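(* Let $G$ be a weakly connected oriented graph on $n\ge 2$ vertices $1,\dots,n$ with $m\ge 1$ edges $e_1,\dots,e_m$, with non-zero edge weights in $\mathbb{C}\setminus\mathbb{R}^-$ and complex signless Laplacian matrix $Q$. Suppose that $G$ contains cycles and that there exists an odd cycle $C$ with $wt(C)\in\mathbb{C}\setminus\mathbb{R}^-$ or an even cycle $C$ with $wt(C)\in\mathbb{C}\setminus\mathbb{R}^+$. Let $\mathcal{U}(G)$ be the set of all spanning subgraphs $H$ of $G$ with $n$ edges all of whose connected components $U_1,\dots,U_{c(H)}$ are unicyclic, such that the cycle $C_t$ of $U_t$ satisfies $wt(C_t)\in\mathbb{C}\setminus\mathbb{R}^+$ whenever it is even and $wt(C_t)\in\mathbb{C}\setminus\mathbb{R}^-$ whenever it is odd. For $H\in\mathcal{U}(G)$ put $$\pi(H)=\prod_{t=1}^{c(H)}2|W_{U_t\setminus C_t}|\,\alpha(C_t),$$ where $\alpha(C_t)=|wt(C_t)|-\operatorname{Re}(wt(C_t))$ if $C_t$ is even and $\alpha(C_t)=|wt(C_t)|+\operatorname{Re}(wt(C_t))$ if $C_t$ is odd, and let $\operatorname{vol}^2(N)=\sum_{H\in\mathcal{U}(G)}\pi(H)$ and $\operatorname{vol}^4(N)=(\operatorname{vol}^2(N))^2$. Then the Moore--Penrose inverse $Q^+$ of $Q$ has entries $$(Q^+)_{ij}=\frac{1}{\operatorname{vol}^4(N)}\sum_{k=1}^m\ \sum_{\substack{H_r,H_s\in\mathcal{U}(G)\\ e_k\in H_r\cap H_s}}\pi(H_r)\,\pi(H_s)\,\overline{(N^+_{H_r})_{ki}}\,(N^+_{H_s})_{kj},$$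 where, for $H\in\mathcal{U}(G)$ and $e_k=(u,v)$ in the component $U_r$ of $H$ with cycle $C_r$, $$(N_H^+)_{kj}=\begin{cases}(-1)^{d^*(j,u)}\dfrac{\frac{wt(\gamma_{u\to j})}{|wt(\gamma_{u\to j})|}}{\sqrt{\overline{w_{uv}}}\left(\frac{w_{uv}}{|w_{uv}|}-\varepsilon\,\frac{wt(\gamma_{u\to v})}{|wt(\gamma_{u\to v})|}\right)} & \text{if } e_k\in C_r,\ j\in U_r,\\[3mm] 0 & \text{if } e_k\notin C_r,\ j\in U_r\setminus e_k[C_r],\\[1mm] (-1)^{d^*(j,u)}\dfrac{1}{\sqrt{w_{uv}}}\dfrac{|wt(\gamma_{j\to u})|}{wt(\gamma_{j\to u})} & \text{if } e_k\notin C_r,\ j\in U_r\setminus(e_k,u](C_r),\\[3mm] (-1)^{d^*(j,v)}\dfrac{1}{\sqrt{\overline{w_{uv}}}}\dfrac{|wt(\gamma_{j\to v})|}{wt(\gamma_{j\to v})} & \text{if } e_k\notin C_r,\ j\in U_r\setminus(e_k,v](C_r),\\[2mm] 0 & \text{if } j\notin U_r,\end{cases}$$ with $\varepsilon=1$ if $C_r$ is even and $\varepsilon=-1$ if $C_r$ is odd.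
   Context: An oriented graph $G$ is obtained from a finite simple undirected graph $G_u$ (its underlying graph) by giving each edge exactly one direction; it is weakly connected if $G_u$ is connected. Write $V(G)=\{1,\dots,n\}$ and $E(G)=\{e_1,\dots,e_m\}$. Each directed edge $(u,v)$ (from $u$ to $v$) has a non-zero complex weight $w_{uv}$. $\mathbb{R}^+$ and $\mathbb{R}^-$ denote the positive and the negative real numbers, and $\sqrt{\cdot}$ is the principal square root. The complex adjacency matrix is $A=(a_{ij})$ with $a_{ij}=w_{ij}$ if $(i,j)\in E(G)$, $a_{ij}=\overline{w_{ji}}$ if $(j,i)\in E(G)$, and $a_{ij}=0$ otherwise. The complex signless Laplacian matrix is $Q=D+A$, where $D$ is diagonal with $D_{ii}=\sum_{j\ne i}|a_{ij}|$. One has $Q=NN^*$, where $N=(n_{ij})$ is the $n\times m$ complex signless incidence matrix: for $e_j=(u,v)$, $n_{ij}=\sqrt{w_{uv}}$ if $i=u$, $n_{ij}=\sqrt{\overline{w_{uv}}}$ if $i=v$, and $n_{ij}=0$ otherwise. The weight of a walk $\gamma=(i_1,\dots,i_k)$ in $G_u$ is $wt(\gamma)=\prod_{s=1}^{k-1}a_{i_si_{s+1}}$ (so a trivial one-vertex walk has weight $1$). A cycle of $G$ means a cycle of $G_u$; $wt(C)$ is the weight of the closed walk going once around $C$ in either direction (the two directions give complex conjugate values, so conditions such as $wt(C)\in\mathbb{R}^\pm$ and the value $\operatorname{Re}(wt(C))$ do not depend on the choice). A unicyclic graph is a connected graph (weakly connected, for oriented graphs) with exactly one cycle; a spanning subgraph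 of $G$ has vertex set $V(G)$. $U_t\setminus C_t$ is obtained from $U_t$ by removing the edges of $C_t$, and $W_F$ is the product of all edge weights of an oriented graph $F$ (equal to $1$ if $F$ has no edges). $N_H$ is the complex signless incidence matrix of $H$; rows of its Moore--Penrose inverse $N_H^+$ are labelled by the edges of $H$ (keeping the labels from $G$) and columns by the vertices. If $e_k=(u,v)$ is an edge of $U_r$ not in $C_r$, then removing $e_k$ from $U_r$ leaves two components: a unicyclic one, denoted $U_r\setminus e_k[C_r]$, and a tree; the tree is denoted $U_r\setminus(e_k,u](C_r)$ if it contains $u$ and $U_r\setminus(e_k,v](C_r)$ if it contains $v$. For vertices $s,t$, $d^*(s,t)$ and $\gamma_{s\to t}$ denote the distance and the unique walk without repeated vertices from $s$ to $t$ in the underlying graph of $U_r$ with $e_k$ removed (if $e_k\in C_r$ this is a tree; if $e_k\notin C_r$ they are only used inside its tree component). *)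

theory Defs
  imports
    Complex_Main
    "Graph_Theory.Digraph_Component"
    "Jordan_Normal_Form.Schur_Decomposition"
    "Jordan_Normal_Form.DL_Missing_Sublist"
begin

section \<open>Oriented graphs and the cycles of the underlying graph\<close>

text \<open>
  The library locale \<^locale>\<open>digraph\<close> is finite, loop-free and without parallel arcs;
  an oriented graph moreover has at most one arc between two vertices.  The underlying
  undirected graph is \<^const>\<open>mk_symmetric\<close>, and the library predicate
  \<^const>\<open>Digraph_Component.connected\<close> is weak connectedness.
\<close>

definition oriented_graph :: "('a, 'b) pre_digraph \<Rightarrow> bool" where
  "oriented_graph G \<longleftrightarrow>
     digraph G \<and> (\<forall>u v. (u, v) \<in> arcs_ends G \<longrightarrow> (v, u) \<notin> arcs_ends G)"

text \<open>
  A walk \<open>(i\<^sub>1, \<dots>, i\<^sub>k)\<close> in the underlying graph is the list of its steps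
  \<open>[(i\<^sub>1, i\<^sub>2), \<dots>, (i\<^sub>k\<^sub>-\<^sub>1, i\<^sub>k)]\<close>, that is, an arc walk of \<^term>\<open>mk_symmetric G\<close>.
  The library notion of cycle admits the closed walk \<open>u, v, u\<close> of length two, which is
  not a cycle of an undirected graph.
\<close>

definition cycle_walk :: "('a, 'b) pre_digraph \<Rightarrow> ('a \<times> 'a) awalk \<Rightarrow> bool" where
  "cycle_walk G p \<longleftrightarrow> pre_digraph.cycle (with_proj (mk_symmetric G)) p \<and> 3 \<le> length p"

definition walk_edges :: "('a, 'b) pre_digraph \<Rightarrow> ('a \<times> 'a) awalk \<Rightarrow> 'b set" where
  "walk_edges G p =
     {e \<in> arcs G. (tail G e, head G e) \<in> set p \<or> (head G e, tail G e) \<in> set p}"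

text \<open>
  A cycle has many traversals (starting point and direction); as a subgraph it is
  identified with its set of edges.  In particular its length is its cardinality.
\<close>

definition cycles :: "('a, 'b) pre_digraph \<Rightarrow> 'b set set" where
  "cycles G = walk_edges G ` {p. cycle_walk G p}"

definition unicyclic :: "('a, 'b) pre_digraph \<Rightarrow> bool" where
  "unicyclic G \<longleftrightarrow> Digraph_Component.connected G \<and> (\<exists>!C. C \<in> cycles G)"

definition undirected_tree :: "('a, 'b) pre_digraph \<Rightarrow> bool" where
  "undirected_tree G \<longleftrightarrow> Digraph_Component.connected G \<and> cycles G = {}"

definition the_cycle :: "('a, 'b) pre_digraph \<Rightarrow> 'b set" where
  "the_cycle G = (THE C. C \<in> cycles G)"

definition weak_components :: "('a, 'b) pre_digraph \<Rightarrow> ('a, 'b) pre_digraph set" where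
  "weak_components G = {U. pre_digraph.max_subgraph G Digraph_Component.connected U}"

definition undirected_dist :: "('a, 'b) pre_digraph \<Rightarrow> 'a \<Rightarrow> 'a \<Rightarrow> nat" where
  "undirected_dist G s t =
     (LEAST l. \<exists>p. pre_digraph.awalk (with_proj (mk_symmetric G)) s p t \<and> length p = l)"

definition undirected_path :: "('a, 'b) pre_digraph \<Rightarrow> 'a \<Rightarrow> 'a \<Rightarrow> ('a \<times> 'a) awalk" where
  "undirected_path G s t =
     (THE p. pre_digraph.apath (with_proj (mk_symmetric G)) s p t)"


section \<open>Matrices of a weighted oriented graph\<close>

text \<open>
  \<open>w u v\<close> is the weight of the arc from \<open>u\<close> to \<open>v\<close>; its values at other pairs are
  never used.  Vertices are \<open>0, \<dots>, n - 1\<close>, following the 0-based indexing of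
  the matrix library.
\<close>

definition adj_entry ::
    "('a, 'b) pre_digraph \<Rightarrow> ('a \<Rightarrow> 'a \<Rightarrow> complex) \<Rightarrow> 'a \<Rightarrow> 'a \<Rightarrow> complex" where
  "adj_entry G w i j =
     (if (i, j) \<in> arcs_ends G then w i j
      else if (j, i) \<in> arcs_ends G then cnj (w j i)
      else 0)"

definition adjacency_mat ::
    "(nat, 'b) pre_digraph \<Rightarrow> (nat \<Rightarrow> nat \<Rightarrow> complex) \<Rightarrow> complex mat" where
  "adjacency_mat G w =
     mat (card (verts G)) (card (verts G)) (\<lambda>(i, j). adj_entry G w i j)"

definition degree_mat ::
    "(nat, 'b) pre_digraph \<Rightarrow> (nat \<Rightarrow> nat \<Rightarrow> complex) \<Rightarrow> complex mat" where
  "degree_mat G w =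
     mat (card (verts G)) (card (verts G))
       (\<lambda>(i, j). if i = j
                 then complex_of_real (\<Sum>k \<in> verts G - {i}. cmod (adj_entry G w i k))
                 else 0)"

definition signless_laplacian ::
    "(nat, 'b) pre_digraph \<Rightarrow> (nat \<Rightarrow> nat \<Rightarrow> complex) \<Rightarrow> complex mat" where
  "signless_laplacian G w = degree_mat G w + adjacency_mat G w"

text \<open>
  Columns of the incidence matrix are labelled by the arcs in increasing order:
  column \<open>l\<close> belongs to the arc \<open>pick (arcs H) l\<close>, the \<open>l\<close>-th smallest one, and
  conversely the arc \<open>k\<close> labels column \<open>edge_pos H k\<close>.  If the arcs are
  \<open>{0..<m}\<close>, both maps are the identity; a subgraph keeps the arc names of the
  ambient graph.
\<close>

definition edge_pos :: "('a, nat) pre_digraph \<Rightarrow> nat \<Rightarrow> nat" where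
  "edge_pos H k = card {l \<in> arcs H. l < k}"

definition incidence_mat ::
    "(nat, nat) pre_digraph \<Rightarrow> (nat \<Rightarrow> nat \<Rightarrow> complex) \<Rightarrow> complex mat" where
  "incidence_mat H w =
     mat (card (verts H)) (card (arcs H))
       (\<lambda>(i, l). let e = pick (arcs H) l; u = tail H e; v = head H e in
                 if i = u then csqrt (w u v)
                 else if i = v then csqrt (cnj (w u v))
                 else 0)"

definition is_mp_inverse :: "complex mat \<Rightarrow> complex mat \<Rightarrow> bool" where
  "is_mp_inverse A X \<longleftrightarrow>
     X \<in> carrier_mat (dim_col A) (dim_row A) \<and>
     A * X * A = A \<and>
     X * A * X = X \<and>
     mat_adjoint (A * X) = A * X \<and>
     mat_adjoint (X * A) = X * A"

definition mp_inverse :: "complex mat \<Rightarrow> complex mat" where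
  "mp_inverse A = (THE X. is_mp_inverse A X)"

text \<open>The entry \<open>(N\<^sub>H\<^sup>+)\<^sub>k\<^sub>j\<close>, where \<open>k\<close> is an arc of \<open>H\<close> and \<open>j\<close> a vertex.\<close>

definition incidence_pinv ::
    "(nat, nat) pre_digraph \<Rightarrow> (nat \<Rightarrow> nat \<Rightarrow> complex) \<Rightarrow> nat \<Rightarrow> nat \<Rightarrow> complex" where
  "incidence_pinv H w k j = mp_inverse (incidence_mat H w) $$ (edge_pos H k, j)"


section \<open>Weights of walks, cycles and subgraphs\<close>

definition pos_reals :: "complex set" where
  "pos_reals = complex_of_real ` {0<..}"

definition neg_reals :: "complex set" where
  "neg_reals = complex_of_real ` {..<0}"

definition walk_wt ::
    "('a, 'b) pre_digraph \<Rightarrow> ('a \<Rightarrow> 'a \<Rightarrow> complex) \<Rightarrow> ('a \<times> 'a) awalk \<Rightarrow> complex" where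
  "walk_wt G w p = (\<Prod>(x, y) \<leftarrow> p. adj_entry G w x y)"

text \<open>
  The weight of a cycle is only determined up to complex conjugation, depending on the
  direction of the chosen traversal; it is only used through its real part, its modulus
  and membership in the sets of positive and negative reals.
\<close>

definition cycle_wt ::
    "('a, 'b) pre_digraph \<Rightarrow> ('a \<Rightarrow> 'a \<Rightarrow> complex) \<Rightarrow> 'b set \<Rightarrow> complex" where
  "cycle_wt G w C = walk_wt G w (SOME p. cycle_walk G p \<and> walk_edges G p = C)"

definition edges_wt ::
    "('a, 'b) pre_digraph \<Rightarrow> ('a \<Rightarrow> 'a \<Rightarrow> complex) \<Rightarrow> complex" where
  "edges_wt F w = (\<Prod>e \<in> arcs F. w (tail F e) (head F e))"

definition del_edges :: "('a, 'b) pre_digraph \<Rightarrow> 'b set \<Rightarrow> ('a, 'b) pre_digraph" where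
  "del_edges U C = U\<lparr>arcs := arcs U - C\<rparr>"

definition cycle_alpha ::
    "('a, 'b) pre_digraph \<Rightarrow> ('a \<Rightarrow> 'a \<Rightarrow> complex) \<Rightarrow> 'b set \<Rightarrow> real" where
  "cycle_alpha G w C =
     (if even (card C) then cmod (cycle_wt G w C) - Re (cycle_wt G w C)
      else cmod (cycle_wt G w C) + Re (cycle_wt G w C))"

text \<open>The family \<open>\<U>(G)\<close>.\<close>

definition unicyclic_family ::
    "('a, 'b) pre_digraph \<Rightarrow> ('a \<Rightarrow> 'a \<Rightarrow> complex) \<Rightarrow> ('a, 'b) pre_digraph set" where
  "unicyclic_family G w =
     {H. spanning H G \<and> card (arcs H) = card (verts G) \<and>
         (\<forall>U \<in> weak_components H. unicyclic U \<and>
            (even (card (the_cycle U)) \<longrightarrow> cycle_wt G w (the_cycle U) \<notin> pos_reals) \<and>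
            (odd (card (the_cycle U)) \<longrightarrow> cycle_wt G w (the_cycle U) \<notin> neg_reals))}"

definition subgraph_pi ::
    "('a, 'b) pre_digraph \<Rightarrow> ('a \<Rightarrow> 'a \<Rightarrow> complex) \<Rightarrow> ('a, 'b) pre_digraph \<Rightarrow> real" where
  "subgraph_pi G w H =
     (\<Prod>U \<in> weak_components H.
        2 * cmod (edges_wt (del_edges U (the_cycle U)) w) * cycle_alpha G w (the_cycle U))"

definition vol2 :: "('a, 'b) pre_digraph \<Rightarrow> ('a \<Rightarrow> 'a \<Rightarrow> complex) \<Rightarrow> real" where
  "vol2 G w = (\<Sum>H \<in> unicyclic_family G w. subgraph_pi G w H)"

definition vol4 :: "('a, 'b) pre_digraph \<Rightarrow> ('a \<Rightarrow> 'a \<Rightarrow> complex) \<Rightarrow> real" where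
  "vol4 G w = (vol2 G w)\<^sup>2"


section \<open>The combinatorial expression for the entries of \<open>N\<^sub>H\<^sup>+\<close>\<close>

text \<open>
  For an arc \<open>k\<close> of a unicyclic graph \<open>U\<close> off its cycle, removing \<open>k\<close> leaves a unicyclic
  component and a tree component.
\<close>

definition unicyclic_part :: "('a, 'b) pre_digraph \<Rightarrow> 'b \<Rightarrow> ('a, 'b) pre_digraph" where
  "unicyclic_part U k =
     (THE X. X \<in> weak_components (pre_digraph.del_arc U k) \<and> unicyclic X)"

definition tree_part :: "('a, 'b) pre_digraph \<Rightarrow> 'b \<Rightarrow> ('a, 'b) pre_digraph" where
  "tree_part U k =
     (THE X. X \<in> weak_components (pre_digraph.del_arc U k) \<and> undirected_tree X)"

text \<open>
  \<open>U\<close> is the component containing the arc \<open>k\<close>.  In the last two branches \<open>j\<close> lies in the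
  tree component of \<open>U\<close> without \<open>k\<close>, which contains exactly one of the two ends \<open>u\<close>, \<open>v\<close>
  of \<open>k\<close>; the final branch is the one where it contains \<open>v\<close>.
\<close>

definition pinv_entry ::
    "('a, 'b) pre_digraph \<Rightarrow> ('a \<Rightarrow> 'a \<Rightarrow> complex) \<Rightarrow> ('a, 'b) pre_digraph \<Rightarrow> 'b \<Rightarrow> 'a \<Rightarrow> complex"
  where
  "pinv_entry G w U k j =
     (let u = tail G k; v = head G k; C = the_cycle U;
          F = pre_digraph.del_arc U k;
          d = undirected_dist F;
          wt = (\<lambda>s t. walk_wt G w (undirected_path F s t));
          \<epsilon> = (if even (card C) then 1 else - 1 :: complex)
      in
      if j \<notin> verts U then 0
      else if k \<in> C then
        (- 1) ^ d j u *
        ((wt u j / complex_of_real (cmod (wt u j))) /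
         (csqrt (cnj (w u v)) *
          (w u v / complex_of_real (cmod (w u v)) -
           \<epsilon> * (wt u v / complex_of_real (cmod (wt u v))))))
      else if j \<in> verts (unicyclic_part U k) then 0
      else if u \<in> verts (tree_part U k) then
        (- 1) ^ d j u * (1 / csqrt (w u v)) * (complex_of_real (cmod (wt j u)) / wt j u)
      else
        (- 1) ^ d j v * (1 / csqrt (cnj (w u v))) * (complex_of_real (cmod (wt j v)) / wt j v))"

end

theory Submission
  imports Defs "HOL-Combinatorics.Cycles" "HOL-Combinatorics.Orbits"
begin

text \<open>
  A nonzero Leibniz term of the determinant of a square incidence matrix assigns to every vertex
  \<open>v\<close> its own incident arc; with \<open>f v\<close> the other end of that arc, the subgraph becomes the graph
  of the function \<open>f\<close>, its components are the basins of the cycles of \<open>f\<close>, and the determinant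
  factors over these cycles.  Hence the squared modulus of the determinant is \<open>\<pi>(H)\<close>, and it
  vanishes exactly outside the family \<open>\<U>(G)\<close>.

  Put \<open>Y = (1 / vol\<^sup>2) \<Sum>\<^sub>H \<pi>(H) N\<^sub>H\<^sup>-\<^sup>1\<close>, the inverses being padded with zero rows.  Then \<open>N Y = 1\<close>
  is clear, and \<open>Y N\<close> is Hermitian because, by Cramer's rule, exchanging an arc \<open>k\<close> of \<open>H\<close> for an
  arc \<open>l\<close> matches the summands of the entries \<open>(k, l)\<close> and \<open>(l, k)\<close>.  Therefore \<open>Y\<^sup>* Y\<close> inverts
  \<open>Q = N N\<^sup>*\<close>, with no appeal to the Cauchy-Binet formula.

  A row of \<open>N\<^sub>H\<^sup>-\<^sup>1\<close> is multiplied by minus the phase of the adjacency entry along every arc other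
  than its own, so it is determined by following paths, and it vanishes on every component that
  still contains a cycle.
\<close>

section \<open>Determinants of functional graphs\<close>

text \<open>The formula for \<open>Y\<close> is the classical expression of a Moore-Penrose inverse
  as an average of the inverses of maximal square submatrices, weighted by the squared moduli of
  their determinants. The double sum over pairs of subgraphs is the product of two such averages,
  and each of them contributes one factor \<open>vol2\<close> to the denominator. A cycle of good
  weight supplies one invertible submatrix, so that \<open>vol2\<close> is positive and both
  pseudoinverses in the theorem are ordinary inverses. The factor \<open>2 * cycle_alpha\<close> has
  a simple origin: a cycle enters the determinant through two terms x and y of equal modulus, with x
  times the conjugate of y equal to the cycle weight up to conjugation. The main obstacle is
  translation. The definitions speak of arbitrary traversals, arc sets, maximal connected subgraphs,
  and paths given by definite descriptions, whereas the determinant only sees a function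
  \<open>f\<close> on vertices. Most of the graph theory below shows that cycles, components, trees
  and paths are what iteration of \<open>f\<close> says they are.\<close>

lemma orbit_enumeration:
  assumes "x \<in> orbit f x"
  obtains k where "0 < k" "orbit f x = (\<lambda>i. (f ^^ i) x) ` {..<k}"
    "inj_on (\<lambda>i. (f ^^ i) x) {..<k}" "(f ^^ k) x = x" "card (orbit f x) = k"
proof -
  let ?k = "funpow_dist1 f x x"
  have "orbit f x = (\<lambda>i. (f ^^ i) x) ` {..<?k}" "inj_on (\<lambda>i. (f ^^ i) x) {..<?k}"
    using orbit_conv_funpow_dist1[OF assms] inj_on_funpow_dist1[OF assms]
    by (simp_all add: atLeast0LessThan)
  moreover from this have "card (orbit f x) = ?k"
    by (simp add: card_image)
  moreover have "(f ^^ ?k) x = x"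
    using funpow_dist1_prop[OF assms] .
  ultimately show ?thesis using that by blast
qed

lemma sign_cycle_of_list:
  "distinct cs \<Longrightarrow> sign (cycle_of_list cs) = (-1) ^ (length cs - 1)"
proof (induction cs rule: cycle_of_list.induct)
  case (1 i j cs)
  have "permutation (cycle_of_list (j # cs))"
    by (rule permutation_of_cycle)
  then have "sign (cycle_of_list (i # j # cs)) = sign (transpose i j) * sign (cycle_of_list (j # cs))"
    using sign_compose[OF permutation_swap_id] by simp
  then show ?case
    using 1 by (simp add: sign_swap_id comp_def)
qed simp_all

text \<open>Listing \<open>C\<close> as x, f x, f (f x) and so on turns \<open>f\<close> into a
  rotation of the list, which is how \<open>cycle_of_list\<close> acts. This gives access to signs
  although \<open>f\<close> need not be injective outside \<open>C\<close>.\<close>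

lemma perm_restrict_cyclic_eq_cycle_of_list:
  assumes "cyclic_on f C"
  obtains cs where "distinct cs" "set cs = C" "perm_restrict f C = cycle_of_list cs"
proof -
  obtain x where x: "x \<in> C" "C = orbit f x"
    using assms by (auto simp: cyclic_on_def)
  then obtain k where k: "0 < k" "orbit f x = (\<lambda>i. (f ^^ i) x) ` {..<k}"
    "inj_on (\<lambda>i. (f ^^ i) x) {..<k}" "(f ^^ k) x = x"
    using orbit_enumeration[of x f] by metis
  define cs where "cs = map (\<lambda>i. (f ^^ i) x) [0..<k]"
  have dist: "distinct cs" and set: "set cs = C"
    using k x by (auto simp: cs_def distinct_map atLeast0LessThan)
  have rot: "map (cycle_of_list cs) cs = rotate1 cs"
    using cyclic_rotation[OF dist, of 1] by simp
  have "cycle_of_list cs ((f ^^ i) x) = f ((f ^^ i) x)" if "i < k" for i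
  proof -
    have "cycle_of_list cs ((f ^^ i) x) = map (cycle_of_list cs) cs ! i"
      using that by (simp add: cs_def)
    also have "\<dots> = (f ^^ (Suc i mod k)) x"
      unfolding rot using that k by (subst nth_rotate1) (auto simp: cs_def)
    also have "\<dots> = (f ^^ Suc i) x"
      using that k by (cases "Suc i = k") auto
    finally show ?thesis by simp
  qed
  then have "perm_restrict f C = cycle_of_list cs"
    using set x k id_outside_supp[of _ cs] by (auto simp: perm_restrict_def fun_eq_iff)
  with dist set show ?thesis by (rule that)
qed

lemma sign_perm_restrict_cyclic:
  assumes "cyclic_on f C"
  shows "perm_restrict f C permutes C" "sign (perm_restrict f C) = (-1) ^ (card C - 1)"
proof -
  obtain cs where "distinct cs" "set cs = C" "perm_restrict f C = cycle_of_list cs"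
    using perm_restrict_cyclic_eq_cycle_of_list[OF assms] .
  then show "perm_restrict f C permutes C" "sign (perm_restrict f C) = (-1) ^ (card C - 1)"
    using cycle_permutes[of cs] sign_cycle_of_list[of cs] by (auto simp: distinct_card)
qed

text \<open>Restrictions to disjoint cycles compose to the restriction to their union, so the signs
  multiply.\<close>

lemma sign_perm_restrict_Union:
  assumes "finite T" "\<And>C. C \<in> T \<Longrightarrow> cyclic_on f C" "pairwise disjnt T"
  shows "perm_restrict f (\<Union>T) permutes \<Union>T \<and>
    sign (perm_restrict f (\<Union>T)) = (\<Prod>C\<in>T. (-1) ^ (card C - 1))"
  using assms
proof (induction T rule: finite_induct)
  case empty
  then show ?case
    by (simp add: perm_restrict_def id_def)
next
  case (insert C T)
  have fin: "finite C" "finite (\<Union>T)"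
    using insert finite_cyclic_on by auto
  have IH: "perm_restrict f (\<Union>T) permutes \<Union>T"
    "sign (perm_restrict f (\<Union>T)) = (\<Prod>C\<in>T. (-1) ^ (card C - 1))"
    using insert by (auto simp: pairwise_insert)
  have C: "perm_restrict f C permutes C" "sign (perm_restrict f C) = (-1) ^ (card C - 1)"
    using sign_perm_restrict_cyclic[OF insert.prems(1)[of C]] by simp_all
  have "C \<inter> \<Union>T = {}"
    using insert by (auto simp: pairwise_insert disjnt_def)
  then have eq: "perm_restrict f (\<Union>(insert C T)) = perm_restrict f C \<circ> perm_restrict f (\<Union>T)"
    using perm_restrict_union[OF C(1) IH(1)] by simp
  have perms: "permutation (perm_restrict f C)" "permutation (perm_restrict f (\<Union>T))"
    using C(1) IH(1) fin permutation_permutes by blast+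
  have "perm_restrict f (\<Union>(insert C T)) permutes \<Union>(insert C T)"
    unfolding eq using permutes_compose[OF permutes_subset[OF IH(1)] permutes_subset[OF C(1)]] by simp
  moreover have "sign (perm_restrict f (\<Union>(insert C T))) = (\<Prod>C\<in>insert C T. (-1) ^ (card C - 1))"
    unfolding eq sign_compose[OF perms] using insert C IH by simp
  ultimately show ?case by blast
qed

definition periodic_orbits :: "('a \<Rightarrow> 'a) \<Rightarrow> 'a set \<Rightarrow> 'a set set" where
  "periodic_orbits f V = {C. C \<subseteq> V \<and> cyclic_on f C}"

lemma pairwise_disjnt_periodic_orbits: "pairwise disjnt (periodic_orbits f V)"
  unfolding pairwise_def periodic_orbits_def disjnt_iff
  by (auto simp: cyclic_on_alldef)

lemma finite_periodic_orbits: "finite V \<Longrightarrow> finite (periodic_orbits f V)"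
  unfolding periodic_orbits_def by (rule finite_subset[of _ "Pow V"]) auto

lemma Union_cyclic_inject:
  assumes "T \<subseteq> periodic_orbits f V" "T' \<subseteq> periodic_orbits f V" "\<Union>T = \<Union>T'"
  shows "T \<subseteq> T'"
proof
  fix C assume C: "C \<in> T"
  then obtain x where x: "x \<in> C" "C = orbit f x"
    using assms by (auto simp: periodic_orbits_def cyclic_on_def)
  then obtain D where D: "D \<in> T'" "x \<in> D"
    using C assms by blast
  then have "D = C"
    using assms x by (auto simp: periodic_orbits_def cyclic_on_alldef)
  with D show "C \<in> T'" by simp
qed

text \<open>By injectivity \<open>p\<close> maps the set \<open>A\<close> of moved points into
  itself, and on \<open>A\<close> it agrees with \<open>f\<close>; hence the orbits of
  \<open>p\<close> inside \<open>A\<close> are cycles of \<open>f\<close>.\<close>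

lemma permutation_moves_along_function:
  assumes fin: "finite V" and p: "p permutes V" and f: "\<And>v. v \<in> V \<Longrightarrow> f v \<noteq> v"
    and pf: "\<And>v. v \<in> V \<Longrightarrow> p v = v \<or> p v = f v"
  shows "\<exists>T\<subseteq>periodic_orbits f V. p = perm_restrict f (\<Union>T)"
proof -
  define A where "A = {v \<in> V. p v \<noteq> v}"
  have inj: "inj p" using p permutes_inj by blast
  have pA: "p v \<in> A" if "v \<in> A" for v
    using that p inj by (auto simp: A_def permutes_in_image dest: injD)
  have orb: "orbit p x \<subseteq> A" if "x \<in> A" for x
  proof
    fix y assume "y \<in> orbit p x"
    then show "y \<in> A" by induction (use that pA in auto)
  qed
  have perm: "permutation p" using fin p permutation_permutes by blast
  have eq: "p v = f v" if "v \<in> A" for v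
    using that pf by (auto simp: A_def)
  have cyc: "cyclic_on f (orbit p x)" if "x \<in> A" for x
    using cyclic_on_orbit'[OF perm, of x] orb[OF that] eq
    by (subst cyclic_cong[of _ f p]) auto
  let ?T = "orbit p ` A"
  have "?T \<subseteq> periodic_orbits f V"
    using cyc orb by (auto simp: periodic_orbits_def A_def)
  moreover have UT: "\<Union>?T = A"
    using orb permutation_self_in_orbit[OF perm] by auto
  have "p v = perm_restrict f A v" for v
    using eq[of v] permutes_not_in[OF p, of v] by (cases "v \<in> A") (auto simp: perm_restrict_def A_def)
  then have "p = perm_restrict f (\<Union>?T)"
    unfolding UT by (rule ext)
  ultimately show ?thesis by blast
qed

text \<open>The nonzero Leibniz terms belong to the permutations that move a union of cycles of
  \<open>f\<close> along \<open>f\<close> and fix everything else.\<close>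

lemma det_functional_mat:
  fixes a b :: "nat \<Rightarrow> 'a :: comm_ring_1"
  assumes fV: "\<And>v. v < n \<Longrightarrow> f v < n" and f: "\<And>v. v < n \<Longrightarrow> f v \<noteq> v"
  shows "det (mat n n (\<lambda>(i, j). if i = j then a j else if i = f j then b j else 0)) =
    (\<Prod>C\<in>periodic_orbits f {0..<n}. prod a C + (-1) ^ (card C - 1) * prod b C) *
    prod a ({0..<n} - \<Union>(periodic_orbits f {0..<n}))"
proof -
  let ?V = "{0..<n}" and ?O = "periodic_orbits f {0..<n}"
  let ?M = "mat n n (\<lambda>(i, j). if i = j then a j else if i = f j then b j else 0)"
  let ?t = "\<lambda>p. signof p * (\<Prod>j<n. ?M $$ (p j, j))"
  let ?g = "\<lambda>T. perm_restrict f (\<Union>T)"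
  have finO: "finite ?O" by (rule finite_periodic_orbits) simp
  have perm: "?g T permutes \<Union>T" "signof (?g T) = ((\<Prod>C\<in>T. (-1) ^ (card C - 1)) :: 'a)"
    if "T \<subseteq> ?O" for T
  proof -
    have "cyclic_on f C" if "C \<in> T" for C
      using \<open>T \<subseteq> ?O\<close> that by (auto simp: periodic_orbits_def)
    then have *: "?g T permutes \<Union>T \<and> sign (?g T) = (\<Prod>C\<in>T. (-1) ^ (card C - 1))"
      using sign_perm_restrict_Union[of T f] finite_subset[OF that finO]
        pairwise_subset[OF pairwise_disjnt_periodic_orbits that] by blast
    then show "?g T permutes \<Union>T" by blast
    show "signof (?g T) = ((\<Prod>C\<in>T. (-1) ^ (card C - 1)) :: 'a)"
      using * by simp
  qed
  have sub: "\<Union>T \<subseteq> ?V" if "T \<subseteq> ?O" for T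
    using that by (auto simp: periodic_orbits_def)
  have permV: "?g T permutes ?V" if "T \<subseteq> ?O" for T
    using permutes_subset[OF perm(1) sub] that by blast
  have inj: "inj_on ?g (Pow ?O)"
  proof (rule inj_onI)
    fix T T' assume T: "T \<in> Pow ?O" "T' \<in> Pow ?O" "?g T = ?g T'"
    \<comment> \<open>Since \<open>f\<close> has no fixed point below \<open>n\<close>, the
      permutation determines the union of the chosen cycles as its set of moved points, and the
      union determines the cycles.\<close>
    have moved: "A = {v. perm_restrict f A v \<noteq> v}" if "A \<subseteq> ?V" for A
      using that f by (auto simp: perm_restrict_def)
    have "\<Union>T = \<Union>T'"
      using moved[of "\<Union>T"] moved[of "\<Union>T'"] sub[of T] sub[of T'] T by simp
    then show "T = T'" using Union_cyclic_inject T by (metis PowD subset_antisym)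
  qed
  have "det ?M = (\<Sum>p | p permutes ?V. ?t p)"
    by (rule det_col) simp
  also have "\<dots> = (\<Sum>p\<in>?g ` Pow ?O. ?t p)"
  proof (rule sum.mono_neutral_right)
    show "\<forall>p\<in>{p. p permutes ?V} - ?g ` Pow ?O. ?t p = 0"
    proof
      fix p assume p: "p \<in> {p. p permutes ?V} - ?g ` Pow ?O"
      then have "\<not> (\<exists>T\<subseteq>?O. p = ?g T)" by auto
      then obtain v where v: "v < n" "p v \<noteq> v" "p v \<noteq> f v"
        using permutation_moves_along_function[of ?V p f] p f by auto
      then have "p v < n"
        using p permutes_in_image[of p ?V v] by auto
      with v have "?M $$ (p v, v) = 0" by simp
      then have "(\<Prod>j<n. ?M $$ (p j, j)) = 0"
        using v by (intro prod_zero) auto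
      then show "?t p = 0" by simp
    qed
  qed (use permV in \<open>auto simp: finite_permutations\<close>)
  also have "\<dots> = (\<Sum>T\<in>Pow ?O. ?t (?g T))"
    using inj by (simp add: sum.reindex)
  also have "\<dots> = (\<Sum>T\<in>Pow ?O. (\<Prod>C\<in>T. (-1) ^ (card C - 1) * prod b C) * (\<Prod>C\<in>?O - T. prod a C)
      * prod a (?V - \<Union>?O))"
  proof (rule sum.cong[OF refl])
    fix T assume "T \<in> Pow ?O"
    then have T: "T \<subseteq> ?O" by simp
    have "(\<Prod>j<n. ?M $$ (?g T j, j)) = (\<Prod>j\<in>?V. if j \<in> \<Union>T then b j else a j)"
      unfolding atLeast0LessThan
      by (rule prod.cong) (use f fV in \<open>auto simp: perm_restrict_def\<close>)
    also have "\<dots> = prod b (\<Union>T) * prod a (?V - \<Union>T)"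
    proof -
      have "?V \<inter> {j. \<exists>x\<in>T. j \<in> x} = \<Union>T" "?V \<inter> - {j. \<exists>x\<in>T. j \<in> x} = ?V - \<Union>T"
        using sub[OF T] by auto
      then show ?thesis by (simp add: prod.If_cases)
    qed
    also have "?V - \<Union>T = \<Union>(?O - T) \<union> (?V - \<Union>?O)"
    proof -
      have "C \<inter> D = {}" if "C \<in> ?O - T" "D \<in> T" for C D
        using that T pairwise_disjnt_periodic_orbits[of f ?V]
        unfolding pairwise_def disjnt_def by (metis DiffE subsetD)
      then have "\<Union>(?O - T) \<inter> \<Union>T = {}"
        by blast
      moreover have "\<Union>?O = \<Union>(?O - T) \<union> \<Union>T"
        using T by auto
      ultimately show ?thesis using sub[of ?O] by blast
    qed
    also have "prod a \<dots> = prod a (\<Union>(?O - T)) * prod a (?V - \<Union>?O)"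
      by (rule prod.union_disjoint) (use sub[of ?O] in \<open>auto intro: finite_subset[of _ ?V]\<close>)
    also have "prod a (\<Union>(?O - T)) = (\<Prod>C\<in>?O - T. prod a C)"
      using pairwise_disjnt_periodic_orbits[of f ?V]
      by (subst prod.Union_disjoint)
        (auto simp: periodic_orbits_def finite_cyclic_on pairwise_def disjnt_def)
    also have "prod b (\<Union>T) = (\<Prod>C\<in>T. prod b C)"
      using pairwise_disjnt_periodic_orbits[of f ?V] T
      by (subst prod.Union_disjoint)
        (auto simp: periodic_orbits_def finite_cyclic_on pairwise_def disjnt_def subset_iff)
    finally show "?t (?g T) = (\<Prod>C\<in>T. (-1) ^ (card C - 1) * prod b C) * (\<Prod>C\<in>?O - T. prod a C)
      * prod a (?V - \<Union>?O)"
      using perm(2)[OF T] by (simp add: prod.distrib mult_ac)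
  qed
  \<comment> \<open>The sum over all subsets \<open>T\<close> is the expansion of a product of
    binomials: each cycle is either moved along \<open>f\<close> or fixed pointwise.\<close>
  also have "\<dots> = (\<Prod>C\<in>?O. (-1) ^ (card C - 1) * prod b C + prod a C) * prod a (?V - \<Union>?O)"
    unfolding prod_add[OF finO] sum_distrib_right ..
  finally show ?thesis by (simp add: add.commute)
qed

section \<open>Cycles and components of functional graphs\<close>

lemma parcs_mk_symmetric_iff:
  "(x, y) \<in> parcs (mk_symmetric H) \<longleftrightarrow>
    (\<exists>a\<in>arcs H. (tail H a, head H a) = (x, y) \<or> (tail H a, head H a) = (y, x))"
  by (auto simp: parcs_mk_symmetric)

lemma sym_parcs_mk_symmetric: "sym (parcs (mk_symmetric H))"
  by (auto simp: sym_def parcs_mk_symmetric_iff)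

lemma awalk_mk_symmetric_iff:
  "pre_digraph.awalk (with_proj (mk_symmetric H)) u p v \<longleftrightarrow>
    u \<in> verts H \<and> set p \<subseteq> parcs (mk_symmetric H) \<and> pcas u p v"
  by (simp add: pre_digraph.awalk_def cas_with_proj_eq)

lemma pcas_enumeration:
  assumes "pcas u p v"
  obtains x where "x 0 = u" "x (length p) = v"
    "p = map (\<lambda>i. (x i, x (Suc i))) [0..<length p]"
    "pawalk_verts u p = map x [0..<Suc (length p)]"
proof -
  have "\<exists>x. x 0 = u \<and> x (length p) = v \<and> p = map (\<lambda>i. (x i, x (Suc i))) [0..<length p] \<and>
      pawalk_verts u p = map x [0..<Suc (length p)]"
    using assms
  proof (induction p arbitrary: u)
    case (Cons s p)
    then obtain x where x: "x 0 = snd s" "x (length p) = v"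
      "p = map (\<lambda>i. (x i, x (Suc i))) [0..<length p]"
      "pawalk_verts (snd s) p = map x [0..<Suc (length p)]"
      by auto
    let ?y = "case_nat u x"
    have upt: "[0..<Suc k] = 0 # map Suc [0..<k]" for k
      by (simp add: map_Suc_upt upt_conv_Cons)
    have "s # p = map (\<lambda>i. (?y i, ?y (Suc i))) [0..<length (s # p)]"
      using Cons.prems x(1,3) unfolding list.size(4) add_Suc_right add_0_right upt
      by (simp add: prod_eq_iff comp_def)
    moreover have "pawalk_verts u (s # p) = map ?y [0..<Suc (length (s # p))]"
      using Cons.prems x(4) unfolding list.size(4) add_Suc_right add_0_right upt[of "Suc (length p)"]
      by (simp add: comp_def del: upt_Suc)
    ultimately show ?case
      using x(2) by (intro exI[of _ ?y]) simp
  qed (auto intro!: exI[of _ "\<lambda>_. v"])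
  then show ?thesis using that by blast
qed

lemma pcas_map: "j \<le> k \<Longrightarrow> pcas (x j) (map (\<lambda>i. (x i, x (Suc i))) [j..<k]) (x k)"
  by (induction j rule: inc_induct) (auto simp: upt_conv_Cons)

lemma pawalk_verts_map:
  "j \<le> k \<Longrightarrow> pawalk_verts (x j) (map (\<lambda>i. (x i, x (Suc i))) [j..<k]) = map x [j..<Suc k]"
  by (induction j rule: inc_induct) (auto simp: upt_conv_Cons simp del: upt_Suc)

text \<open>A cycle is presented as a periodic sequence over all natural numbers, so that later
  arguments can pass to the next vertex without treating the closing step separately.\<close>

lemma cycle_walkE:
  assumes "cycle_walk H p"
  obtains k x where "3 \<le> k" "\<And>i. x (i + k) = x i" "inj_on x {..<k}"
    "\<And>i. (x i, x (Suc i)) \<in> parcs (mk_symmetric H)"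
    "p = map (\<lambda>i. (x i, x (Suc i))) [0..<k]"
proof -
  obtain u where u: "set p \<subseteq> parcs (mk_symmetric H)" "pcas u p u" "distinct (tl (pawalk_verts u p))"
    "3 \<le> length p"
    using assms unfolding cycle_walk_def pre_digraph.cycle_def awalk_mk_symmetric_iff
      awalk_verts_with_proj_eq by blast
  let ?k = "length p"
  obtain x where x: "x 0 = u" "x ?k = u" "p = map (\<lambda>i. (x i, x (Suc i))) [0..<?k]"
    "pawalk_verts u p = map x [0..<Suc ?k]"
    using pcas_enumeration[OF u(2)] by metis
  define y where "y i = x (i mod ?k)" for i
  have xy: "y i = x i" if "i \<le> ?k" for i
    using that x u(4) by (cases "i = ?k") (auto simp: y_def)
  have step: "(x i, x (Suc i)) \<in> parcs (mk_symmetric H)" if "i < ?k" for i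
    using u(1) that by (subst (asm) x(3)) auto
  have "distinct (map x [1..<Suc ?k])"
    using u(3) x(4) by (simp add: map_tl[symmetric] del: upt_Suc)
  then have inj: "inj_on x {1..<Suc ?k}"
    by (simp add: distinct_map del: upt_Suc)
  have "inj_on y {..<?k}"
  proof (rule inj_onI)
    fix i j assume ij: "i \<in> {..<?k}" "j \<in> {..<?k}" "y i = y j"
    \<comment> \<open>Distinctness is known for the tail of the vertex list, that is, at the
      positions 1 to \<open>?k\<close>; replacing 0 by \<open>?k\<close> transports it to the
      positions below \<open>?k\<close>.\<close>
    let ?s = "\<lambda>i. if i = 0 then ?k else i"
    have "x (?s i) = x (?s j)"
      using ij x(1,2) xy[of i] xy[of j] by auto
    then have "?s i = ?s j"
      using ij by (intro inj_onD[OF inj]) auto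
    then show "i = j" using ij by (auto split: if_splits)
  qed
  moreover have "(y i, y (Suc i)) \<in> parcs (mk_symmetric H)" for i
  proof -
    have "y (Suc i) = x (Suc (i mod ?k))"
      using x(1,2) u(4) unfolding y_def mod_Suc by auto
    moreover have "i mod ?k < ?k"
      using u(4) by (intro mod_less_divisor) linarith
    ultimately show ?thesis
      using step[of "i mod ?k"] by (simp only: y_def)
  qed
  moreover have "p = map (\<lambda>i. (y i, y (Suc i))) [0..<?k]"
    by (subst x(3)) (auto simp: xy)
  ultimately show ?thesis
    using u(4) by (intro that[of ?k y]) (auto simp: y_def)
qed

lemma cycle_walkI:
  assumes "3 \<le> k" "x k = x 0" "inj_on x {..<k}" "x 0 \<in> verts H"
    "\<And>i. i < k \<Longrightarrow> (x i, x (Suc i)) \<in> parcs (mk_symmetric H)"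
  shows "cycle_walk H (map (\<lambda>i. (x i, x (Suc i))) [0..<k])"
proof -
  let ?p = "map (\<lambda>i. (x i, x (Suc i))) [0..<k]"
  have "pcas (x 0) ?p (x 0)" "pawalk_verts (x 0) ?p = map x [0..<Suc k]"
    using pcas_map[of 0 k x] pawalk_verts_map[of 0 k x] assms(2) by simp_all
  moreover have "distinct (map x [1..<Suc k])"
  proof -
    have "inj_on x {1..<Suc k}"
    proof (rule inj_onI)
      fix i j assume ij: "i \<in> {1..<Suc k}" "j \<in> {1..<Suc k}" "x i = x j"
      let ?s = "\<lambda>i. if i = k then 0 else i"
      have "x (?s i) = x (?s j)" using ij assms(2) by auto
      then have "?s i = ?s j" using ij by (intro inj_onD[OF assms(3)]) auto
      then show "i = j" using ij by (auto split: if_splits)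
    qed
    then show ?thesis by (simp add: distinct_map del: upt_Suc)
  qed
  moreover have "tl (map x [0..<Suc k]) = map x [1..<Suc k]"
    by (simp add: map_tl[symmetric] del: upt_Suc)
  ultimately show ?thesis
    using assms unfolding cycle_walk_def pre_digraph.cycle_def awalk_mk_symmetric_iff
      awalk_verts_with_proj_eq by (auto intro!: exI[of _ "x 0"])
qed

lemma oriented_graph_arc_eq:
  assumes "oriented_graph H" "a \<in> arcs H" "b \<in> arcs H"
    "{tail H a, head H a} = {tail H b, head H b}"
  shows "a = b"
proof -
  interpret digraph H using assms(1) by (simp add: oriented_graph_def)
  have "\<not> (tail H a = head H b \<and> head H a = tail H b)"
    using assms unfolding oriented_graph_def arcs_ends_conv by (metis (no_types, lifting) image_eqI)
  then have "tail H a = tail H b \<and> head H a = head H b"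
    using assms(4) by (auto simp: doubleton_eq_iff)
  then show ?thesis
    using no_multi_arcs[OF assms(2,3)] by (auto simp: arc_to_ends_def)
qed

text \<open>A choice of distinct incident arcs for all vertices, exhausting the arcs.  It turns the
  graph into the graph of the function \<open>f\<close>, and is what a nonzero term of the Leibniz formula
  for the incidence matrix provides.\<close>

locale functional_graph =
  fixes H :: "('a, 'b) pre_digraph" and e :: "'a \<Rightarrow> 'b" and f :: "'a \<Rightarrow> 'a"
  assumes oriented: "oriented_graph H"
    and bij: "bij_betw e (verts H) (arcs H)"
    and ends: "v \<in> verts H \<Longrightarrow>
      (tail H (e v), head H (e v)) = (v, f v) \<or> (tail H (e v), head H (e v)) = (f v, v)"
begin

sublocale digraph H
  using oriented by (simp add: oriented_graph_def)

lemma e_in: "v \<in> verts H \<Longrightarrow> e v \<in> arcs H"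
  using bij by (auto simp: bij_betw_def)

lemma f_in: "v \<in> verts H \<Longrightarrow> f v \<in> verts H"
  using ends[of v] wellformed[OF e_in[of v]] by auto

lemma funpow_in: "v \<in> verts H \<Longrightarrow> (f ^^ i) v \<in> verts H"
  by (induction i) (auto simp: f_in)

lemma orbit_subset_verts: "v \<in> verts H \<Longrightarrow> orbit f v \<subseteq> verts H"
  by (auto simp: orbit_altdef funpow_in)

lemma f_ne: "v \<in> verts H \<Longrightarrow> f v \<noteq> v"
  using ends[of v] no_loops[OF e_in[of v]] by auto

text \<open>A 2-cycle of \<open>f\<close> would use one arc for both of its vertices, against the
  injectivity of \<open>e\<close>. So every cycle of \<open>f\<close> has length at least 3, as a
  cycle of an undirected graph must.\<close>

lemma ff_ne: 
  assumes "v \<in> verts H"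
  shows "f (f v) \<noteq> v"
proof
  assume *: "f (f v) = v"
  have "e v = e (f v)"
    using ends[of v] ends[of "f v"] e_in[of v] e_in[of "f v"] f_in[of v] assms *
    by (intro oriented_graph_arc_eq[OF oriented]) auto
  then show False
    using bij assms f_in[of v] f_ne[of v] by (auto simp: bij_betw_def inj_on_def)
qed

lemma parcs_iff:
  "(x, y) \<in> parcs (mk_symmetric H) \<longleftrightarrow> (x \<in> verts H \<and> y = f x) \<or> (y \<in> verts H \<and> x = f y)"
proof
  assume "(x, y) \<in> parcs (mk_symmetric H)"
  then obtain a where a: "a \<in> arcs H"
    "(tail H a, head H a) = (x, y) \<or> (tail H a, head H a) = (y, x)"
    by (auto simp: parcs_mk_symmetric_iff)
  then obtain v where "v \<in> verts H" "a = e v"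
    using bij by (auto simp: bij_betw_def)
  then show "(x \<in> verts H \<and> y = f x) \<or> (y \<in> verts H \<and> x = f y)"
    using a ends[of v] by auto
next
  assume "(x \<in> verts H \<and> y = f x) \<or> (y \<in> verts H \<and> x = f y)"
  then show "(x, y) \<in> parcs (mk_symmetric H)"
    using e_in ends unfolding parcs_mk_symmetric_iff by metis
qed

lemma arc_iff:
  assumes "a \<in> arcs H" "v \<in> verts H"
  shows "a = e v \<longleftrightarrow> (tail H a, head H a) = (v, f v) \<or> (tail H a, head H a) = (f v, v)"
  using ends[OF assms(2)] oriented_graph_arc_eq[OF oriented assms(1) e_in[OF assms(2)]]
  by (auto simp: insert_commute)

text \<open>The two disjuncts are the two directions of traversal. The starting point is left open,
  because edge set and weight depend only on the set of steps.\<close>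

abbreviation steps_along :: "('a \<times> 'a) list \<Rightarrow> 'a set \<Rightarrow> bool" where
  "steps_along p C \<equiv> distinct p \<and>
    (set p = (\<lambda>v. (v, f v)) ` C \<or> set p = (\<lambda>v. (f v, v)) ` C)"

lemma walk_edges_steps_along:
  assumes "steps_along p C" "C \<subseteq> verts H"
  shows "walk_edges H p = e ` C"
proof -
  have "(t, h) \<in> set p \<or> (h, t) \<in> set p \<longleftrightarrow> (\<exists>v\<in>C. (t, h) = (v, f v) \<or> (t, h) = (f v, v))" for t h
    using assms(1) by auto
  then have "a \<in> walk_edges H p \<longleftrightarrow> a \<in> arcs H \<and> (\<exists>v\<in>C. a = e v)" for a
    using assms(2) arc_iff[of a] unfolding walk_edges_def by (simp only: mem_Collect_eq) blast
  then show ?thesis using assms e_in by auto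
qed

text \<open>Two consecutive steps of a cycle cannot use the arcs chosen by their common vertex in both
  directions, so a cycle runs along \<open>f\<close> all the way, or against it all the way.\<close>

lemma cycle_walk_steps_along:
  assumes "cycle_walk H p"
  shows "\<exists>C\<in>periodic_orbits f (verts H). steps_along p C"
proof -
  obtain k x where k: "3 \<le> k" and per: "\<And>i. x (i + k) = x i" and inj: "inj_on x {..<k}"
    and step: "\<And>i. (x i, x (Suc i)) \<in> parcs (mk_symmetric H)"
    and p: "p = map (\<lambda>i. (x i, x (Suc i))) [0..<k]"
    by (rule cycle_walkE[OF assms], rule that)
  have xV: "x i \<in> verts H" for i
    using step[of i] f_in by (auto simp: parcs_iff)
  have per': "x (i + j * k) = x i" for i j
    by (induction j) (auto simp: per add.assoc[symmetric] add.commute[of k])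
  have xmod: "x i = x (i mod k)" for i
    using per'[of "i mod k" "i div k"] by simp
  have fb: "f (x i) = x (Suc i) \<or> f (x (Suc i)) = x i" for i
    using step[of i] by (auto simp: parcs_iff)
  have ne: "x i \<noteq> x (Suc (Suc i))" for i
  proof
    assume "x i = x (Suc (Suc i))"
    then have eq: "x (i mod k) = x (Suc (Suc i) mod k)"
      by (simp flip: xmod)
    have "i mod k = Suc (Suc i) mod k"
      by (rule inj_onD[OF inj eq]) (use k in \<open>simp_all add: lessThan_def\<close>)
    then have "k dvd Suc (Suc i) - i"
      using mod_eq_dvd_iff_nat[of i "Suc (Suc i)" k] by simp
    then show False
      using dvd_imp_le[of k 2] k by simp
  qed
  \<comment> \<open>Were the step after a backward step forward, \<open>f (x (Suc j))\<close> would
    be both \<open>x j\<close> and \<open>x (Suc (Suc j))\<close>, which differ because the length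
    is at least 3.\<close>
  have bwd: "f (x (Suc j)) = x j" if "f (x (Suc i)) = x i" "i \<le> j" for i j
    using that(2,1)
  proof (induction j rule: dec_induct)
    case (step j)
    then show ?case using fb[of "Suc j"] ne[of j] by auto
  qed
  have dist: "distinct p"
    unfolding p using inj by (auto simp: distinct_map inj_on_def)
  have setp: "set p = range (\<lambda>i. (x i, x (Suc i)))"
  proof
    show "range (\<lambda>i. (x i, x (Suc i))) \<subseteq> set p"
    proof safe
      fix i
      have "x (Suc i) = x (Suc (i mod k))"
        using per'[of "Suc (i mod k)" "i div k"] by simp
      then have "(x i, x (Suc i)) = (\<lambda>i. (x i, x (Suc i))) (i mod k)"
        using xmod[of i] by simp
      moreover have "i mod k < k" using k by simp
      ultimately show "(x i, x (Suc i)) \<in> set p" unfolding p by (simp only: set_map image_iff) auto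
    qed
  qed (auto simp: p)
  show ?thesis
  proof (cases "\<exists>i. f (x (Suc i)) = x i")
    case True
    then obtain i where "f (x (Suc i)) = x i" by blast
    \<comment> \<open>Periodicity carries the direction to the indices before \<open>i\<close>,
      since \<open>j + i * k\<close> lies beyond \<open>i\<close>.\<close>
    then have f': "f (x (Suc (j + i * k))) = x (j + i * k)" for j
      using bwd[of i "j + i * k"] k by (simp add: trans_le_add2)
    have f: "f (x (Suc j)) = x j" for j
      using f'[of j] per'[of "Suc j" i] per'[of j i] by simp
    have pow: "(f ^^ j) (x (j + i)) = x i" for i j
    proof (induction j)
      case (Suc j)
      have "(f ^^ Suc j) (x (Suc j + i)) = (f ^^ j) (f (x (Suc (j + i))))"
        by (simp add: funpow_swap1)
      then show ?case by (simp only: f Suc)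
    qed simp
    have "orbit f (x 0) = range x"
    proof safe
      fix y assume "y \<in> orbit f (x 0)"
      then show "y \<in> range x"
      proof induction
        case base
        have "x 0 = x (Suc (k - 1))" using per[of 0] k by simp
        then show ?case using f by simp
      next
        case (step y)
        then obtain j where "y = x j" by blast
        then have "y = x (Suc (j + k - 1))" using per[of j] k by simp
        then show ?case using f by simp
      qed
    next
      fix j
      \<comment> \<open>Walking back from \<open>x (k * Suc j)\<close>, which is \<open>x 0\<close>
        after \<open>Suc j\<close> full turns, leaves a positive exponent, as \<open>orbit\<close>
        requires.\<close>
      have "(f ^^ (k * Suc j - j)) (x (k * Suc j - j + j)) = x j" by (rule pow)
      moreover have lt: "j < k * Suc j"
        using mult_le_mono1[of 1 k "Suc j"] k by simp
      then have "k * Suc j - j + j = 0 + Suc j * k" "0 < k * Suc j - j"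
        by (simp_all add: mult.commute)
      ultimately have "x j = (f ^^ (k * Suc j - j)) (x 0)" "0 < k * Suc j - j"
        using per'[of 0 "Suc j"] by metis+
      then show "x j \<in> orbit f (x 0)"
        unfolding orbit_altdef by blast
    qed
    then have "range x \<in> periodic_orbits f (verts H)"
      using xV by (auto simp: periodic_orbits_def cyclic_on_def)
    moreover have "set p = (\<lambda>v. (f v, v)) ` range x"
    proof -
      have "(\<lambda>v. (f v, v)) ` range x = range (\<lambda>i. (f (x (Suc i)), x (Suc i)))"
      proof -
        have "range x = range (\<lambda>i. x (Suc i))"
        proof safe
          fix i
          have "x i = x (Suc (i + k - 1))" using per[of i] k by simp
          then show "x i \<in> range (\<lambda>i. x (Suc i))" by blast
        qed auto
        then show ?thesis by (simp add: image_image)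
      qed
      then show ?thesis by (simp add: setp f)
    qed
    ultimately show ?thesis using dist by blast
  next
    case False
    then have f: "f (x i) = x (Suc i)" for i using fb by blast
    have pow: "(f ^^ j) (x 0) = x j" for j
      by (induction j) (auto simp: f)
    have "x j \<in> {x i |i. 0 < i}" for j
      using per[of j] k by (intro CollectI exI[of _ "j + k"]) auto
    then have "orbit f (x 0) = range x"
      unfolding orbit_altdef pow by blast
    then have "range x \<in> periodic_orbits f (verts H)"
      using xV by (auto simp: periodic_orbits_def cyclic_on_def)
    moreover have "set p = (\<lambda>v. (v, f v)) ` range x"
      by (simp add: setp image_image f)
    ultimately show ?thesis using dist by blast
  qed
qed

lemma periodic_orbit_cycle_walk:
  assumes "C \<in> periodic_orbits f (verts H)"
  shows "\<exists>p. cycle_walk H p \<and> steps_along p C" "3 \<le> card C"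
proof -
  obtain y where y: "y \<in> C" "C = orbit f y" and CV: "C \<subseteq> verts H"
    using assms by (auto simp: periodic_orbits_def cyclic_on_def)
  then obtain k where k: "0 < k" "C = (\<lambda>i. (f ^^ i) y) ` {..<k}"
    "inj_on (\<lambda>i. (f ^^ i) y) {..<k}" "(f ^^ k) y = y" "card C = k"
    using orbit_enumeration[of y f] by metis
  have yV: "y \<in> verts H" using y CV by blast
  have "k \<noteq> 1" "k \<noteq> 2"
    using k(4) f_ne[OF yV] ff_ne[OF yV] by (auto simp: numeral_2_eq_2)
  then have k3: "3 \<le> k" using k(1) by linarith
  let ?x = "\<lambda>i. (f ^^ i) y"
  let ?p = "map (\<lambda>i. (?x i, ?x (Suc i))) [0..<k]"
  have "cycle_walk H ?p"
    by (rule cycle_walkI) (use k3 k yV funpow_in[OF yV] in \<open>auto simp: parcs_iff\<close>)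
  moreover have "distinct ?p"
    using k(3) by (auto simp: distinct_map inj_on_def)
  moreover have "set ?p = (\<lambda>v. (v, f v)) ` C"
    unfolding k(2) by (auto simp: image_image)
  ultimately show "\<exists>p. cycle_walk H p \<and> steps_along p C" by blast
  show "3 \<le> card C" using k3 k by simp
qed

lemma cycles_eq: "cycles H = (`) e ` periodic_orbits f (verts H)"
proof safe
  fix X assume "X \<in> cycles H"
  then obtain p where "cycle_walk H p" "X = walk_edges H p"
    by (auto simp: cycles_def)
  then obtain C where C: "C \<in> periodic_orbits f (verts H)" "steps_along p C"
    using cycle_walk_steps_along by blast
  then have "X = e ` C"
    using walk_edges_steps_along \<open>X = _\<close> by (auto simp: periodic_orbits_def)
  with C show "X \<in> (`) e ` periodic_orbits f (verts H)" by blast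
next
  fix C assume C: "C \<in> periodic_orbits f (verts H)"
  then obtain p where p: "cycle_walk H p" "steps_along p C"
    using periodic_orbit_cycle_walk by blast
  then have "walk_edges H p = e ` C"
    using walk_edges_steps_along[OF p(2)] C by (simp add: periodic_orbits_def)
  then show "e ` C \<in> cycles H"
    using p(1) unfolding cycles_def by (intro image_eqI[of _ _ p]) auto
qed

text \<open>The periodic points of the forward orbit: for a vertex this is the one cycle into which
  iteration of \<open>f\<close> falls. It serves as the label of a component.\<close>

definition core :: "'a \<Rightarrow> 'a set" where
  "core v = {x \<in> orbit f v. x \<in> orbit f x}"

lemma core_f: "core (f v) = core v"
  unfolding core_def by (auto intro: orbit_subset dest: orbit_step)

lemma core_eq_orbit:
  assumes "x \<in> core v"
  shows "core v = orbit f x"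
proof
  have x: "x \<in> orbit f v" "x \<in> orbit f x" using assms by (auto simp: core_def)
  show "orbit f x \<subseteq> core v"
    using x by (auto simp: core_def intro: orbit_trans self_in_orbit_trans)
  show "core v \<subseteq> orbit f x"
  proof
    fix y assume "y \<in> core v"
    then have y: "y \<in> orbit f v" "y \<in> orbit f y" by (auto simp: core_def)
    obtain a b where ab: "y = (f ^^ a) v" "x = (f ^^ b) v"
      using x y by (auto simp: orbit_altdef)
    show "y \<in> orbit f x"
    proof (cases "b < a")
      case True
      then have "y = (f ^^ (a - b)) x" "0 < a - b"
        using ab funpow_add[of "a - b" b f] by (auto simp: comp_def)
      then show ?thesis by (auto simp: orbit_altdef)
    next
      case False
      then have "x = (f ^^ (b - a)) y"
        using ab funpow_add[of "b - a" a f] by (auto simp: comp_def)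
      then have "x = y \<or> x \<in> orbit f y" using False by (cases "b = a") (auto simp: orbit_altdef)
      then show ?thesis using y x orbit_swap by metis
    qed
  qed
qed

text \<open>Finiteness of the vertex set forces a repetition among the iterates, and a repeated
  iterate is periodic.\<close>

lemma core_nonempty:
  assumes "v \<in> verts H"
  shows "core v \<noteq> {}"
proof -
  have "\<not> inj (\<lambda>i. (f ^^ i) v)"
    using finite_subset[of "range (\<lambda>i. (f ^^ i) v)" "verts H"] funpow_in[OF assms]
    by (auto dest: finite_imageD)
  then obtain i j where ij: "i < j" "(f ^^ i) v = (f ^^ j) v"
    by (auto simp: inj_on_def) (metis nat_neq_iff)
  let ?x = "(f ^^ i) v"
  have "(f ^^ (j - i)) ?x = ?x" "0 < j - i"
    using ij funpow_add[of "j - i" i f] by (auto simp: comp_def)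
  then have x: "?x \<in> orbit f ?x" by (metis (mono_tags, lifting) mem_Collect_eq orbit_altdef)
  have "?x = v \<or> ?x \<in> orbit f v"
    by (cases "i = 0") (auto simp: orbit_altdef)
  then have "?x \<in> core v" using x by (auto simp: core_def)
  then show ?thesis by blast
qed

lemma core_periodic: "v \<in> verts H \<Longrightarrow> core v \<in> periodic_orbits f (verts H)"
  using core_nonempty[of v] core_eq_orbit[of _ v] orbit_subset_verts[of v]
  unfolding periodic_orbits_def cyclic_on_def core_def by fastforce

lemma core_of_periodic:
  assumes "C \<in> periodic_orbits f V" "v \<in> C"
  shows "core v = C"
proof -
  have "C = orbit f v" using assms by (auto simp: periodic_orbits_def cyclic_on_alldef)
  then have "v \<in> core v" using assms by (auto simp: core_def)
  then show ?thesis using core_eq_orbit \<open>C = _\<close> by simp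
qed

lemma rtrancl_funpow: 
  assumes "v \<in> verts H"
  shows "(v, (f ^^ i) v) \<in> (parcs (mk_symmetric H))\<^sup>*"
proof (induction i)
  case (Suc i)
  have "((f ^^ i) v, (f ^^ Suc i) v) \<in> parcs (mk_symmetric H)"
    using funpow_in[OF assms] by (simp add: parcs_iff)
  with Suc show ?case by (rule rtrancl_into_rtrancl)
qed simp

lemma rtrancl_core:
  assumes "v \<in> verts H" "x \<in> core v"
  shows "(v, x) \<in> (parcs (mk_symmetric H))\<^sup>*"
  using assms rtrancl_funpow by (auto simp: core_def orbit_altdef)

text \<open>A step along \<open>f\<close> or against it leaves the core unchanged; conversely, two
  vertices with the same core both flow to a common point of it.\<close>

lemma rtrancl_iff_core:
  assumes "u \<in> verts H" "v \<in> verts H"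
  shows "(u, v) \<in> (parcs (mk_symmetric H))\<^sup>* \<longleftrightarrow> core u = core v"
proof
  assume "(u, v) \<in> (parcs (mk_symmetric H))\<^sup>*"
  then show "core u = core v"
  proof induction
    case (step y z)
    have "core y = core z"
      using step.hyps(2) core_f[of y] core_f[of z] unfolding parcs_iff by metis
    with step show ?case by simp
  qed simp
next
  assume eq: "core u = core v"
  then obtain x where x: "x \<in> core u" "x \<in> core v" using core_nonempty[OF assms(1)] by auto
  have "(x, v) \<in> (parcs (mk_symmetric H))\<^sup>*"
    by (rule symD[OF sym_rtrancl[OF sym_parcs_mk_symmetric] rtrancl_core[OF assms(2) x(2)]])
  with rtrancl_core[OF assms(1) x(1)] show "(u, v) \<in> (parcs (mk_symmetric H))\<^sup>*" by auto
qed

end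

section \<open>Weak components as reachability classes\<close>

lemma (in wf_digraph) parcs_in_verts:
  "(x, y) \<in> parcs (mk_symmetric G) \<Longrightarrow> x \<in> verts G \<and> y \<in> verts G"
  by (auto simp: parcs_mk_symmetric_iff)

lemma (in wf_digraph) rtrancl_parcs_in_verts:
  "(x, y) \<in> (parcs (mk_symmetric G))\<^sup>* \<Longrightarrow> x \<in> verts G \<Longrightarrow> y \<in> verts G"
  by (induction rule: rtrancl_induct) (auto dest: parcs_in_verts)

lemma (in wf_digraph) connected_iff_rtrancl:
  "Digraph_Component.connected G \<longleftrightarrow> verts G \<noteq> {} \<and>
    (\<forall>u\<in>verts G. \<forall>v\<in>verts G. (u, v) \<in> (parcs (mk_symmetric G))\<^sup>*)"
proof -
  interpret S: pair_wf_digraph "mk_symmetric G" ..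
  show ?thesis
    by (auto simp: connected_def strongly_connected_def S.reachable_conv)
qed

lemma parcs_mk_symmetric_mono:
  "subgraph H G \<Longrightarrow> parcs (mk_symmetric H) \<subseteq> parcs (mk_symmetric G)"
  by (auto simp: parcs_mk_symmetric subgraph_def compatible_def)

lemma subgraph_eqI:
  "subgraph H K \<Longrightarrow> verts H = verts K \<Longrightarrow> arcs H = arcs K \<Longrightarrow> H = K"
  by (auto simp: subgraph_def compatible_def)

definition reach_class :: "('a, 'b) pre_digraph \<Rightarrow> 'a \<Rightarrow> 'a set" where
  "reach_class H v = {x. (v, x) \<in> (parcs (mk_symmetric H))\<^sup>*}"

lemma (in wf_digraph) connected_reach_class:
  assumes "v \<in> verts G"
  shows "Digraph_Component.connected (G \<restriction> reach_class G v)"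
proof -
  let ?U = "G \<restriction> reach_class G v"
  interpret U: wf_digraph ?U by (rule wellformed_induce_subgraph)
  have *: "(v, x) \<in> (parcs (mk_symmetric ?U))\<^sup>*" if "(v, x) \<in> (parcs (mk_symmetric G))\<^sup>*" for x
    using that
  proof induction
    case (step y z)
    then have "(v, z) \<in> (parcs (mk_symmetric G))\<^sup>*" by auto
    with step have "(y, z) \<in> parcs (mk_symmetric ?U)"
      by (auto simp: parcs_mk_symmetric_iff reach_class_def)
    with step.IH show ?case by (rule rtrancl_into_rtrancl)
  qed simp
  have "(x, y) \<in> (parcs (mk_symmetric ?U))\<^sup>*" if "x \<in> verts ?U" "y \<in> verts ?U" for x y
    using *[of x] *[of y] that symD[OF sym_rtrancl[OF sym_parcs_mk_symmetric], of v x ?U]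
    by (auto simp: reach_class_def)
  moreover have "v \<in> verts ?U"
    by (simp add: reach_class_def)
  ultimately show ?thesis
    unfolding U.connected_iff_rtrancl by blast
qed

lemma (in wf_digraph) connected_subgraph_reach_class:
  assumes "Digraph_Component.connected U" "subgraph U G" "v \<in> verts U"
  shows "subgraph U (G \<restriction> reach_class G v)"
proof -
  interpret U: wf_digraph U using assms(2) by auto
  have "x \<in> reach_class G v" if "x \<in> verts U" for x
    using assms that rtrancl_mono[OF parcs_mk_symmetric_mono[OF assms(2)]]
    unfolding U.connected_iff_rtrancl reach_class_def by blast
  then show ?thesis
    using assms(2) U.wellformed wellformed_induce_subgraph[of "reach_class G v"]
    by (auto simp: subgraph_def compatible_def)
qed

text \<open>Every connected subgraph through a vertex lies inside the subgraph induced on the class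
  of that vertex, which is itself connected; so the maximal connected subgraphs are these induced
  ones.\<close>

lemma (in wf_digraph) weak_components_eq:
  "weak_components G = (\<lambda>v. G \<restriction> reach_class G v) ` verts G"
proof (intro equalityI subsetI)
  fix U assume "U \<in> weak_components G"
  then have U: "subgraph U G" "Digraph_Component.connected U"
    "\<And>H'. H' \<noteq> U \<Longrightarrow> subgraph U H' \<Longrightarrow> subgraph H' G \<Longrightarrow> \<not> Digraph_Component.connected H'"
    by (auto simp: weak_components_def max_subgraph_def)
  interpret U: wf_digraph U using U(1) by auto
  obtain v where v: "v \<in> verts U" using U(2) unfolding U.connected_iff_rtrancl by blast
  then have vG: "v \<in> verts G" using U(1) by auto
  have "subgraph (G \<restriction> reach_class G v) G"
    using rtrancl_parcs_in_verts vG
    by (intro subgraph_induce_subgraphI) (auto simp: reach_class_def)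
  then have "G \<restriction> reach_class G v = U"
    using U(3) connected_subgraph_reach_class[OF U(2,1) v] connected_reach_class[OF vG] by blast
  then show "U \<in> (\<lambda>v. G \<restriction> reach_class G v) ` verts G" using vG by blast
next
  fix U assume "U \<in> (\<lambda>v. G \<restriction> reach_class G v) ` verts G"
  then obtain v where v: "v \<in> verts G" "U = G \<restriction> reach_class G v" by blast
  have "subgraph U G"
    using rtrancl_parcs_in_verts v
    by (auto intro!: subgraph_induce_subgraphI simp: reach_class_def)
  moreover have "H' = U" if H': "subgraph U H'" "subgraph H' G" "Digraph_Component.connected H'" for H'
  proof -
    have "v \<in> verts H'"
      using subgraph_imp_subverts[OF H'(1)] v by (auto simp: reach_class_def)
    then have "subgraph H' U"
      using connected_subgraph_reach_class[OF H'(3,2)] v by simp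
    with H'(1) show ?thesis
      by (intro subgraph_eqI) auto
  qed
  ultimately show "U \<in> weak_components G"
    using connected_reach_class[OF v(1)] v(2) by (auto simp: weak_components_def max_subgraph_def)
qed

lemma oriented_graph_subgraph:
  assumes "oriented_graph G" "subgraph H G"
  shows "oriented_graph H"
  using assms digraph.digraph_subgraph[of G H] arcs_ends_mono[of H G]
  unfolding oriented_graph_def by blast

section \<open>Components of a functional graph\<close>

context functional_graph
begin

text \<open>Every arc is chosen by one of its ends, so an arc with both ends in \<open>S\<close> is
  chosen inside \<open>S\<close>; closure under \<open>f\<close> gives the other inclusion.\<close>

lemma functional_graph_restrict:
  assumes "S \<subseteq> verts H" "\<And>v. v \<in> S \<Longrightarrow> f v \<in> S"
  shows "functional_graph (H \<restriction> S) e f" "arcs (H \<restriction> S) = e ` S"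
proof -
  have "a \<in> e ` S" if "a \<in> arcs H" "tail H a \<in> S" "head H a \<in> S" for a
  proof -
    have "a \<in> e ` verts H"
      using that bij by (simp add: bij_betw_def)
    then obtain v where v: "v \<in> verts H" "a = e v" by blast
    then show ?thesis using ends[OF v(1)] that by auto
  qed
  moreover have "e v \<in> arcs H \<and> tail H (e v) \<in> S \<and> head H (e v) \<in> S" if "v \<in> S" for v
    using ends[OF subsetD[OF assms(1) that]] e_in[OF subsetD[OF assms(1) that]] assms(2)[OF that] that
    by auto
  ultimately show arcs: "arcs (H \<restriction> S) = e ` S" by auto
  show "functional_graph (H \<restriction> S) e f"
  proof
    show "oriented_graph (H \<restriction> S)"
      by (rule oriented_graph_subgraph[OF oriented subgraph_induce_subgraphI[OF assms(1)]])
    show "bij_betw e (verts (H \<restriction> S)) (arcs (H \<restriction> S))"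
      unfolding arcs using bij assms(1) by (auto simp: bij_betw_def inj_on_def)
  qed (use ends assms(1) in auto)
qed

definition basin :: "'a set \<Rightarrow> 'a set" where
  "basin C = {v \<in> verts H. core v = C}"

lemma f_basin: "v \<in> basin C \<Longrightarrow> f v \<in> basin C"
  by (simp add: basin_def f_in core_f)

lemma basin_subset: "basin C \<subseteq> verts H"
  by (auto simp: basin_def)

lemma periodic_subset_basin: "C \<in> periodic_orbits f (verts H) \<Longrightarrow> C \<subseteq> basin C"
  using core_of_periodic by (auto simp: basin_def periodic_orbits_def)

lemma periodic_orbits_nonempty: "C \<in> periodic_orbits f V \<Longrightarrow> C \<noteq> {}"
  by (auto simp: periodic_orbits_def cyclic_on_alldef)

lemma weak_components_basin:
  "weak_components H = (\<lambda>C. H \<restriction> basin C) ` periodic_orbits f (verts H)"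
proof -
  have "reach_class H v = basin (core v)" if "v \<in> verts H" for v
    using rtrancl_iff_core[OF that] rtrancl_parcs_in_verts[OF _ that]
    by (auto simp: reach_class_def basin_def)
  then have "weak_components H = (\<lambda>C. H \<restriction> basin C) ` core ` verts H"
    unfolding weak_components_eq image_image by (intro image_cong) simp_all
  also have "core ` verts H = periodic_orbits f (verts H)"
  proof (intro equalityI subsetI)
    fix C assume C: "C \<in> periodic_orbits f (verts H)"
    then obtain v where "v \<in> C" "v \<in> verts H"
      using periodic_orbits_nonempty[OF C] by (auto simp: periodic_orbits_def)
    then show "C \<in> core ` verts H" using core_of_periodic[OF C] by blast
  qed (auto simp: core_periodic)
  finally show ?thesis .
qed

lemma inj_on_restrict_basin:
  "inj_on (\<lambda>C. H \<restriction> basin C) (periodic_orbits f (verts H))"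
proof (rule inj_onI)
  fix C D assume *: "C \<in> periodic_orbits f (verts H)" "D \<in> periodic_orbits f (verts H)"
    "H \<restriction> basin C = H \<restriction> basin D"
  then have "basin C = basin D" by (metis induce_subgraph_verts)
  then show "C = D"
    using periodic_subset_basin[OF *(1)] periodic_orbits_nonempty[OF *(1)] by (auto simp: basin_def)
qed

lemma functional_graph_basin:
  "functional_graph (H \<restriction> basin C) e f" "arcs (H \<restriction> basin C) = e ` basin C"
  using functional_graph_restrict[of "basin C"] basin_subset f_basin by auto

lemma periodic_orbits_basin:
  assumes "C \<in> periodic_orbits f (verts H)"
  shows "periodic_orbits f (basin C) = {C}"
proof -
  have "D = C" if "D \<subseteq> basin C" "cyclic_on f D" for D
  proof -
    have D: "D \<in> periodic_orbits f (verts H)"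
      using that basin_subset by (auto simp: periodic_orbits_def)
    obtain v where "v \<in> D" using periodic_orbits_nonempty[OF D] by blast
    then show ?thesis using core_of_periodic[OF D] that by (auto simp: basin_def)
  qed
  then show ?thesis
    using assms periodic_subset_basin[OF assms] by (auto simp: periodic_orbits_def)
qed

lemma cycles_basin:
  assumes "C \<in> periodic_orbits f (verts H)"
  shows "cycles (H \<restriction> basin C) = {e ` C}" "the_cycle (H \<restriction> basin C) = e ` C"
    "unicyclic (H \<restriction> basin C)"
proof -
  interpret B: functional_graph "H \<restriction> basin C" e f by (rule functional_graph_basin)
  show cyc: "cycles (H \<restriction> basin C) = {e ` C}"
    using B.cycles_eq periodic_orbits_basin[OF assms] by simp
  then show "the_cycle (H \<restriction> basin C) = e ` C"
    by (simp add: the_cycle_def)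
  have "H \<restriction> basin C \<in> weak_components H"
    using assms weak_components_basin by blast
  then show "unicyclic (H \<restriction> basin C)"
    using cyc by (auto simp: unicyclic_def weak_components_def max_subgraph_def)
qed

end

section \<open>Growing a choice of incident arcs from a cycle\<close>

lemma rtrancl_crossing:
  assumes "(u, z) \<in> R\<^sup>*" "u \<in> T" "z \<notin> T"
  shows "\<exists>a b. (a, b) \<in> R \<and> a \<in> T \<and> b \<notin> T"
  using assms by (induction rule: rtrancl_induct) blast+

text \<open>The local form of \<open>functional_graph\<close>: it lives on a part \<open>T\<close>
  of the vertices closed under \<open>f\<close> and need not exhaust the arcs, so that it can be
  enlarged step by step.\<close>

definition incident_choice :: "('a, 'b) pre_digraph \<Rightarrow> ('a \<Rightarrow> 'b) \<Rightarrow> ('a \<Rightarrow> 'a) \<Rightarrow> 'a set \<Rightarrow> bool" where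
  "incident_choice H e f T \<longleftrightarrow> inj_on e T \<and> (\<forall>v\<in>T. e v \<in> arcs H \<and> f v \<in> T \<and>
    ((tail H (e v), head H (e v)) = (v, f v) \<or> (tail H (e v), head H (e v)) = (f v, v)))"

text \<open>Vertices outside \<open>T\<close> are attached one by one, each with the arc that attaches it.\<close>

lemma incident_choice_extend:
  assumes "wf_digraph H" "finite (verts H)" "Digraph_Component.connected H"
    and "S \<subseteq> verts H" "S \<noteq> {}" "incident_choice H e f S"
  obtains e' f' where "incident_choice H e' f' (verts H)" "\<And>v. v \<in> S \<Longrightarrow> e' v = e v \<and> f' v = f v"
    "\<And>v. v \<in> verts H \<Longrightarrow> \<exists>i. (f' ^^ i) v \<in> S"
proof -
  interpret wf_digraph H by fact
  \<comment> \<open>The last clause records that every vertex flows into \<open>S\<close>, so the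
    enlargement creates no cycle outside \<open>S\<close>.\<close>
  let ?P = "\<lambda>T. S \<subseteq> T \<and> T \<subseteq> verts H \<and>
    (\<exists>e' f'. incident_choice H e' f' T \<and> (\<forall>v\<in>S. e' v = e v \<and> f' v = f v) \<and>
      (\<forall>v\<in>T. \<exists>i. (f' ^^ i) v \<in> S))"
  define A where "A = {T. ?P T}"
  have "finite A"
    unfolding A_def by (rule finite_subset[of _ "Pow (verts H)"]) (use assms in auto)
  moreover have "\<forall>v\<in>S. \<exists>i. (f ^^ i) v \<in> S"
    by (auto intro: exI[of _ 0])
  then have "S \<in> A" using assms unfolding A_def by blast
  ultimately obtain T where TA: "T \<in> A" and max: "\<And>T'. T' \<in> A \<Longrightarrow> T \<subseteq> T' \<Longrightarrow> T = T'"
    using finite_has_maximal[of A] by auto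
  from TA have T: "?P T" unfolding A_def mem_Collect_eq .
  then obtain e' f' where e': "incident_choice H e' f' T" "\<forall>v\<in>S. e' v = e v \<and> f' v = f v"
    "\<forall>v\<in>T. \<exists>i. (f' ^^ i) v \<in> S" by blast
  have "T = verts H"
  proof (rule ccontr)
    assume "T \<noteq> verts H"
    then obtain z where z: "z \<in> verts H" "z \<notin> T" using T by blast
    obtain u where u: "u \<in> S" using assms by blast
    then have "u \<in> T" "u \<in> verts H" using T assms(4) by auto
    then have "(u, z) \<in> (parcs (mk_symmetric H))\<^sup>*"
      using assms(3) z(1) unfolding connected_iff_rtrancl by simp
    from rtrancl_crossing[OF this \<open>u \<in> T\<close> z(2)]
    obtain a b where ab: "(a, b) \<in> parcs (mk_symmetric H)" "a \<in> T" "b \<notin> T"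
      by auto
    then obtain l where l: "l \<in> arcs H"
      "(tail H l, head H l) = (a, b) \<or> (tail H l, head H l) = (b, a)"
      by (auto simp: parcs_mk_symmetric_iff)
    have bV: "b \<in> verts H" using ab parcs_in_verts by blast
    \<comment> \<open>Chosen arcs have both ends in \<open>T\<close>, whereas \<open>l\<close>
      leaves \<open>T\<close>.\<close>
    have "l \<notin> e' ` T"
      using l ab e'(1) unfolding incident_choice_def by auto
    then have "incident_choice H (e'(b := l)) (f'(b := a)) (insert b T)"
      using e'(1) l ab unfolding incident_choice_def by (auto simp: inj_on_def)
    moreover have "\<forall>v\<in>S. (e'(b := l)) v = e v \<and> (f'(b := a)) v = f v"
      using e'(2) ab T by auto
    moreover have "\<forall>v\<in>insert b T. \<exists>i. ((f'(b := a)) ^^ i) v \<in> S"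
    proof
      have *: "((f'(b := a)) ^^ i) v = (f' ^^ i) v \<and> (f' ^^ i) v \<in> T" if "v \<in> T" for v i
        using that ab(3) e'(1) by (induction i) (auto simp: incident_choice_def)
      fix v assume "v \<in> insert b T"
      then consider "v \<in> T" | "v = b" by blast
      then show "\<exists>i. ((f'(b := a)) ^^ i) v \<in> S"
      proof cases
        case 1
        then show ?thesis using *[OF 1] e'(3) by simp
      next
        case 2
        obtain i where "((f'(b := a)) ^^ i) a \<in> S" using *[OF ab(2)] e'(3) ab(2) by auto
        then have "((f'(b := a)) ^^ Suc i) b \<in> S" by (simp add: funpow_swap1)
        then show ?thesis using 2 by blast
      qed
    qed
    ultimately have "insert b T \<in> A" using T bV unfolding A_def by blast
    then have "T = insert b T" by (rule max) blast
    then show False using ab by blast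
  qed
  then show ?thesis using that e' by blast
qed

lemma incident_choice_functional_graph:
  assumes "oriented_graph H" "incident_choice H e f (verts H)"
  shows "functional_graph (H\<lparr>arcs := e ` verts H\<rparr>) e f"
proof
  interpret digraph H using assms(1) by (simp add: oriented_graph_def)
  have "subgraph (H\<lparr>arcs := e ` verts H\<rparr>) H"
    using assms(2) wf_digraph wellformed
    by (auto simp: subgraph_def compatible_def incident_choice_def intro!: wf_digraph.intro)
  then show "oriented_graph (H\<lparr>arcs := e ` verts H\<rparr>)"
    by (rule oriented_graph_subgraph[OF assms(1)])
qed (use assms(2) in \<open>auto simp: incident_choice_def bij_betw_def\<close>)

text \<open>Along a traversal each vertex takes the arc to its successor. The chosen arcs are
  distinct because the cycle has length at least 3.\<close>

lemma cycle_incident_choice: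
  assumes "oriented_graph H" "X \<in> cycles H"
  obtains e f C where "incident_choice H e f C" "C \<subseteq> verts H" "cyclic_on f C" "X = e ` C"
proof -
  interpret digraph H using assms(1) by (simp add: oriented_graph_def)
  obtain p where p: "cycle_walk H p" "X = walk_edges H p"
    using assms(2) by (auto simp: cycles_def)
  obtain k x where k: "3 \<le> k" and per: "\<And>i. x (i + k) = x i" and inj: "inj_on x {..<k}"
    and step: "\<And>i. (x i, x (Suc i)) \<in> parcs (mk_symmetric H)"
    and px: "p = map (\<lambda>i. (x i, x (Suc i))) [0..<k]"
    by (rule cycle_walkE[OF p(1)], rule that)
  let ?C = "x ` {..<k}"
  define j where "j = the_inv_into {..<k} x"
  have j: "j (x i) = i" if "i < k" for i
    using that inj by (simp add: j_def the_inv_into_f_f)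
  have "\<forall>i. \<exists>a. a \<in> arcs H \<and>
      ((tail H a, head H a) = (x i, x (Suc i)) \<or> (tail H a, head H a) = (x (Suc i), x i))"
    using step unfolding parcs_mk_symmetric_iff by blast
  then obtain a where a: "\<And>i. a i \<in> arcs H"
    "\<And>i. (tail H (a i), head H (a i)) = (x i, x (Suc i)) \<or> (tail H (a i), head H (a i)) = (x (Suc i), x i)"
    by metis
  define e where "e v = a (j v)" for v
  define f where "f v = x (Suc (j v))" for v
  have e: "e (x i) = a i" and f: "f (x i) = x (Suc i)" if "i < k" for i
    using that by (simp_all add: e_def f_def j)
  have Suc_in: "x (Suc i) \<in> ?C" if "i < k" for i
  proof (cases "Suc i = k")
    case True
    then have "x (Suc i) = x 0" using per[of 0] by simp
    then show ?thesis using k by auto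
  qed (use that in auto)
  \<comment> \<open>Two different vertices sharing an arc would be successors of each other, so
    \<open>k\<close> would divide 2.\<close>
  have inj_a: "i = i'" if "i < k" "i' < k" "a i = a i'" for i i'
  proof (rule ccontr)
    assume ne: "i \<noteq> i'"
    have "x i \<noteq> x i'" using inj that ne by (auto simp: inj_on_def)
    then have eq: "x i = x (Suc i')" "x (Suc i) = x i'"
      using a(2)[of i] a(2)[of i'] that(3) by auto
    have *: "Suc i' mod k = i" if "x i = x (Suc i')" "i < k" "i' < k" for i i'
    proof (cases "Suc i' = k")
      case True
      then have "x i = x 0" using that per[of 0] by simp
      then have "i = 0" using inj that k by (auto simp: inj_on_def)
      then show ?thesis using True by simp
    next
      case False
      then have "Suc i' < k" using that by simp
      then show ?thesis using inj_onD[OF inj that(1)] that by simp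
    qed
    have "Suc i' mod k = i" "Suc i mod k = i'"
      using *[OF eq(1)] *[OF eq(2)[symmetric]] that by simp_all
    then have "Suc (Suc i') mod k = i' mod k"
      using that(2) by (metis mod_Suc_eq mod_less)
    then have "k dvd Suc (Suc i') - i'"
      using mod_eq_dvd_iff_nat[of i' "Suc (Suc i')" k] by simp
    then show False
      using dvd_imp_le[of k 2] k by simp
  qed
  have choice: "incident_choice H e f ?C"
    unfolding incident_choice_def
  proof (intro conjI ballI)
    show "inj_on e ?C"
      by (rule inj_onI) (auto simp: e dest: inj_a)
  next
    fix v assume "v \<in> ?C"
    then obtain i where i: "i < k" "v = x i" by blast
    show "e v \<in> arcs H" "f v \<in> ?C"
      "(tail H (e v), head H (e v)) = (v, f v) \<or> (tail H (e v), head H (e v)) = (f v, v)"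
      unfolding i(2) e[OF i(1)] f[OF i(1)] using a(1)[of i] a(2)[of i] Suc_in[OF i(1)] by blast+
  qed
  have pow: "(f ^^ i) (x 0) = x (i mod k)" for i
  proof (induction i)
    case (Suc i)
    have "i mod k < k" using k by (intro mod_less_divisor) linarith
    then have "(f ^^ Suc i) (x 0) = x (Suc (i mod k))" using Suc f by simp
    also have "\<dots> = x (Suc i mod k)"
      using per[of 0] by (simp add: mod_Suc)
    finally show ?case .
  qed simp
  have "?C = orbit f (x 0)"
  proof
    show "?C \<subseteq> orbit f (x 0)"
    proof
      fix y assume "y \<in> ?C"
      then obtain i where "i < k" "y = x i" by blast
      then have "y = (f ^^ (i + k)) (x 0)" "0 < i + k" unfolding pow using k by simp_all
      then show "y \<in> orbit f (x 0)" unfolding orbit_altdef by blast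
    qed
    have "i mod k < k" for i using k by (intro mod_less_divisor) linarith
    then show "orbit f (x 0) \<subseteq> ?C" unfolding orbit_altdef pow by blast
  qed
  then have cyc: "cyclic_on f ?C"
    using k by (auto simp: cyclic_on_def)
  have CV: "?C \<subseteq> verts H"
    using parcs_in_verts step by blast
  have "X = e ` ?C"
  proof (intro equalityI subsetI)
    fix l assume "l \<in> X"
    then have l: "l \<in> arcs H" "\<exists>i<k. (tail H l, head H l) = (x i, x (Suc i)) \<or> (tail H l, head H l) = (x (Suc i), x i)"
      by (auto simp: p(2) px walk_edges_def)
    then obtain i where i: "i < k" "{tail H l, head H l} = {x i, x (Suc i)}"
      by (auto simp: insert_commute)
    moreover have "{tail H (a i), head H (a i)} = {x i, x (Suc i)}"
      using a(2)[of i] by auto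
    ultimately have "l = a i"
      using oriented_graph_arc_eq[OF assms(1) l(1) a(1)] by simp
    then show "l \<in> e ` ?C" using e[OF i(1)] i(1) by (intro image_eqI[of _ _ "x i"]) auto
  next
    fix l assume "l \<in> e ` ?C"
    then obtain i where i: "i < k" "l = a i" using e by auto
    then have "(x i, x (Suc i)) \<in> set p" by (auto simp: px)
    then show "l \<in> X" using a[of i] i by (auto simp: p(2) walk_edges_def)
  qed
  with choice CV cyc show ?thesis by (rule that)
qed

text \<open>The choice on the cycle seeds the extension. As every vertex then flows into
  \<open>C\<close>, the subgraph of chosen arcs has no cycle besides \<open>X\<close>.\<close>

lemma connected_cycle_incident_choice:
  assumes "oriented_graph H" "Digraph_Component.connected H" "X \<in> cycles H"
  obtains e f C where "incident_choice H e f (verts H)" "C \<in> periodic_orbits f (verts H)" "X = e ` C"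
    "\<And>v. v \<in> verts H \<Longrightarrow> \<exists>i. (f ^^ i) v \<in> C"
proof -
  interpret digraph H using assms(1) by (simp add: oriented_graph_def)
  obtain e f C where C: "incident_choice H e f C" "C \<subseteq> verts H" "cyclic_on f C" "X = e ` C"
    by (rule cycle_incident_choice[OF assms(1,3)], rule that)
  have "C \<noteq> {}" using C(3) by (simp add: cyclic_on_alldef)
  then obtain e' f' where e': "incident_choice H e' f' (verts H)"
    "\<And>v. v \<in> C \<Longrightarrow> e' v = e v \<and> f' v = f v" "\<And>v. v \<in> verts H \<Longrightarrow> \<exists>i. (f' ^^ i) v \<in> C"
    using incident_choice_extend[OF wf_digraph finite_verts assms(2) C(2) _ C(1)] by metis
  then have "cyclic_on f' C" "X = e' ` C"
    using C by (simp_all cong: cyclic_cong)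
  then show ?thesis using that[OF e'(1)] e'(3) C(2) by (auto simp: periodic_orbits_def)
qed

lemma oriented_graph_component:
  assumes "oriented_graph H" "U \<in> weak_components H"
  shows "oriented_graph U" "subgraph U H" "Digraph_Component.connected U"
  using assms oriented_graph_subgraph
  by (auto simp: weak_components_def pre_digraph.max_subgraph_def)

text \<open>Choices on the components can be glued: a chosen arc stays in the component of its
  vertex, so two vertices with the same arc already lie in one component, where injectivity is
  known.\<close>

lemma components_incident_choice:
  assumes "oriented_graph H" "\<And>U. U \<in> weak_components H \<Longrightarrow> cycles U \<noteq> {}"
  obtains e f where "incident_choice H e f (verts H)"
proof -
  interpret digraph H using assms(1) by (simp add: oriented_graph_def)
  let ?U = "\<lambda>v. H \<restriction> reach_class H v"
  have "\<exists>e f. incident_choice U e f (verts U)" if "U \<in> weak_components H" for U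
    using oriented_graph_component[OF assms(1) that] assms(2)[OF that]
      connected_cycle_incident_choice[of U] by (metis equals0I)
  then obtain E F where EF: "\<And>U. U \<in> weak_components H \<Longrightarrow> incident_choice U (E U) (F U) (verts U)"
    by metis
  have comp: "?U v \<in> weak_components H" if "v \<in> verts H" for v
    using that weak_components_eq by blast
  have v: "v \<in> verts (?U v)" for v by (simp add: reach_class_def)
  have same: "?U u = ?U v" if "u \<in> reach_class H v" for u v
  proof -
    have "(u, v) \<in> (parcs (mk_symmetric H))\<^sup>*" "(v, u) \<in> (parcs (mk_symmetric H))\<^sup>*"
      using that symD[OF sym_rtrancl[OF sym_parcs_mk_symmetric], of v u H] by (auto simp: reach_class_def)
    then have "reach_class H u = reach_class H v"
      unfolding reach_class_def by (auto intro: rtrancl_trans)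
    then show ?thesis by simp
  qed
  define e where "e v = E (?U v) v" for v
  define f where "f v = F (?U v) v" for v
  have *: "e v \<in> arcs (?U v) \<and> f v \<in> verts (?U v) \<and>
    ((tail H (e v), head H (e v)) = (v, f v) \<or> (tail H (e v), head H (e v)) = (f v, v))"
    if "v \<in> verts H" for v
    using EF[OF comp[OF that]] v[of v] unfolding incident_choice_def e_def f_def by simp
  have "inj_on e (verts H)"
  proof (rule inj_onI)
    fix u v assume uv: "u \<in> verts H" "v \<in> verts H" "e u = e v"
    have "u \<in> reach_class H v"
      using *[OF uv(1)] *[OF uv(2)] uv(3) by auto
    then have "?U u = ?U v" by (rule same)
    then show "u = v"
      using EF[OF comp[OF uv(2)]] uv(3) v[of u] v[of v]
      unfolding incident_choice_def e_def by (metis inj_onD)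
  qed
  moreover have "e v \<in> arcs H \<and> f v \<in> verts H" if "v \<in> verts H" for v
    using *[OF that] rtrancl_parcs_in_verts[OF _ that] by (auto simp: reach_class_def)
  ultimately have "incident_choice H e f (verts H)"
    using * unfolding incident_choice_def by blast
  then show ?thesis by (rule that)
qed

section \<open>Removing an arc from a unicyclic graph\<close>

text \<open>\<open>walk_edges\<close> looks arcs up in the ambient graph. An oriented graph has only
  one arc between two vertices, so the lookup in \<open>H\<close> finds the arc that
  \<open>F\<close> already has.\<close>

lemma cycles_subgraph:
  assumes "oriented_graph H" "subgraph F H"
  shows "cycles F \<subseteq> cycles H"
proof
  fix X assume "X \<in> cycles F"
  then obtain p where p: "cycle_walk F p" "X = walk_edges F p"
    by (auto simp: cycles_def)
  have mono: "parcs (mk_symmetric F) \<subseteq> parcs (mk_symmetric H)"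
    by (rule parcs_mk_symmetric_mono[OF assms(2)])
  have c: "tail F = tail H" "head F = head H" "arcs F \<subseteq> arcs H" "verts F \<subseteq> verts H"
    using assms(2) by (auto simp: subgraph_def compatible_def)
  have pF: "set p \<subseteq> parcs (mk_symmetric F)"
    using p(1) unfolding cycle_walk_def pre_digraph.cycle_def awalk_mk_symmetric_iff by blast
  have "cycle_walk H p"
    using p(1) mono c(4) unfolding cycle_walk_def pre_digraph.cycle_def awalk_mk_symmetric_iff
      awalk_verts_with_proj_eq by blast
  moreover have "walk_edges H p = walk_edges F p"
  proof -
    have "a \<in> arcs F" if a: "a \<in> arcs H" "(tail H a, head H a) \<in> set p \<or> (head H a, tail H a) \<in> set p" for a
    proof -
      obtain b where b: "b \<in> arcs F" "{tail H b, head H b} = {tail H a, head H a}"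
        using a(2) pF c by (fastforce simp: parcs_mk_symmetric_iff insert_commute)
      then have "b = a"
        using oriented_graph_arc_eq[OF assms(1)] a(1) c(3) by blast
      with b show ?thesis by simp
    qed
    then show ?thesis using c by (auto simp: walk_edges_def)
  qed
  ultimately show "X \<in> cycles H"
    using p(2) unfolding cycles_def by (intro image_eqI[of _ _ p]) auto
qed

text \<open>Two paths that part at \<open>s\<close> and meet again close up to a cycle, because their remainders
  connect \<open>x\<close> and \<open>y\<close> outside \<open>s\<close>.\<close>

lemma diverging_paths_cycle:
  fixes F :: "('a, 'b) pre_digraph"
  assumes "wf_digraph F"
    and p: "pre_digraph.apath (with_proj (mk_symmetric F)) s ((s, x) # p) t"
    and q: "pre_digraph.apath (with_proj (mk_symmetric F)) s ((s, y) # q) t"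
    and "x \<noteq> y"
  shows "cycles F \<noteq> {}"
proof -
  interpret wf_digraph F by fact
  interpret S: pair_wf_digraph "mk_symmetric F" ..
  \<comment> \<open>The graph without the vertex \<open>s\<close>; both remainders avoid
    \<open>s\<close> and therefore survive in it.\<close>
  define K where "K = \<lparr>pverts = verts F - {s},
    parcs = {(a, b) \<in> parcs (mk_symmetric F). a \<noteq> s \<and> b \<noteq> s}\<rparr>"
  interpret K: pair_wf_digraph K
    by unfold_locales (auto simp: K_def dest: S.in_arcsD1 S.in_arcsD2)
  have K: "K.awalk z r t" if "S.apath s ((s, z) # r) t" for z r
  proof -
    have "S.awalk z r t" "s \<notin> set (pawalk_verts z r)"
      using that by (auto simp: S.apath_Cons_iff S.apath_def S.awalk_Cons_iff)
    then show ?thesis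
    proof (induction r arbitrary: z)
      case Nil
      then show ?case unfolding K.awalk_Nil_iff by (auto simp: S.awalk_Nil_iff K_def)
    next
      case (Cons a r)
      have "S.awalk (snd a) r t" "snd a \<noteq> s" "fst a \<noteq> s" "z = fst a" "a \<in> parcs (mk_symmetric F)"
        using Cons.prems by (cases r; auto simp: S.awalk_Cons_iff)+
      then show ?case
        using Cons unfolding K.awalk_Cons_iff by (cases a) (auto simp: K_def)
    qed
  qed
  have symK: "symmetric (with_proj K)"
    using sym_parcs_mk_symmetric[of F] by (auto simp: symmetric_def K_def sym_def)
  have "x \<rightarrow>\<^sup>*\<^bsub>K\<^esub> t" "y \<rightarrow>\<^sup>*\<^bsub>K\<^esub> t"
    using K[OF p] K[OF q] K.reachable_awalk by blast+
  then have "x \<rightarrow>\<^sup>*\<^bsub>K\<^esub> y"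
    using symmetric_reachable[OF symK] K.reachable_trans by blast
  then obtain r where r: "K.apath x r y" using K.reachable_apath by blast
  have rp: "set r \<subseteq> parcs (mk_symmetric F)" "pcas x r y" "distinct (pawalk_verts x r)"
    "s \<notin> set (pawalk_verts x r)"
  proof -
    have "K.awalk x r y" and d: "distinct (pawalk_verts x r)"
      using r by (simp_all add: K.apath_def)
    then have K': "set r \<subseteq> parcs K" "pcas x r y" "x \<in> pverts K"
      by (simp_all add: K.awalk_def)
    then have "s \<notin> set (pawalk_verts x r)"
      using K.awalk_verts_in_verts[of x r s] by (auto simp: K_def)
    then show "set r \<subseteq> parcs (mk_symmetric F)" "pcas x r y" "distinct (pawalk_verts x r)"
      "s \<notin> set (pawalk_verts x r)"
      using K' d by (auto simp: K_def)
  qed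
  have "r \<noteq> []" using r assms(4) by (auto simp: K.apath_Nil_iff)
  have sx: "(s, x) \<in> parcs (mk_symmetric F)" "(y, s) \<in> parcs (mk_symmetric F)" "s \<in> verts F"
    using p q sym_parcs_mk_symmetric[of F] by (auto simp: S.apath_Cons_iff sym_def dest: S.in_arcsD1)
  let ?c = "(s, x) # r @ [(y, s)]"
  have cas: "pcas x (r @ [(y, s)]) s"
    using rp(2) by (induction r arbitrary: x) auto
  have vs: "pawalk_verts x (r @ [(y, s)]) = pawalk_verts x r @ [s]"
    using rp(2) by (induction r arbitrary: x) auto
  have "cycle_walk F ?c"
    unfolding cycle_walk_def pre_digraph.cycle_def awalk_mk_symmetric_iff awalk_verts_with_proj_eq
    using cas vs rp sx \<open>r \<noteq> []\<close> by (auto intro!: exI[of _ s] simp: Suc_le_eq numeral_3_eq_3)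
  then show ?thesis by (auto simp: cycles_def)
qed

lemma acyclic_apath_unique:
  assumes "wf_digraph F" "cycles F = {}"
    and "pre_digraph.apath (with_proj (mk_symmetric F)) s p t"
    and "pre_digraph.apath (with_proj (mk_symmetric F)) s q t"
  shows "p = q"
proof -
  interpret wf_digraph F by fact
  interpret S: pair_wf_digraph "mk_symmetric F" ..
  from assms(3,4) show ?thesis
  proof (induction p arbitrary: s q)
    case Nil
    then show ?case using S.apath_nonempty_ends[of s q t] by (auto simp: S.apath_Nil_iff)
  next
    case (Cons a p)
    then obtain x where a: "a = (s, x)" by (cases a) (auto simp: S.apath_Cons_iff)
    have "s \<noteq> t" using S.apath_nonempty_ends[OF Cons.prems(1)] by simp
    then obtain b q' where q: "q = b # q'"
      using Cons.prems(2) by (cases q) (auto simp: S.apath_Nil_iff)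
    then obtain y where b: "b = (s, y)"
      using Cons.prems by (cases b) (auto simp: S.apath_Cons_iff)
    have "x = y"
      using diverging_paths_cycle[OF assms(1)] Cons.prems assms(2) unfolding a b q by blast
    then show ?case
      using Cons unfolding a b q by (auto simp: S.apath_Cons_iff)
  qed
qed

text \<open>A shortest walk repeats no vertex, and without cycles such a walk is unique. Hence the
  definite description of the path and the least length in the distance refer to the same
  walk.\<close>

lemma undirected_path_acyclic:
  assumes "wf_digraph F" "cycles F = {}" "s \<in> verts F" "(s, t) \<in> (parcs (mk_symmetric F))\<^sup>*"
  shows "pre_digraph.awalk (with_proj (mk_symmetric F)) s (undirected_path F s t) t"
    "length (undirected_path F s t) = undirected_dist F s t"
proof -
  interpret wf_digraph F by fact
  interpret S: pair_wf_digraph "mk_symmetric F" ..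
  let ?P = "\<lambda>l. \<exists>p. S.awalk s p t \<and> length p = l"
  have "s \<rightarrow>\<^sup>*\<^bsub>mk_symmetric F\<^esub> t"
    using assms(3,4) rtrancl_parcs_in_verts by (auto simp: S.reachable_conv)
  then have ex: "\<exists>l. ?P l" unfolding S.reachable_awalk by blast
  obtain p where p: "S.awalk s p t" "length p = undirected_dist F s t"
    using LeastI_ex[OF ex] unfolding undirected_dist_def by blast
  have "distinct (pawalk_verts s p)"
  proof (rule ccontr)
    assume "\<not> distinct (pawalk_verts s p)"
    then obtain q r z w where "p = q @ r @ z" "0 < length r" "S.awalk s q w" "S.awalk w z t"
      using S.awalk_not_distinct_decomp[OF p(1)] by blast
    then have "S.awalk s (q @ z) t" "length (q @ z) < length p" by auto
    then have "undirected_dist F s t \<le> length (q @ z)"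
      unfolding undirected_dist_def by (intro Least_le) blast
    then show False using p(2) \<open>length (q @ z) < length p\<close> by linarith
  qed
  then have ap: "S.apath s p t" using p(1) by (simp add: S.apath_def)
  have "undirected_path F s t = p"
    unfolding undirected_path_def
    using ap acyclic_apath_unique[OF assms(1,2) _ ap] by (rule the_equality)
  with p show "S.awalk s (undirected_path F s t) t"
    "length (undirected_path F s t) = undirected_dist F s t" by simp_all
qed

lemma awalk_restrict_closed:
  assumes "\<And>x y. (x, y) \<in> parcs (mk_symmetric F) \<Longrightarrow> x \<in> T \<Longrightarrow> y \<in> T" "T \<subseteq> verts F" "s \<in> T"
  shows "pre_digraph.awalk (with_proj (mk_symmetric (F \<restriction> T))) s p t \<longleftrightarrow>
    pre_digraph.awalk (with_proj (mk_symmetric F)) s p t"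
proof -
  have *: "(x, y) \<in> parcs (mk_symmetric (F \<restriction> T)) \<longleftrightarrow> (x, y) \<in> parcs (mk_symmetric F)" if "x \<in> T" for x y
    using assms(1)[of x y] that by (auto simp: parcs_mk_symmetric_iff)
  have "set p \<subseteq> parcs (mk_symmetric (F \<restriction> T)) \<and> pcas s p t \<longleftrightarrow>
      set p \<subseteq> parcs (mk_symmetric F) \<and> pcas s p t"
    using assms(3)
  proof (induction p arbitrary: s)
    case (Cons a p)
    then show ?case
      using *[of s "snd a"] assms(1)[of s "snd a"] by (cases a) auto
  qed simp
  then show ?thesis
    using assms(2,3) by (auto simp: awalk_mk_symmetric_iff)
qed

text \<open>When an arc off the cycle is removed, the remaining graph still has a cycle, and unique
  paths are available only inside the tree component. This lemma carries them over to the graph in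
  which \<open>pinv_entry\<close> measures paths and distances.\<close>

lemma undirected_path_restrict_closed:
  assumes "\<And>x y. (x, y) \<in> parcs (mk_symmetric F) \<Longrightarrow> x \<in> T \<Longrightarrow> y \<in> T" "T \<subseteq> verts F" "s \<in> T"
  shows "undirected_path (F \<restriction> T) s t = undirected_path F s t"
    "undirected_dist (F \<restriction> T) s t = undirected_dist F s t"
  unfolding undirected_path_def undirected_dist_def pre_digraph.apath_def
  by (simp_all add: awalk_restrict_closed[OF assms] awalk_verts_with_proj_eq)

locale unicyclic_functional_graph = functional_graph +
  fixes C
  assumes core_eq: "v \<in> verts H \<Longrightarrow> core v = C" and verts_nonempty: "verts H \<noteq> {}"
begin

lemma C_periodic: "C \<in> periodic_orbits f (verts H)"
  using verts_nonempty core_eq core_periodic by blast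

lemma cycles_C: "cycles H = {e ` C}"
proof -
  have "periodic_orbits f (verts H) = {C}"
  proof -
    have "D = C" if D: "D \<in> periodic_orbits f (verts H)" for D
    proof -
      obtain v where "v \<in> D" using periodic_orbits_nonempty[OF D] by blast
      then show ?thesis
        using core_of_periodic[OF D] core_eq[of v] D by (auto simp: periodic_orbits_def)
    qed
    then show ?thesis using C_periodic by blast
  qed
  then show ?thesis using cycles_eq by simp
qed

lemma the_cycle_C: "the_cycle H = e ` C"
  by (simp add: the_cycle_def cycles_C)

lemma C_subset: "C \<subseteq> verts H"
  using C_periodic by (simp add: periodic_orbits_def)

lemma C_nonempty: "C \<noteq> {}"
  using periodic_orbits_nonempty C_periodic by blast

lemma e_in_C_iff: "c \<in> verts H \<Longrightarrow> e c \<in> e ` C \<longleftrightarrow> c \<in> C"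
  using bij C_subset by (auto simp: bij_betw_def inj_on_def)

lemma parcs_del_arc_iff:
  assumes "c \<in> verts H"
  shows "(x, y) \<in> parcs (mk_symmetric (del_arc (e c))) \<longleftrightarrow>
    (x \<in> verts H \<and> x \<noteq> c \<and> y = f x) \<or> (y \<in> verts H \<and> y \<noteq> c \<and> x = f y)"
proof -
  have "(x, y) \<in> parcs (mk_symmetric (del_arc (e c))) \<longleftrightarrow>
     (\<exists>v\<in>verts H. v \<noteq> c \<and> ((tail H (e v), head H (e v)) = (x, y) \<or> (tail H (e v), head H (e v)) = (y, x)))"
  proof -
    have "arcs H - {e c} = e ` (verts H - {c})"
      using bij assms by (auto simp: bij_betw_def inj_on_def)
    then show ?thesis by (auto simp: parcs_mk_symmetric_iff arcs_del_arc tail_del_arc head_del_arc)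
  qed
  also have "\<dots> \<longleftrightarrow> (\<exists>v\<in>verts H. v \<noteq> c \<and> ((x, y) = (v, f v) \<or> (y, x) = (v, f v)))"
  proof -
    have "(tail H (e v), head H (e v)) = (x, y) \<or> (tail H (e v), head H (e v)) = (y, x) \<longleftrightarrow>
        (x, y) = (v, f v) \<or> (y, x) = (v, f v)" if "v \<in> verts H" for v
      using ends[OF that] by auto
    then show ?thesis by blast
  qed
  also have "\<dots> \<longleftrightarrow> (x \<in> verts H \<and> x \<noteq> c \<and> y = f x) \<or> (y \<in> verts H \<and> y \<noteq> c \<and> x = f y)"
    by auto
  finally show ?thesis .
qed

lemma subgraph_del_arc: "subgraph (del_arc a) H"
  using wf_digraph wf_digraph_del_arc[of a]
  by (auto simp: subgraph_def compatible_def verts_del_arc arcs_del_arc tail_del_arc head_del_arc)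

lemma rtrancl_del_arc_funpow:
  assumes "c \<in> verts H" "v \<in> verts H" "\<And>j. j < i \<Longrightarrow> (f ^^ j) v \<noteq> c"
  shows "(v, (f ^^ i) v) \<in> (parcs (mk_symmetric (del_arc (e c))))\<^sup>*"
  using assms(3)
proof (induction i)
  case (Suc i)
  have "((f ^^ i) v, (f ^^ Suc i) v) \<in> parcs (mk_symmetric (del_arc (e c)))"
    unfolding parcs_del_arc_iff[OF assms(1)] using funpow_in[OF assms(2)] Suc.prems by auto
  with Suc show ?case by (auto intro: rtrancl_into_rtrancl)
qed simp

lemma rtrancl_del_arc_reaches:
  assumes "c \<in> verts H" "v \<in> verts H" "(f ^^ i) v = c"
  shows "(v, c) \<in> (parcs (mk_symmetric (del_arc (e c))))\<^sup>*"
proof -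
  let ?i = "LEAST i. (f ^^ i) v = c"
  have "(f ^^ ?i) v = c" using assms(3) by (rule LeastI)
  moreover have "(f ^^ j) v \<noteq> c" if "j < ?i" for j using not_less_Least[OF that] .
  ultimately show ?thesis using rtrancl_del_arc_funpow[OF assms(1,2), of ?i] by simp
qed

text \<open>Every vertex flows to \<open>c\<close>, because \<open>c\<close> lies on the only cycle,
  and it does so without the arc \<open>e c\<close>; the graph stays connected when that arc
  goes.\<close>

lemma rtrancl_del_cycle_arc:
  assumes "c \<in> C" "u \<in> verts H" "v \<in> verts H"
  shows "(u, v) \<in> (parcs (mk_symmetric (del_arc (e c))))\<^sup>*"
proof -
  have "(v, c) \<in> (parcs (mk_symmetric (del_arc (e c))))\<^sup>*" if "v \<in> verts H" for v
  proof -
    have "c \<in> orbit f v" using core_eq[OF that] assms(1) by (auto simp: core_def)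
    then obtain i where "(f ^^ i) v = c" by (auto simp: orbit_altdef)
    then show ?thesis using rtrancl_del_arc_reaches[OF _ that] C_subset assms(1) by blast
  qed
  from this[OF assms(2)] symD[OF sym_rtrancl[OF sym_parcs_mk_symmetric] this[OF assms(3)]]
  show ?thesis by (rule rtrancl_trans)
qed

lemma cycles_del_cycle_arc:
  assumes "c \<in> C"
  shows "cycles (del_arc (e c)) = {}"
proof -
  have "X \<subseteq> arcs (del_arc (e c))" if "X \<in> cycles (del_arc (e c))" for X
    using that by (auto simp: cycles_def walk_edges_def)
  moreover have "cycles (del_arc (e c)) \<subseteq> {e ` C}"
    using cycles_subgraph[OF oriented subgraph_del_arc] cycles_C by simp
  moreover have "\<not> e ` C \<subseteq> arcs (del_arc (e c))"
    using assms by (auto simp: arcs_del_arc)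
  ultimately show ?thesis by blast
qed

text \<open>For \<open>c\<close> off the cycle this is the vertex set of the tree that falls off
  when \<open>e c\<close> is removed.\<close>

definition branch :: "'a \<Rightarrow> 'a set" where
  "branch c = {v \<in> verts H. \<exists>i. (f ^^ i) v = c}"

lemma self_in_branch: "c \<in> verts H \<Longrightarrow> c \<in> branch c"
  unfolding branch_def by (auto intro: exI[of _ 0])

lemma branch_closed:
  assumes "c \<in> verts H" "(x, y) \<in> parcs (mk_symmetric (del_arc (e c)))"
  shows "x \<in> branch c \<longleftrightarrow> y \<in> branch c"
proof -
  have f: "v \<in> branch c \<longleftrightarrow> f v \<in> branch c" if v: "v \<in> verts H" "v \<noteq> c" for v
  proof
    assume "v \<in> branch c"
    then obtain i where i: "(f ^^ i) v = c" by (auto simp: branch_def)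
    then obtain j where "i = Suc j" using v(2) by (cases i) auto
    then have "(f ^^ j) (f v) = c" using i by (simp add: funpow_swap1)
    then show "f v \<in> branch c" using f_in[OF v(1)] by (auto simp: branch_def)
  next
    assume "f v \<in> branch c"
    then obtain i where "(f ^^ i) (f v) = c" by (auto simp: branch_def)
    then have "(f ^^ Suc i) v = c" by (simp add: funpow_swap1)
    then show "v \<in> branch c" using v(1) unfolding branch_def by blast
  qed
  show ?thesis
    using assms(2) f[of x] f[of y] unfolding parcs_del_arc_iff[OF assms(1)] by auto
qed

lemma rtrancl_branch_closed:
  assumes "c \<in> verts H" "(x, y) \<in> (parcs (mk_symmetric (del_arc (e c))))\<^sup>*"
  shows "x \<in> branch c \<longleftrightarrow> y \<in> branch c"
  using assms(2) by induction (use branch_closed[OF assms(1)] in auto)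

section \<open>Removing an arc off the cycle\<close>

context
  fixes c
  assumes c: "c \<in> verts H" "c \<notin> C"
begin

lemma C_not_in_branch: "C \<inter> branch c = {}"
proof -
  have "(f ^^ i) x \<in> C" if "x \<in> C" for x i
    using cyclic_on_funpow_in[of f C x i] C_periodic that by (simp add: periodic_orbits_def)
  then show ?thesis using c by (auto simp: branch_def)
qed

text \<open>Otherwise iteration from \<open>c\<close> would return to \<open>c\<close> and put
  \<open>c\<close> on the cycle. So the removed arc joins the tree side at \<open>c\<close> to the
  unicyclic side at \<open>f c\<close>.\<close>

lemma f_not_in_branch: "f c \<notin> branch c"
proof
  assume "f c \<in> branch c"
  then obtain i where "(f ^^ i) (f c) = c" by (auto simp: branch_def)
  then have "(f ^^ Suc i) c = c" by (simp add: funpow_swap1)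
  then have "c \<in> orbit f c" unfolding orbit_altdef by (metis (mono_tags) mem_Collect_eq zero_less_Suc)
  then have "c \<in> core c" by (simp add: core_def)
  then show False using core_eq c by simp
qed

lemma rtrancl_off_branch:
  assumes "u \<in> verts H - branch c" "v \<in> verts H - branch c"
  shows "(u, v) \<in> (parcs (mk_symmetric (del_arc (e c))))\<^sup>*"
proof -
  obtain x where x: "x \<in> C" using C_nonempty by blast
  have "(v, x) \<in> (parcs (mk_symmetric (del_arc (e c))))\<^sup>*" if "v \<in> verts H - branch c" for v
  proof -
    have "x \<in> orbit f v" using core_eq[of v] x that by (auto simp: core_def)
    then obtain i where "(f ^^ i) v = x" by (auto simp: orbit_altdef)
    then show ?thesis
      using rtrancl_del_arc_funpow[OF c(1), of v i] that by (auto simp: branch_def)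
  qed
  from this[OF assms(1)] symD[OF sym_rtrancl[OF sym_parcs_mk_symmetric] this[OF assms(2)]]
  show ?thesis by (rule rtrancl_trans)
qed

lemma rtrancl_branch:
  assumes "u \<in> branch c" "v \<in> branch c"
  shows "(u, v) \<in> (parcs (mk_symmetric (del_arc (e c))))\<^sup>*"
proof -
  have "(v, c) \<in> (parcs (mk_symmetric (del_arc (e c))))\<^sup>*" if "v \<in> branch c" for v
    using that rtrancl_del_arc_reaches[OF c(1)] by (auto simp: branch_def)
  from this[OF assms(1)] symD[OF sym_rtrancl[OF sym_parcs_mk_symmetric] this[OF assms(2)]]
  show ?thesis by (rule rtrancl_trans)
qed

lemma reach_class_del_arc:
  assumes "v \<in> verts H"
  shows "reach_class (del_arc (e c)) v = (if v \<in> branch c then branch c else verts H - branch c)"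
proof -
  interpret F: wf_digraph "del_arc (e c)" by (rule wf_digraph_del_arc)
  have "x \<in> verts H" if "x \<in> reach_class (del_arc (e c)) v" for x
    using F.rtrancl_parcs_in_verts[of v x] that assms by (auto simp: reach_class_def verts_del_arc)
  moreover have "x \<in> branch c \<longleftrightarrow> v \<in> branch c" if "x \<in> reach_class (del_arc (e c)) v" for x
    using rtrancl_branch_closed[OF c(1), of v x] that by (auto simp: reach_class_def)
  moreover have "x \<in> reach_class (del_arc (e c)) v"
    if "x \<in> verts H" "x \<in> branch c \<longleftrightarrow> v \<in> branch c" for x
    using rtrancl_branch[of v x] rtrancl_off_branch[of v x] that assms
    by (cases "x \<in> branch c") (auto simp: reach_class_def)
  moreover have "branch c \<subseteq> verts H" by (auto simp: branch_def)
  ultimately show ?thesis by auto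
qed

lemma weak_components_del_arc:
  "weak_components (del_arc (e c)) =
    {del_arc (e c) \<restriction> branch c, del_arc (e c) \<restriction> (verts H - branch c)}"
proof -
  interpret F: wf_digraph "del_arc (e c)" by (rule wf_digraph_del_arc)
  obtain x where x: "x \<in> C" using C_nonempty by blast
  then have "x \<in> verts H" "x \<notin> branch c" using C_not_in_branch C_subset by auto
  moreover note self_in_branch[OF c(1)] c(1)
  ultimately show ?thesis
    unfolding F.weak_components_eq verts_del_arc
    by (auto simp: reach_class_del_arc image_iff split: if_splits)
qed

lemma cycles_branch: "cycles (del_arc (e c) \<restriction> branch c) = {}"
proof -
  let ?T = "del_arc (e c) \<restriction> branch c"
  have sub: "subgraph ?T H"
    by (rule subgraph_trans[OF wf_digraph.subgraph_induce_subgraphI[OF wf_digraph_del_arc] subgraph_del_arc])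
      (auto simp: verts_del_arc branch_def)
  have "X \<subseteq> arcs ?T" if "X \<in> cycles ?T" for X
    using that by (auto simp: cycles_def walk_edges_def)
  moreover have "cycles ?T \<subseteq> {e ` C}"
    using cycles_subgraph[OF oriented sub] cycles_C by simp
  moreover have "\<not> e ` C \<subseteq> arcs ?T"
  proof -
    obtain x where x: "x \<in> C" using C_nonempty by blast
    then have "x \<notin> branch c" "x \<in> verts H" using C_not_in_branch C_subset by auto
    then have "e x \<notin> arcs ?T" using ends[of x] by (auto simp: tail_del_arc head_del_arc)
    then show ?thesis using x by blast
  qed
  ultimately show ?thesis by blast
qed

text \<open>The vertices off the branch are closed under \<open>f\<close> and keep their own arcs,
  so they form a functional graph again, with the same cycle.\<close>

lemma cycles_off_branch: "cycles (del_arc (e c) \<restriction> (verts H - branch c)) = {e ` C}"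
proof -
  let ?R = "verts H - branch c"
  have "f v \<in> ?R" if "v \<in> ?R" for v
    using branch_closed[OF c(1), of v "f v"] parcs_del_arc_iff[OF c(1), of v "f v"] that f_in[of v]
      self_in_branch[OF c(1)] by auto
  then have R: "functional_graph (H \<restriction> ?R) e f" "arcs (H \<restriction> ?R) = e ` ?R"
    using functional_graph_restrict[of ?R] by auto
  have "e c \<notin> arcs (H \<restriction> ?R)"
    unfolding R(2) using bij c self_in_branch[OF c(1)] by (auto simp: bij_betw_def inj_on_def)
  then have "del_arc (e c) \<restriction> ?R = H \<restriction> ?R"
    by (auto simp: induce_subgraph_def del_arc_def)
  moreover have "cycles (H \<restriction> ?R) = {e ` C}"
  proof -
    interpret R: functional_graph "H \<restriction> ?R" e f by (rule R)
    have "periodic_orbits f ?R = {C}"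
    proof -
      have "D = C" if D: "D \<in> periodic_orbits f ?R" for D
      proof -
        obtain v where "v \<in> D" using periodic_orbits_nonempty[OF D] by blast
        then show ?thesis
          using core_of_periodic[OF D] core_eq[of v] D by (auto simp: periodic_orbits_def)
      qed
      moreover have "C \<in> periodic_orbits f ?R"
        using C_periodic C_not_in_branch by (auto simp: periodic_orbits_def)
      ultimately show ?thesis by blast
    qed
    then show ?thesis using R.cycles_eq by simp
  qed
  ultimately show ?thesis by simp
qed

lemma tree_part_branch: "tree_part H (e c) = del_arc (e c) \<restriction> branch c"
  and unicyclic_part_off_branch: "unicyclic_part H (e c) = del_arc (e c) \<restriction> (verts H - branch c)"
proof -
  have conn: "Digraph_Component.connected X" if "X \<in> weak_components (del_arc (e c))" for X
    using that by (auto simp: weak_components_def pre_digraph.max_subgraph_def)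
  show "tree_part H (e c) = del_arc (e c) \<restriction> branch c"
    unfolding tree_part_def
    by (rule the_equality)
      (use conn cycles_branch cycles_off_branch in \<open>auto simp: weak_components_del_arc undirected_tree_def\<close>)
  show "unicyclic_part H (e c) = del_arc (e c) \<restriction> (verts H - branch c)"
    unfolding unicyclic_part_def
    by (rule the_equality)
      (use conn cycles_branch cycles_off_branch in \<open>auto simp: weak_components_del_arc unicyclic_def\<close>)
qed

end

end

section \<open>Determinants of incidence matrices\<close>

text \<open>The principal root commutes with conjugation off its branch cut. Through this fact the
  exclusion of negative real weights enters: it makes the two entries of an incidence column
  conjugate to each other.\<close>

lemma cnj_csqrt_not_neg:
  assumes "z \<notin> neg_reals"
  shows "csqrt (cnj z) = cnj (csqrt z)"
proof -
  have "Im z = 0 \<longrightarrow> 0 \<le> Re z"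
  proof (intro impI leI notI)
    assume "Im z = 0" "Re z < 0"
    then have "z = complex_of_real (Re z)" by (simp add: complex_eq_iff)
    with \<open>Re z < 0\<close> show False using assms unfolding neg_reals_def by blast
  qed
  then show ?thesis
    by (cases "Im z = 0") (auto simp: complex_eq_iff sgn_if)
qed

lemma cmod_sum_squared:
  "(cmod (x + complex_of_real s * y))\<^sup>2 = (cmod x)\<^sup>2 + s\<^sup>2 * (cmod y)\<^sup>2 + 2 * s * Re (x * cnj y)"
  unfolding cmod_power2 by (simp add: power2_eq_square algebra_simps)

locale weighted_oriented_graph =
  fixes G :: "(nat, nat) pre_digraph" and w :: "nat \<Rightarrow> nat \<Rightarrow> complex" and n :: nat
  assumes oriented: "oriented_graph G"
    and verts_eq: "verts G = {0..<n}"
    and weights: "a \<in> arcs G \<Longrightarrow> w (tail G a) (head G a) \<noteq> 0 \<and> w (tail G a) (head G a) \<notin> neg_reals"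
begin

sublocale digraph G
  using oriented by (simp add: oriented_graph_def)

abbreviation adj :: "nat \<Rightarrow> nat \<Rightarrow> complex" where
  "adj \<equiv> adj_entry G w"

text \<open>The incidence entry labelled by the arc itself instead of its column position, so that
  it is common to \<open>G\<close> and all its subgraphs.\<close>

definition inc :: "nat \<Rightarrow> nat \<Rightarrow> complex" where
  "inc i a = (if i = tail G a then csqrt (w (tail G a) (head G a))
    else if i = head G a then csqrt (cnj (w (tail G a) (head G a))) else 0)"

lemma adj_arc:
  assumes "a \<in> arcs G"
  shows "adj (tail G a) (head G a) = w (tail G a) (head G a)"
    "adj (head G a) (tail G a) = cnj (w (tail G a) (head G a))"
proof -
  have "(tail G a, head G a) \<in> arcs_ends G"
    using assms by (auto simp: arcs_ends_conv)
  moreover from this have "(head G a, tail G a) \<notin> arcs_ends G"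
    using oriented by (auto simp: oriented_graph_def)
  ultimately show "adj (tail G a) (head G a) = w (tail G a) (head G a)"
    "adj (head G a) (tail G a) = cnj (w (tail G a) (head G a))"
    by (auto simp: adj_entry_def)
qed

text \<open>The ends are called \<open>x\<close> and \<open>y\<close> in either order, so later
  arguments need not distinguish tail from head.\<close>

lemma inc_adj:
  assumes "a \<in> arcs G" "(tail G a, head G a) = (x, y) \<or> (tail G a, head G a) = (y, x)"
  shows "inc x a * cnj (inc y a) = adj x y" "(cmod (inc x a))\<^sup>2 = cmod (adj x y)"
    "inc x a \<noteq> 0" "adj y x = cnj (adj x y)" "adj x y \<noteq> 0" "x \<noteq> y"
    "cmod (w (tail G a) (head G a)) = cmod (adj x y)"
proof -
  have ne: "tail G a \<noteq> head G a" using no_loops[OF assms(1)] .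
  let ?w = "w (tail G a) (head G a)"
  have w: "?w \<noteq> 0" "csqrt (cnj ?w) = cnj (csqrt ?w)"
    using weights[OF assms(1)] cnj_csqrt_not_neg by auto
  have sq: "csqrt z * csqrt z = z" for z
    by (metis power2_csqrt power2_eq_square)
  show "inc x a * cnj (inc y a) = adj x y"
    using assms(2) ne sq[of ?w] w
    by (auto simp: inc_def adj_arc[OF assms(1)] simp flip: complex_cnj_mult)
  have "(cmod (csqrt z))\<^sup>2 = cmod z" for z
    by (metis norm_power power2_csqrt)
  then show "(cmod (inc x a))\<^sup>2 = cmod (adj x y)"
    using assms(2) ne w by (auto simp: inc_def adj_arc[OF assms(1)])
  show "inc x a \<noteq> 0" "adj y x = cnj (adj x y)" "adj x y \<noteq> 0" "x \<noteq> y" "cmod ?w = cmod (adj x y)"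
    using assms(2) ne w by (auto simp: inc_def adj_arc[OF assms(1)])
qed

lemma inc_eq_0: "i \<noteq> tail G a \<Longrightarrow> i \<noteq> head G a \<Longrightarrow> inc i a = 0"
  by (simp add: inc_def)

definition inc_mat :: "(nat \<Rightarrow> nat) \<Rightarrow> complex mat" where
  "inc_mat e = mat n n (\<lambda>(i, j). inc i (e j))"

lemma inc_mat_carrier [simp]: "inc_mat e \<in> carrier_mat n n"
  by (simp add: inc_mat_def)

text \<open>Two labellings of the same arcs differ by a permutation of the columns, which affects
  only the sign. Thus columns may be labelled by position in one place and by the choosing vertex in
  another.\<close>

lemma cmod_det_inc_mat_cong:
  assumes "bij_betw d {0..<n} S" "bij_betw e {0..<n} S"
  shows "cmod (det (inc_mat d)) = cmod (det (inc_mat e))"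
proof -
  let ?V = "{0..<n}"
  let ?g = "inv_into ?V d"
  define p where "p j = (if j < n then ?g (e j) else j)" for j
  have "bij_betw (?g \<circ> e) ?V ?V"
    using assms bij_betw_inv_into bij_betw_trans by blast
  then have "bij_betw p ?V ?V"
    by (rule bij_betw_cong[THEN iffD1, rotated]) (simp add: p_def)
  then have p: "p permutes ?V"
    by (rule bij_imp_permutes) (simp add: p_def)
  have dp: "d (p j) = e j" if "j < n" for j
  proof -
    have "e j \<in> d ` ?V" using that assms by (auto simp: bij_betw_def)
    then show ?thesis using that by (simp add: p_def f_inv_into_f)
  qed
  have "mat n n (\<lambda>(i, j). transpose_mat (inc_mat d) $$ (p i, j)) = transpose_mat (inc_mat e)"
    using dp permutes_in_image[OF p] by (intro eq_matI) (auto simp: inc_mat_def)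
  then have "det (transpose_mat (inc_mat e)) = signof p * det (transpose_mat (inc_mat d))"
    using det_permute_rows[OF _ p, of "transpose_mat (inc_mat d)"] by simp
  then have "det (inc_mat e) = signof p * det (inc_mat d)"
    using det_transpose[of "inc_mat d" n] det_transpose[of "inc_mat e" n] by simp
  then show ?thesis
    by (cases p rule: sign_cases) (auto simp: norm_mult)
qed

end

section \<open>The determinant of a weighted functional graph\<close>

locale weighted_functional_graph = weighted_oriented_graph + H: functional_graph H e f
  for H :: "(nat, nat) pre_digraph" and e f +
  assumes spanning: "spanning H G"
begin

lemma H_simps: "verts H = {0..<n}" "tail H = tail G" "head H = head G" "arcs H \<subseteq> arcs G"
  "subgraph H G"
  using spanning verts_eq by (auto simp: spanning_def subgraph_def compatible_def)

lemma ends_G: "v < n \<Longrightarrow> (tail G (e v), head G (e v)) = (v, f v) \<or> (tail G (e v), head G (e v)) = (f v, v)"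
  using H.ends[of v] H_simps by simp

lemma e_in_G: "v < n \<Longrightarrow> e v \<in> arcs G"
  using H.e_in[of v] H_simps by auto

lemmas inc_adj_e = inc_adj[OF e_in_G ends_G]

abbreviation orbits :: "nat set set" where
  "orbits \<equiv> periodic_orbits f {0..<n}"

definition orbit_wt :: "nat set \<Rightarrow> complex" where
  "orbit_wt C = (\<Prod>v\<in>C. adj v (f v))"

text \<open>Both parity cases of \<open>cycle_alpha\<close> in one formula.\<close>

definition orbit_alpha :: "nat set \<Rightarrow> real" where
  "orbit_alpha C = cmod (orbit_wt C) - (-1) ^ card C * Re (orbit_wt C)"

lemma orbit_lt: "C \<in> orbits \<Longrightarrow> v \<in> C \<Longrightarrow> v < n"
  by (auto simp: periodic_orbits_def)

lemma card_orbit_ge: "C \<in> orbits \<Longrightarrow> 3 \<le> card C"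
  using H.periodic_orbit_cycle_walk(2)[of C] H_simps by simp

lemma orbit_wt_nonzero: "C \<in> orbits \<Longrightarrow> orbit_wt C \<noteq> 0"
  using inc_adj_e(5) orbit_lt H.finite_verts finite_subset[of C "{0..<n}"]
  by (auto simp: orbit_wt_def periodic_orbits_def prod_zero_iff)

text \<open>The products \<open>?x\<close> and \<open>?y\<close> both have squared modulus
  \<open>cmod (orbit_wt C)\<close>, and \<open>?x * cnj ?y\<close> is \<open>orbit_wt C\<close>.
  Expanding the squared modulus of the sum gives twice the modulus plus or minus twice the real
  part, with the sign of a cyclic permutation.\<close>

lemma orbit_factor:
  assumes "C \<in> orbits"
  shows "(cmod ((\<Prod>v\<in>C. inc v (e v)) + (-1) ^ (card C - 1) * (\<Prod>v\<in>C. inc (f v) (e v))))\<^sup>2 =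
    2 * orbit_alpha C"
proof -
  let ?x = "\<Prod>v\<in>C. inc v (e v)" and ?y = "\<Prod>v\<in>C. inc (f v) (e v)"
  have lt: "v < n" if "v \<in> C" for v using orbit_lt[OF assms that] .
  have "?x * cnj ?y = orbit_wt C"
    unfolding orbit_wt_def cnj_prod prod.distrib[symmetric]
    by (rule prod.cong[OF refl]) (use inc_adj_e(1) lt in auto)
  moreover have "(cmod ?x)\<^sup>2 = cmod (orbit_wt C)"
    unfolding orbit_wt_def prod_norm[symmetric] prod_power_distrib
    by (rule prod.cong[OF refl]) (use inc_adj_e(2) lt in auto)
  moreover have "(cmod (inc (f v) (e v)))\<^sup>2 = cmod (adj v (f v))" if "v < n" for v
  proof -
    have "(cmod (inc (f v) (e v)))\<^sup>2 = cmod (adj (f v) v)"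
      using inc_adj(2)[OF e_in_G[OF that], of "f v" v] ends_G[OF that] by blast
    then show ?thesis using inc_adj_e(4)[OF that that] by simp
  qed
  then have "(cmod ?y)\<^sup>2 = cmod (orbit_wt C)"
    unfolding orbit_wt_def prod_norm[symmetric] prod_power_distrib
    by (intro prod.cong[OF refl]) (use lt in auto)
  moreover have "orbit_alpha C = cmod (orbit_wt C) + (-1) ^ (card C - 1) * Re (orbit_wt C)"
    using card_orbit_ge[OF assms] by (cases "card C") (auto simp: orbit_alpha_def)
  moreover have "((-1 :: real) ^ (card C - 1))\<^sup>2 = 1"
    by (cases "even (card C - 1)") auto
  moreover have "(-1) ^ (card C - 1) = complex_of_real ((-1) ^ (card C - 1))"
    by simp
  ultimately show ?thesis
    unfolding cmod_sum_squared by (simp only: cmod_sum_squared) (simp add: algebra_simps)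
qed

lemma det_inc_mat_squared:
  "(cmod (det (inc_mat e)))\<^sup>2 =
    (\<Prod>C\<in>orbits. 2 * orbit_alpha C) * (\<Prod>v\<in>{0..<n} - \<Union>orbits. cmod (adj v (f v)))"
proof -
  have "inc_mat e = mat n n (\<lambda>(i, j). if i = j then inc j (e j) else if i = f j then inc (f j) (e j) else 0)"
    unfolding inc_mat_def using ends_G
    by (intro cong_mat) (auto intro!: inc_eq_0)
  moreover have "f v < n" "f v \<noteq> v" if "v < n" for v
    using H.f_in[of v] H.f_ne[of v] that by (simp_all add: H_simps)
  ultimately have "det (inc_mat e) =
    (\<Prod>C\<in>orbits. (\<Prod>v\<in>C. inc v (e v)) + (-1) ^ (card C - 1) * (\<Prod>v\<in>C. inc (f v) (e v))) *
    (\<Prod>v\<in>{0..<n} - \<Union>orbits. inc v (e v))"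
    using det_functional_mat[of n f "\<lambda>j. inc j (e j)" "\<lambda>j. inc (f j) (e j)"] by simp
  then have "(cmod (det (inc_mat e)))\<^sup>2 =
    (\<Prod>C\<in>orbits. (cmod ((\<Prod>v\<in>C. inc v (e v)) + (-1) ^ (card C - 1) * (\<Prod>v\<in>C. inc (f v) (e v))))\<^sup>2) *
    (\<Prod>v\<in>{0..<n} - \<Union>orbits. (cmod (inc v (e v)))\<^sup>2)"
    by (simp add: norm_mult power_mult_distrib prod_power_distrib flip: prod_norm)
  also have "\<dots> = (\<Prod>C\<in>orbits. 2 * orbit_alpha C) * (\<Prod>v\<in>{0..<n} - \<Union>orbits. cmod (adj v (f v)))"
    by (intro arg_cong2[of _ _ _ _ "(*)"] prod.cong refl orbit_factor inc_adj_e(2)) auto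
  finally show ?thesis .
qed

lemma walk_wt_steps_along:
  assumes "H.steps_along p C" "C \<in> orbits"
  shows "walk_wt G w p = orbit_wt C \<or> walk_wt G w p = cnj (orbit_wt C)"
proof -
  have "walk_wt G w p = (\<Prod>s\<in>set p. adj (fst s) (snd s))"
    using assms(1) unfolding walk_wt_def by (simp add: prod.distinct_set_conv_list split_def)
  moreover have "(\<Prod>s\<in>(\<lambda>v. (v, f v)) ` C. adj (fst s) (snd s)) = orbit_wt C"
    by (subst prod.reindex) (auto simp: inj_on_def orbit_wt_def)
  moreover have "(\<Prod>s\<in>(\<lambda>v. (f v, v)) ` C. adj (fst s) (snd s)) = cnj (orbit_wt C)"
  proof -
    have "(\<Prod>s\<in>(\<lambda>v. (f v, v)) ` C. adj (fst s) (snd s)) = (\<Prod>v\<in>C. adj (f v) v)"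
      by (subst prod.reindex) (auto simp: inj_on_def)
    also have "\<dots> = cnj (orbit_wt C)"
      unfolding orbit_wt_def cnj_prod
      by (rule prod.cong[OF refl]) (use inc_adj_e(4) orbit_lt[OF assms(2)] in auto)
    finally show ?thesis .
  qed
  ultimately show ?thesis using assms(1) by auto
qed

text \<open>The traversal behind \<open>cycle_wt\<close> is an arbitrary one in \<open>G\<close>.
  Its arcs are those chosen by \<open>C\<close>, so it is a cycle of \<open>H\<close> and runs along
  or against some orbit; comparing arcs shows that this orbit is \<open>C\<close>.\<close>

lemma cycle_wt_orbit:
  assumes "C \<in> orbits"
  shows "cycle_wt G w (e ` C) = orbit_wt C \<or> cycle_wt G w (e ` C) = cnj (orbit_wt C)"
proof -
  let ?P = "\<lambda>p. cycle_walk G p \<and> walk_edges G p = e ` C"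
  have CH: "C \<in> periodic_orbits f (verts H)" using assms by (simp add: H_simps)
  then have "e ` C \<in> cycles H" by (auto simp: H.cycles_eq)
  then have "e ` C \<in> cycles G"
    using cycles_subgraph[OF oriented H_simps(5)] by blast
  then have "\<exists>p. ?P p" by (auto simp: cycles_def)
  then obtain p where p: "?P p" "cycle_wt G w (e ` C) = walk_wt G w p"
    unfolding cycle_wt_def by (metis (mono_tags, lifting) someI_ex)
  have CV: "C \<subseteq> {0..<n}" using assms by (simp add: periodic_orbits_def)
  have eC: "e ` C \<subseteq> arcs H" using H.e_in CV by (auto simp: H_simps)
  have "set p \<subseteq> parcs (mk_symmetric H)"
  proof
    fix s assume s: "s \<in> set p"
    obtain x y where xy: "s = (x, y)" by (cases s)
    have "s \<in> parcs (mk_symmetric G)"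
      using p(1) s unfolding cycle_walk_def pre_digraph.cycle_def awalk_mk_symmetric_iff by blast
    then obtain a where a: "a \<in> arcs G" "(tail G a, head G a) = (x, y) \<or> (tail G a, head G a) = (y, x)"
      unfolding xy parcs_mk_symmetric_iff by blast
    then have "a \<in> walk_edges G p" using s xy by (auto simp: walk_edges_def)
    then have "a \<in> arcs H" using p(1) eC by auto
    then show "s \<in> parcs (mk_symmetric H)"
      using a unfolding xy parcs_mk_symmetric_iff by (auto simp: H_simps)
  qed
  then have cH: "cycle_walk H p"
    using p(1) verts_eq H_simps(1) unfolding cycle_walk_def pre_digraph.cycle_def awalk_mk_symmetric_iff
      awalk_verts_with_proj_eq by auto
  then obtain D where D: "D \<in> orbits" "H.steps_along p D"
    using H.cycle_walk_steps_along[OF cH] by (auto simp: H_simps)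
  have DV: "D \<subseteq> {0..<n}" using D(1) by (simp add: periodic_orbits_def)
  have "e ` D = walk_edges H p"
    using H.walk_edges_steps_along[OF D(2)] DV by (simp add: H_simps)
  also have "\<dots> \<subseteq> walk_edges G p"
    using H_simps by (auto simp: walk_edges_def)
  finally have sub: "e ` D \<subseteq> e ` C" using p(1) by simp
  have "D \<subseteq> C"
  proof
    fix x assume x: "x \<in> D"
    then obtain y where y: "y \<in> C" "e x = e y" using sub by blast
    have "inj_on e {0..<n}" using H.bij by (simp add: bij_betw_def H_simps)
    then have "x = y" using x y CV DV by (auto dest: inj_onD)
    then show "x \<in> C" using y by simp
  qed
  moreover obtain v where "v \<in> D" using H.periodic_orbits_nonempty[OF D(1)] by blast
  ultimately have "D = C"
    using H.core_of_periodic[OF D(1)] H.core_of_periodic[OF assms] by blast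
  then show ?thesis using walk_wt_steps_along[OF D(2,1)] p(2) by simp
qed

lemma card_e_image: "C \<in> orbits \<Longrightarrow> card (e ` C) = card C"
  using H.bij by (intro card_image) (auto simp: bij_betw_def H_simps periodic_orbits_def intro: inj_on_subset)

lemma cycle_alpha_orbit:
  assumes "C \<in> orbits"
  shows "cycle_alpha G w (e ` C) = orbit_alpha C"
  using cycle_wt_orbit[OF assms]
  by (auto simp: cycle_alpha_def orbit_alpha_def card_e_image[OF assms])

lemma orbit_alpha_eq_0_iff:
  assumes "C \<in> orbits"
  shows "orbit_alpha C = 0 \<longleftrightarrow>
    (even (card C) \<and> cycle_wt G w (e ` C) \<in> pos_reals) \<or>
    (odd (card C) \<and> cycle_wt G w (e ` C) \<in> neg_reals)"
proof -
  let ?z = "cycle_wt G w (e ` C)"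
  have z: "cmod ?z = cmod (orbit_wt C)" "Re ?z = Re (orbit_wt C)" "?z \<noteq> 0"
    using cycle_wt_orbit[OF assms] orbit_wt_nonzero[OF assms] by auto
  have real: "z = complex_of_real (Re z)" if "cmod z = \<bar>Re z\<bar>" for z
    using that by (simp add: complex_eq_iff cmod_def real_sqrt_eq_iff) (metis abs_norm_cancel
      add_cancel_right_right cmod_power2 power2_abs power_eq_0_iff that zero_neq_numeral)
  have "cmod ?z - Re ?z = 0 \<longleftrightarrow> ?z \<in> pos_reals"
  proof
    assume *: "cmod ?z - Re ?z = 0"
    moreover have "0 < cmod ?z" using z(3) by simp
    ultimately have "cmod ?z = \<bar>Re ?z\<bar>" "0 < Re ?z" by linarith+
    then show "?z \<in> pos_reals"
      using real[of ?z] unfolding pos_reals_def by (intro image_eqI[of _ _ "Re ?z"]) auto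
  qed (auto simp: pos_reals_def)
  moreover have "cmod ?z + Re ?z = 0 \<longleftrightarrow> ?z \<in> neg_reals"
  proof
    assume *: "cmod ?z + Re ?z = 0"
    moreover have "0 < cmod ?z" using z(3) by simp
    ultimately have "cmod ?z = \<bar>Re ?z\<bar>" "Re ?z < 0" by linarith+
    then show "?z \<in> neg_reals"
      using real[of ?z] unfolding neg_reals_def by (intro image_eqI[of _ _ "Re ?z"]) auto
  qed (auto simp: neg_reals_def)
  ultimately show ?thesis
    using z by (cases "even (card C)") (auto simp: orbit_alpha_def)
qed

text \<open>The basins partition the vertices. Within a basin the arcs off the cycle are those
  chosen by the vertices off the cycle, so the tree weights of all components together give the
  product over the vertices lying on no cycle.\<close>

lemma subgraph_pi_eq_det: "subgraph_pi G w H = (cmod (det (inc_mat e)))\<^sup>2"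
proof -
  let ?U = "\<lambda>C. H \<restriction> H.basin C"
  have fin: "finite (H.basin C)" for C
    using H.basin_subset[of C] by (auto intro: finite_subset simp: H_simps)
  have "2 * cmod (edges_wt (del_edges (?U C) (the_cycle (?U C))) w) * cycle_alpha G w (the_cycle (?U C)) =
      (2 * orbit_alpha C) * (\<Prod>v\<in>H.basin C - C. cmod (adj v (f v)))" if C: "C \<in> orbits" for C
  proof -
    have CH: "C \<in> periodic_orbits f (verts H)" using C by (simp add: H_simps)
    have inj: "inj_on e (H.basin C)"
      using H.bij H.basin_subset[of C] by (auto simp: bij_betw_def intro: inj_on_subset)
    have "arcs (del_edges (?U C) (e ` C)) = e ` H.basin C - e ` C"
      using H.functional_graph_basin(2)[of C] by (simp add: del_edges_def)
    also have "\<dots> = e ` (H.basin C - C)"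
      using inj H.periodic_subset_basin[OF CH] by (simp add: inj_on_image_set_diff)
    finally have "edges_wt (del_edges (?U C) (e ` C)) w =
        (\<Prod>v\<in>H.basin C - C. w (tail G (e v)) (head G (e v)))"
      using inj_on_subset[OF inj, of "H.basin C - C"]
      by (simp add: edges_wt_def prod.reindex del_edges_def H_simps)
    then have "cmod (edges_wt (del_edges (?U C) (e ` C)) w) =
        (\<Prod>v\<in>H.basin C - C. cmod (w (tail G (e v)) (head G (e v))))"
      by (simp add: prod_norm)
    also have "\<dots> = (\<Prod>v\<in>H.basin C - C. cmod (adj v (f v)))"
      using H.basin_subset[of C] by (intro prod.cong[OF refl] inc_adj_e(7)) (auto simp: H_simps)
    finally show ?thesis
      using H.cycles_basin(2)[OF CH] cycle_alpha_orbit[OF C] by simp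
  qed
  note factor = this
  have inj: "inj_on ?U orbits"
    using H.inj_on_restrict_basin by (simp add: H_simps)
  have "subgraph_pi G w H =
      (\<Prod>C\<in>orbits. (2 * orbit_alpha C) * (\<Prod>v\<in>H.basin C - C. cmod (adj v (f v))))"
    unfolding subgraph_pi_def H.weak_components_basin H_simps(1) prod.reindex[OF inj] o_def
    by (rule prod.cong[OF refl]) (rule factor)
  also have "\<dots> = (\<Prod>C\<in>orbits. 2 * orbit_alpha C) *
      (\<Prod>C\<in>orbits. \<Prod>v\<in>H.basin C - C. cmod (adj v (f v)))"
    by (rule prod.distrib)
  also have "(\<Prod>C\<in>orbits. \<Prod>v\<in>H.basin C - C. cmod (adj v (f v))) =
      (\<Prod>v\<in>(\<Union>C\<in>orbits. H.basin C - C). cmod (adj v (f v)))"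
    by (rule prod.UNION_disjoint[symmetric])
      (use fin in \<open>auto simp: finite_periodic_orbits H.basin_def\<close>)
  also have "(\<Union>C\<in>orbits. H.basin C - C) = {0..<n} - \<Union>orbits"
  proof -
    have A: "v < n \<and> v \<notin> D" if "C \<in> orbits" "v \<in> H.basin C - C" "D \<in> orbits" for v C D
      using that H.core_of_periodic[OF that(3), of v] by (auto simp: H.basin_def H_simps)
    have B: "H.core v \<in> orbits" "v \<in> H.basin (H.core v)" if "v < n" for v
      using H.core_periodic[of v] that by (simp_all add: H.basin_def H_simps)
    show ?thesis
    proof (intro equalityI subsetI)
      fix v assume "v \<in> (\<Union>C\<in>orbits. H.basin C - C)"
      then obtain C where C: "C \<in> orbits" "v \<in> H.basin C - C" by blast
      show "v \<in> {0..<n} - \<Union>orbits" using A[OF C] C(1) by auto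
    next
      fix v assume "v \<in> {0..<n} - \<Union>orbits"
      then have v: "v < n" "v \<notin> H.core v" using B(1)[of v] by auto
      then show "v \<in> (\<Union>C\<in>orbits. H.basin C - C)" using B[OF v(1)] by blast
    qed
  qed
  finally show ?thesis by (simp add: det_inc_mat_squared)
qed

lemma in_unicyclic_family_iff_alpha:
  "H \<in> unicyclic_family G w \<longleftrightarrow> (\<forall>C\<in>orbits. orbit_alpha C \<noteq> 0)"
proof -
  have card: "card (arcs H) = card (verts H)"
    using bij_betw_same_card[OF H.bij] by simp
  have "(\<forall>U\<in>weak_components H. unicyclic U \<and>
      (even (card (the_cycle U)) \<longrightarrow> cycle_wt G w (the_cycle U) \<notin> pos_reals) \<and>
      (odd (card (the_cycle U)) \<longrightarrow> cycle_wt G w (the_cycle U) \<notin> neg_reals)) \<longleftrightarrow>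
    (\<forall>C\<in>orbits. orbit_alpha C \<noteq> 0)"
    unfolding H.weak_components_basin H_simps
    using H.cycles_basin(2,3) by (auto simp: H_simps orbit_alpha_eq_0_iff card_e_image)
  then show ?thesis
    using spanning card by (simp add: unicyclic_family_def spanning_def)
qed

lemma in_unicyclic_family_iff: "H \<in> unicyclic_family G w \<longleftrightarrow> det (inc_mat e) \<noteq> 0"
proof -
  have "H \<in> unicyclic_family G w \<longleftrightarrow> (\<forall>C\<in>orbits. orbit_alpha C \<noteq> 0)"
    by (rule in_unicyclic_family_iff_alpha)
  also have "\<dots> \<longleftrightarrow> (cmod (det (inc_mat e)))\<^sup>2 \<noteq> 0"
    unfolding det_inc_mat_squared using inc_adj_e(5)
    by (auto simp: prod_zero_iff finite_periodic_orbits)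
  finally show ?thesis by simp
qed

end

section \<open>Invertible square submatrices and the family of subgraphs\<close>

context weighted_oriented_graph
begin

lemma det_inc_mat_nonzero_choice:
  assumes "det (inc_mat d) \<noteq> 0" "spanning H G" "bij_betw d {0..<n} (arcs H)"
  obtains e f where "weighted_functional_graph G w n H e f"
proof -
  let ?V = "{0..<n}"
  have H: "verts H = ?V" "tail H = tail G" "head H = head G" "subgraph H G"
    using assms(2) verts_eq by (auto simp: spanning_def subgraph_def compatible_def)
  have "\<exists>p. p permutes ?V \<and> (\<Prod>j<n. inc_mat d $$ (p j, j)) \<noteq> 0"
  proof (rule ccontr)
    assume "\<not> ?thesis"
    then have "det (inc_mat d) = 0"
      unfolding det_col[OF inc_mat_carrier] by (intro sum.neutral) auto
    then show False using assms(1) by simp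
  qed
  then obtain p where p: "p permutes ?V" "\<And>j. j < n \<Longrightarrow> inc_mat d $$ (p j, j) \<noteq> 0"
    by (auto simp: prod_zero_iff)
  have pj: "p j = tail G (d j) \<or> p j = head G (d j)" if "j < n" for j
  proof (rule ccontr)
    assume "\<not> ?thesis"
    moreover have "p j < n" using permutes_in_image[OF p(1), of j] that by simp
    ultimately show False using p(2)[OF that] that inc_eq_0 by (simp add: inc_mat_def)
  qed
  \<comment> \<open>\<open>p\<close> sends a column to an end of its arc; choosing an arc for each
    vertex needs the inverse.\<close>
  define q where "q = inv_into UNIV p"
  have q: "q permutes ?V" using p(1) permutes_inv q_def by blast
  have pq: "p (q v) = v" for v unfolding q_def using p(1) permutes_inverses by metis
  define e where "e = d \<circ> q"
  define f where "f v = (if v = tail G (e v) then head G (e v) else tail G (e v))" for v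
  have "weighted_functional_graph G w n H e f"
  proof
    show "oriented_graph H" by (rule oriented_graph_subgraph[OF oriented H(4)])
    show "bij_betw e (verts H) (arcs H)"
      unfolding e_def H(1) using permutes_imp_bij[OF q] assms(3) by (rule bij_betw_trans)
    fix v assume "v \<in> verts H"
    then have "q v < n" using permutes_in_image[OF q, of v] H(1) by simp
    then have "v = tail G (e v) \<or> v = head G (e v)"
      using pj[of "q v"] pq by (simp add: e_def)
    then show "(tail H (e v), head H (e v)) = (v, f v) \<or> (tail H (e v), head H (e v)) = (f v, v)"
      by (auto simp: f_def H)
  qed (rule assms(2))
  then show ?thesis by (rule that)
qed

text \<open>Every component contains a cycle, so distinct incident arcs can be chosen for all
  vertices; there are as many arcs as vertices, hence the choice exhausts them.\<close>

lemma unicyclic_family_choice: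
  assumes "H \<in> unicyclic_family G w"
  obtains e f where "weighted_functional_graph G w n H e f"
proof -
  have H: "spanning H G" "card (arcs H) = card (verts G)"
    "\<And>U. U \<in> weak_components H \<Longrightarrow> unicyclic U"
    using assms by (auto simp: unicyclic_family_def)
  then have sub: "subgraph H G" and V: "verts H = {0..<n}"
    using verts_eq by (auto simp: spanning_def)
  have orH: "oriented_graph H" by (rule oriented_graph_subgraph[OF oriented sub])
  obtain e f where ef: "incident_choice H e f (verts H)"
    using components_incident_choice[OF orH] H(3) unfolding unicyclic_def by (metis empty_iff)
  have "finite (arcs H)" using finite_subset[OF _ finite_arcs, of "arcs H"] sub by (simp add: subgraph_def)
  then have "e ` verts H = arcs H"
    using ef H(2) V verts_eq by (intro card_subset_eq) (auto simp: incident_choice_def card_image)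
  then have "H\<lparr>arcs := e ` verts H\<rparr> = H" by simp
  then interpret F: functional_graph H e f
    using incident_choice_functional_graph[OF orH ef] by simp
  have "weighted_functional_graph G w n H e f"
    by unfold_locales (rule H(1))
  then show ?thesis by (rule that)
qed

lemma det_unicyclic_family:
  assumes "H \<in> unicyclic_family G w" "bij_betw d {0..<n} (arcs H)"
  shows "subgraph_pi G w H = (cmod (det (inc_mat d)))\<^sup>2" "det (inc_mat d) \<noteq> 0"
proof -
  obtain e f where "weighted_functional_graph G w n H e f"
    by (rule unicyclic_family_choice[OF assms(1)], rule that)
  then interpret W: weighted_functional_graph G w n H e f .
  have "cmod (det (inc_mat d)) = cmod (det (inc_mat e))"
    using cmod_det_inc_mat_cong[OF assms(2)] W.H.bij by (simp add: W.H_simps)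
  then show "subgraph_pi G w H = (cmod (det (inc_mat d)))\<^sup>2" "det (inc_mat d) \<noteq> 0"
    using W.subgraph_pi_eq_det W.in_unicyclic_family_iff assms(1) by auto
qed

lemma det_not_unicyclic_family:
  assumes "spanning H G" "H \<notin> unicyclic_family G w" "bij_betw d {0..<n} (arcs H)"
  shows "det (inc_mat d) = 0"
proof (rule ccontr)
  assume nz: "det (inc_mat d) \<noteq> 0"
  obtain e f where "weighted_functional_graph G w n H e f"
    by (rule det_inc_mat_nonzero_choice[OF nz assms(1,3)], rule that)
  then interpret W: weighted_functional_graph G w n H e f .
  have "cmod (det (inc_mat d)) = cmod (det (inc_mat e))"
    using cmod_det_inc_mat_cong[OF assms(3)] W.H.bij by (simp add: W.H_simps)
  then show False
    using W.in_unicyclic_family_iff assms(2) nz by auto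
qed

text \<open>The spanning subgraph grown around \<open>X\<close> has \<open>X\<close> as its only
  cycle, and the weight condition makes its factor nonzero. This will make \<open>vol2\<close>
  positive.\<close>

lemma unicyclic_family_nonempty:
  assumes "Digraph_Component.connected G" "X \<in> cycles G"
    "(odd (card X) \<and> cycle_wt G w X \<notin> neg_reals) \<or> (even (card X) \<and> cycle_wt G w X \<notin> pos_reals)"
  shows "unicyclic_family G w \<noteq> {}"
proof -
  obtain e f C where ef: "incident_choice G e f (verts G)" "C \<in> periodic_orbits f (verts G)" "X = e ` C"
    "\<And>v. v \<in> verts G \<Longrightarrow> \<exists>i. (f ^^ i) v \<in> C"
    by (rule connected_cycle_incident_choice[OF oriented assms(1,2)], rule that)
  define H where "H = G\<lparr>arcs := e ` verts G\<rparr>"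
  interpret F: functional_graph H e f
    unfolding H_def by (rule incident_choice_functional_graph[OF oriented ef(1)])
  interpret W: weighted_functional_graph G w n H e f
    using ef(1) F.wf_digraph wf_digraph
    by unfold_locales (auto simp: H_def spanning_def subgraph_def compatible_def incident_choice_def)
  have C: "C \<in> W.orbits" using ef(2) by (simp add: verts_eq)
  have "W.orbits \<subseteq> {C}"
  proof
    fix D assume D: "D \<in> W.orbits"
    obtain v where v: "v \<in> D" using F.periodic_orbits_nonempty[OF D] by blast
    then obtain i where i: "(f ^^ i) v \<in> C"
      using ef(4)[of v] W.orbit_lt[OF D] by (auto simp: verts_eq)
    moreover have "(f ^^ i) v \<in> D"
      using cyclic_on_funpow_in[of f D v i] D v by (simp add: periodic_orbits_def)
    ultimately show "D \<in> {C}"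
      using F.core_of_periodic[OF D] F.core_of_periodic[OF C] by blast
  qed
  moreover have "W.orbit_alpha C \<noteq> 0"
    using W.orbit_alpha_eq_0_iff[OF C] W.card_e_image[OF C] assms(3) ef(3) by auto
  ultimately have "H \<in> unicyclic_family G w"
    using W.in_unicyclic_family_iff_alpha by blast
  then show ?thesis by blast
qed

end

section \<open>The inverse of the signless Laplacian\<close>

lemma mat_adjoint_one: "mat_adjoint (1\<^sub>m n :: complex mat) = 1\<^sub>m n"
  by (rule eq_matI) (auto simp: mat_adjoint_def mat_of_rows_def)

text \<open>For an invertible matrix the equation \<open>A * X * A = A\<close> cancels on both sides
  to \<open>X = B\<close>.\<close>

lemma mp_inverse_eq:
  assumes A: "A \<in> carrier_mat n n" and B: "B \<in> carrier_mat n n" and inv: "A * B = 1\<^sub>m n" "B * A = 1\<^sub>m n"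
  shows "mp_inverse A = B"
  unfolding mp_inverse_def
proof (rule the_equality)
  show "is_mp_inverse A B"
    using assms by (simp add: is_mp_inverse_def mat_adjoint_one)
  fix X assume "is_mp_inverse A X"
  then have X: "X \<in> carrier_mat n n" "A * X * A = A"
    using A by (auto simp: is_mp_inverse_def)
  have "X = (B * A) * X * (A * B)"
    using X A B by (simp add: inv)
  also have "\<dots> = B * (A * X * A) * B"
    using X(1) A B by (simp add: assoc_mult_mat[of _ n n _ n _ n])
  also have "\<dots> = B"
    using A B by (simp add: X(2) inv)
  finally show "X = B" .
qed

lemma det_nonzero_inverse:
  assumes A: "(A :: 'a :: field mat) \<in> carrier_mat n n" and "det A \<noteq> 0"
  obtains B where "B \<in> carrier_mat n n" "A * B = 1\<^sub>m n" "B * A = 1\<^sub>m n"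
proof -
  let ?B = "(1 / det A) \<cdot>\<^sub>m adj_mat A"
  have adj: "adj_mat A \<in> carrier_mat n n" "A * adj_mat A = det A \<cdot>\<^sub>m 1\<^sub>m n"
    using adj_mat[OF A] by auto
  have "A * ?B = (1 / det A) \<cdot>\<^sub>m (A * adj_mat A)"
    by (rule mult_smult_distrib[OF A adj(1)])
  also have "\<dots> = 1\<^sub>m n"
    unfolding adj(2) using assms(2) by (intro eq_matI) auto
  finally have "A * ?B = 1\<^sub>m n" .
  moreover have "?B \<in> carrier_mat n n" using adj(1) by simp
  ultimately show ?thesis
    using mat_mult_left_right_inverse[OF A] that by blast
qed

lemma bij_betw_pick:
  assumes "finite S"
  shows "bij_betw (pick S) {0..<card S} S"
proof -
  have "inj_on (pick S) {0..<card S}"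
    by (rule inj_onI) (metis atLeastLessThan_iff less_irrefl linorder_neqE_nat pick_mono_le)
  moreover have "pick S ` {0..<card S} = S"
    using calculation assms by (intro card_subset_eq) (auto simp: card_image pick_in_set_le)
  ultimately show ?thesis by (simp add: bij_betw_def)
qed

section \<open>Column bases and the exchange of arcs\<close>

context weighted_oriented_graph
begin

abbreviation family :: "(nat, nat) pre_digraph set" where
  "family \<equiv> unicyclic_family G w"

lemma familyD:
  assumes "H \<in> family"
  shows "verts H = {0..<n}" "tail H = tail G" "head H = head G" "arcs H \<subseteq> arcs G" "card (arcs H) = n"
    "spanning H G" "finite (arcs H)" "H = G\<lparr>arcs := arcs H\<rparr>"
proof -
  show sp: "spanning H G" using assms by (simp add: unicyclic_family_def)
  then show eq: "verts H = {0..<n}" "tail H = tail G" "head H = head G" "arcs H \<subseteq> arcs G"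
    using verts_eq by (auto simp: spanning_def subgraph_def compatible_def)
  show "H = G\<lparr>arcs := arcs H\<rparr>"
    by (rule pre_digraph.equality) (simp_all add: eq(1-3) verts_eq)
  show "card (arcs H) = n" using assms verts_eq by (simp add: unicyclic_family_def)
  show "finite (arcs H)" by (rule finite_subset[OF eq(4) finite_arcs])
qed

lemma finite_family: "finite family"
proof (rule finite_subset)
  show "family \<subseteq> (\<lambda>S. G\<lparr>arcs := S\<rparr>) ` Pow (arcs G)"
    using familyD(4,8) by blast
qed simp

lemma spanning_arcs_subset:
  assumes "S \<subseteq> arcs G"
  shows "spanning (G\<lparr>arcs := S\<rparr>) G"
  using assms wf_digraph wellformed
  by (auto simp: spanning_def subgraph_def compatible_def intro!: wf_digraph.intro)

lemma subgraph_pi_pos: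
  assumes "H \<in> family"
  shows "0 < subgraph_pi G w H"
  using det_unicyclic_family[OF assms] bij_betw_pick[OF familyD(7)[OF assms]] familyD(5)[OF assms] by simp

text \<open>The two inverse relations as sums over vertices and over arcs. They free the rest of the
  proof from column positions and from \<open>edge_pos\<close>.\<close>

lemma incidence_pinv_inverse:
  assumes H: "H \<in> family"
  shows "k \<in> arcs H \<Longrightarrow> l \<in> arcs H \<Longrightarrow>
      (\<Sum>j<n. incidence_pinv H w k j * inc j l) = (if k = l then 1 else 0)" (is "_ \<Longrightarrow> _ \<Longrightarrow> ?L k l")
    and "i < n \<Longrightarrow> j < n \<Longrightarrow>
      (\<Sum>k\<in>arcs H. inc i k * incidence_pinv H w k j) = (if i = j then 1 else 0)" (is "_ \<Longrightarrow> _ \<Longrightarrow> ?R i j")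
proof -
  let ?d = "pick (arcs H)"
  note D = familyD[OF H]
  have bij: "bij_betw ?d {0..<n} (arcs H)"
    using bij_betw_pick[OF D(7)] D(5) by simp
  have inc: "incidence_mat H w = inc_mat ?d"
    unfolding incidence_mat_def inc_mat_def inc_def D(1,2,3,5) Let_def by simp
  obtain B where B: "B \<in> carrier_mat n n" "inc_mat ?d * B = 1\<^sub>m n" "B * inc_mat ?d = 1\<^sub>m n"
    by (rule det_nonzero_inverse[OF inc_mat_carrier det_unicyclic_family(2)[OF H bij]], rule that)
  have mp: "mp_inverse (incidence_mat H w) = B"
    unfolding inc using mp_inverse_eq[OF inc_mat_carrier B] .
  have pos: "edge_pos H (?d q) = q" if "q < n" for q
    using card_pick_le[of q "arcs H"] that D(5) by (simp add: edge_pos_def)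
  have pinv: "incidence_pinv H w (?d q) j = B $$ (q, j)" if "q < n" for q j
    by (simp add: incidence_pinv_def mp pos[OF that])
  have inj: "inj_on ?d {0..<n}"
    using bij by (simp add: bij_betw_def)
  {
    assume "k \<in> arcs H" "l \<in> arcs H"
    then have "k \<in> ?d ` {0..<n}" "l \<in> ?d ` {0..<n}"
      using bij by (simp_all add: bij_betw_def)
    then obtain p q where pq: "p < n" "q < n" "k = ?d p" "l = ?d q" by auto
    have "(\<Sum>j<n. incidence_pinv H w k j * inc j l) = (B * inc_mat ?d) $$ (p, q)"
      using B(1) pq pinv by (simp add: scalar_prod_def inc_mat_def atLeast0LessThan)
    then show "?L k l"
      using pq inj by (auto simp: B(3) inj_on_def)
  }
  {
    assume ij: "i < n" "j < n"
    have "(\<Sum>k\<in>arcs H. inc i k * incidence_pinv H w k j) =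
        (\<Sum>q\<in>{0..<n}. inc i (?d q) * incidence_pinv H w (?d q) j)"
      by (rule sum.reindex_bij_betw[OF bij, symmetric])
    also have "\<dots> = (inc_mat ?d * B) $$ (i, j)"
      using B(1) ij pinv by (simp add: scalar_prod_def inc_mat_def)
    finally show "?R i j" using ij by (simp add: B(2))
  }
qed

text \<open>For \<open>H\<close> in the family its columns form a basis, and this is the coordinate
  at \<open>k\<close> of the column of \<open>l\<close>.\<close>

definition coord :: "(nat, nat) pre_digraph \<Rightarrow> nat \<Rightarrow> nat \<Rightarrow> complex" where
  "coord H k l = (\<Sum>j<n. incidence_pinv H w k j * inc j l)"

lemma coord_arc: "H \<in> family \<Longrightarrow> k \<in> arcs H \<Longrightarrow> l \<in> arcs H \<Longrightarrow> coord H k l = (if k = l then 1 else 0)"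
  using incidence_pinv_inverse(1) by (simp add: coord_def)

lemma inc_expansion:
  assumes "H \<in> family" "i < n"
  shows "inc i l = (\<Sum>a\<in>arcs H. inc i a * coord H a l)"
proof -
  have "(\<Sum>a\<in>arcs H. inc i a * coord H a l) =
      (\<Sum>a\<in>arcs H. \<Sum>j<n. inc i a * incidence_pinv H w a j * inc j l)"
    by (simp add: coord_def sum_distrib_left mult.assoc)
  also have "\<dots> = (\<Sum>j<n. (\<Sum>a\<in>arcs H. inc i a * incidence_pinv H w a j) * inc j l)"
    by (subst sum.swap) (simp add: sum_distrib_right)
  also have "\<dots> = (\<Sum>j<n. if i = j then inc j l else 0)"
    by (rule sum.cong[OF refl]) (simp add: incidence_pinv_inverse(2)[OF assms(1,2)])
  finally show ?thesis using assms(2) by simp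
qed

abbreviation exchange :: "nat \<Rightarrow> nat \<Rightarrow> (nat, nat) pre_digraph \<Rightarrow> (nat, nat) pre_digraph" where
  "exchange k l H \<equiv> G\<lparr>arcs := insert l (arcs H - {k})\<rparr>"

text \<open>Column \<open>l\<close> is a combination of the columns of \<open>H\<close>, so putting
  it in place of column \<open>k\<close> multiplies the determinant by its coordinate at
  \<open>k\<close>. If the new subgraph leaves the family, its determinant vanishes and so does the
  coordinate.\<close>

lemma exchange_coord:
  assumes H: "H \<in> family" and k: "k \<in> arcs H" and l: "l \<in> arcs G" "l \<notin> arcs H"
  shows "exchange k l H \<in> family \<Longrightarrow>
      subgraph_pi G w (exchange k l H) = (cmod (coord H k l))\<^sup>2 * subgraph_pi G w H" (is "_ \<Longrightarrow> ?P")
    and "exchange k l H \<notin> family \<Longrightarrow> coord H k l = 0" (is "_ \<Longrightarrow> ?Q")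
proof -
  let ?d = "pick (arcs H)"
  note D = familyD[OF H]
  have bij: "bij_betw ?d {0..<n} (arcs H)"
    using bij_betw_pick[OF D(7)] D(5) by simp
  then have "k \<in> ?d ` {0..<n}"
    using k by (simp add: bij_betw_def)
  then obtain p where p: "p < n" "?d p = k" by auto
  let ?d' = "?d(p := l)"
  have bij': "bij_betw ?d' {0..<n} (insert l (arcs H - {k}))"
  proof -
    have inj: "inj_on ?d {0..<n}" and img: "?d ` {0..<n} = arcs H"
      using bij by (auto simp: bij_betw_def)
    have "inj_on ?d' {0..<n}"
      using inj img l(2) by (intro inj_on_fun_updI) auto
    moreover have "?d ` ({0..<n} - {p}) = arcs H - {k}"
      using inj_on_image_set_diff[OF inj, of "{0..<n}" "{p}"] img p by simp
    moreover have "p \<in> {0..<n}" using p(1) by simp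
    ultimately have "?d' ` {0..<n} = insert l (arcs H - {k})" "inj_on ?d' {0..<n}"
      by (simp_all only: fun_upd_image if_True)
    then show ?thesis by (simp only: bij_betw_def)
  qed
  define x where "x = vec n (\<lambda>q. coord H (?d q) l)"
  define b where "b = inc_mat ?d *\<^sub>v x"
  have "replace_col (inc_mat ?d) b p = inc_mat ?d'"
  proof (rule eq_matI)
    fix i j assume ij: "i < dim_row (inc_mat ?d')" "j < dim_col (inc_mat ?d')"
    then have ij: "i < n" "j < n" by (simp_all add: inc_mat_def)
    have "b $ i = (\<Sum>q\<in>{0..<n}. inc i (?d q) * coord H (?d q) l)"
      using ij by (simp add: b_def inc_mat_def x_def scalar_prod_def)
    also have "\<dots> = (\<Sum>a\<in>arcs H. inc i a * coord H a l)"
      by (rule sum.reindex_bij_betw[OF bij])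
    also have "\<dots> = inc i l" by (rule inc_expansion[OF H ij(1), symmetric])
    finally show "replace_col (inc_mat ?d) b p $$ (i, j) = inc_mat ?d' $$ (i, j)"
      using ij by (simp add: replace_col_def inc_mat_def)
  qed (auto simp: replace_col_def inc_mat_def)
  moreover have "det (replace_col (inc_mat ?d) b p) = x $ p * det (inc_mat ?d)"
    unfolding b_def by (rule cramer_lemma_mat[OF inc_mat_carrier _ p(1)]) (simp add: x_def)
  moreover have "x $ p = coord H k l"
    using p by (simp add: x_def)
  ultimately have det: "det (inc_mat ?d') = coord H k l * det (inc_mat ?d)"
    by metis
  show ?P if "exchange k l H \<in> family"
    using det_unicyclic_family(1)[OF that, of ?d'] bij' det_unicyclic_family(1)[OF H bij] det
    by (simp add: norm_mult power_mult_distrib)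
  show ?Q if "exchange k l H \<notin> family"
  proof -
    have "insert l (arcs H - {k}) \<subseteq> arcs G" using l(1) D(4) by auto
    then have "det (inc_mat ?d') = 0"
      using det_not_unicyclic_family[OF spanning_arcs_subset that, of ?d'] bij' by simp
    then show ?thesis using det det_unicyclic_family(2)[OF H bij] by simp
  qed
qed

text \<open>In the exchanged basis the column of \<open>l\<close> has coordinate 1 at
  \<open>l\<close>. When this column is first expanded over \<open>H\<close>, the arcs common to
  both bases have coordinate 0 at \<open>l\<close>, and only the term of \<open>k\<close>
  remains.\<close>

lemma coord_mult_exchange:
  assumes H: "H \<in> family" "exchange k l H \<in> family" and k: "k \<in> arcs H" and l: "l \<notin> arcs H"
  shows "coord H k l * coord (exchange k l H) l k = 1"
proof -
  let ?H = "exchange k l H"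
  have "1 = coord ?H l l"
    using coord_arc[OF H(2), of l l] by simp
  also have "\<dots> = (\<Sum>i<n. incidence_pinv ?H w l i * (\<Sum>a\<in>arcs H. inc i a * coord H a l))"
    unfolding coord_def[of ?H] by (rule sum.cong[OF refl]) (simp add: inc_expansion[OF H(1), symmetric])
  also have "\<dots> = (\<Sum>a\<in>arcs H. coord ?H l a * coord H a l)"
    unfolding coord_def[of ?H] sum_distrib_left sum_distrib_right
    by (subst sum.swap) (simp add: mult.assoc)
  also have "\<dots> = (\<Sum>a\<in>arcs H. if a = k then coord ?H l k * coord H k l else 0)"
  proof (rule sum.cong[OF refl])
    fix a assume "a \<in> arcs H"
    then show "coord ?H l a * coord H a l = (if a = k then coord ?H l k * coord H k l else 0)"
      using coord_arc[OF H(2), of l a] l by auto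
  qed
  also have "\<dots> = coord H k l * coord ?H l k"
    using k familyD(7)[OF H(1)] by (simp add: mult.commute)
  finally show ?thesis by simp
qed

text \<open>Up to the factor \<open>vol\<^sup>2\<close>, the entry \<open>(k, l)\<close> of \<open>Y N\<close>.\<close>

definition average_coord :: "nat \<Rightarrow> nat \<Rightarrow> complex" where
  "average_coord k l = (\<Sum>H | H \<in> family \<and> k \<in> arcs H. complex_of_real (subgraph_pi G w H) * coord H k l)"

text \<open>Only subgraphs that can be exchanged contribute: if \<open>l\<close> is already an arc
  of \<open>H\<close>, its coordinate at \<open>k\<close> is 0, and if the exchange leaves the
  family, the coordinate vanishes as well.\<close>

lemma average_coord_exchangeable:
  assumes "k \<in> arcs G" "l \<in> arcs G" "k \<noteq> l"
  shows "average_coord k l = (\<Sum>H | H \<in> family \<and> k \<in> arcs H \<and> l \<notin> arcs H \<and> exchange k l H \<in> family.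
    complex_of_real (subgraph_pi G w H) * coord H k l)"
  unfolding average_coord_def
proof (rule sum.mono_neutral_right)
  show "finite {H \<in> family. k \<in> arcs H}" using finite_family by simp
  show "\<forall>H\<in>{H \<in> family. k \<in> arcs H} - {H \<in> family. k \<in> arcs H \<and> l \<notin> arcs H \<and> exchange k l H \<in> family}.
      complex_of_real (subgraph_pi G w H) * coord H k l = 0"
  proof
    fix H assume "H \<in> {H \<in> family. k \<in> arcs H} -
      {H \<in> family. k \<in> arcs H \<and> l \<notin> arcs H \<and> exchange k l H \<in> family}"
    then have H: "H \<in> family" "k \<in> arcs H" "l \<in> arcs H \<or> exchange k l H \<notin> family" by auto
    have "coord H k l = 0"
      using coord_arc[OF H(1,2), of l] exchange_coord(2)[OF H(1,2) assms(2)] H(3) assms(3) by auto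
    then show "complex_of_real (subgraph_pi G w H) * coord H k l = 0" by simp
  qed
qed auto

text \<open>With \<open>x\<close> and \<open>y\<close> the coordinates exchanged into \<open>H\<close> and back, Cramer's rule gives
  \<open>\<pi>(H') = |x|\<^sup>2 \<pi>(H)\<close> and \<open>x y = 1\<close>, hence \<open>\<pi>(H) x = cnj (\<pi>(H') y)\<close>.\<close>

lemma average_coord_hermitian:
  assumes "k \<in> arcs G" "l \<in> arcs G"
  shows "average_coord k l = cnj (average_coord l k)"
proof (cases "k = l")
  case True
  have "average_coord k k = (\<Sum>H | H \<in> family \<and> k \<in> arcs H. complex_of_real (subgraph_pi G w H))"
    unfolding average_coord_def by (rule sum.cong[OF refl]) (simp add: coord_arc)
  then show ?thesis using True by simp
next
  case False
  have undo: "exchange l k (exchange k l H) = H" if "H \<in> family" "k \<in> arcs H" "l \<notin> arcs H" for H k l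
  proof -
    have "insert k (insert l (arcs H - {k}) - {l}) = arcs H" using that by auto
    then show ?thesis using familyD(8)[OF that(1)] by simp
  qed
  have term_eq: "cnj (complex_of_real (subgraph_pi G w (exchange k l H)) * coord (exchange k l H) l k) =
      complex_of_real (subgraph_pi G w H) * coord H k l"
    if H: "H \<in> family" "k \<in> arcs H" "l \<notin> arcs H" "exchange k l H \<in> family" for H
  proof -
    let ?x = "coord H k l" and ?y = "coord (exchange k l H) l k"
    have xy: "?x * ?y = 1" by (rule coord_mult_exchange[OF H(1,4,2,3)])
    have "complex_of_real (subgraph_pi G w (exchange k l H)) * cnj ?y =
        (?x * cnj ?x) * complex_of_real (subgraph_pi G w H) * cnj ?y"
      unfolding exchange_coord(1)[OF H(1,2) assms(2) H(3,4)] of_real_mult complex_norm_square ..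
    also have "\<dots> = complex_of_real (subgraph_pi G w H) * ?x * cnj (?x * ?y)"
      by (simp add: mult_ac)
    finally show ?thesis by (simp add: xy)
  qed
  have "average_coord k l = (\<Sum>H | H \<in> family \<and> l \<in> arcs H \<and> k \<notin> arcs H \<and> exchange l k H \<in> family.
      cnj (complex_of_real (subgraph_pi G w H) * coord H l k))"
    unfolding average_coord_exchangeable[OF assms False]
    by (rule sum.reindex_bij_witness[where i = "exchange l k" and j = "exchange k l"])
      (use undo False term_eq in auto)
  also have "\<dots> = cnj (average_coord l k)"
    unfolding average_coord_exchangeable[OF assms(2,1) False[symmetric]] by simp
  finally show ?thesis .
qed

section \<open>The signless Laplacian as a product and its inverse\<close>

lemma adj_eq_0:
  assumes "\<And>a. a \<in> arcs G \<Longrightarrow> {tail G a, head G a} \<noteq> {x, y}"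
  shows "adj x y = 0"
  using assms by (force simp: adj_entry_def arcs_ends_conv insert_commute)

lemma signless_laplacian_entry:
  assumes ij: "i < n" "j < n"
  shows "signless_laplacian G w $$ (i, j) = (\<Sum>a\<in>arcs G. inc i a * cnj (inc j a))"
proof -
  have dims: "card (verts G) = n" by (simp add: verts_eq)
  have Q: "signless_laplacian G w $$ (i, j) =
      (if i = j then complex_of_real (\<Sum>k\<in>{0..<n} - {i}. cmod (adj i k)) else 0) + adj i j"
    using ij by (simp add: signless_laplacian_def degree_mat_def adjacency_mat_def dims verts_eq)
  show ?thesis
  proof (cases "i = j")
    case True
    let ?I = "{a \<in> arcs G. i = tail G a \<or> i = head G a}"
    \<comment> \<open>The arcs at \<open>i\<close> correspond injectively to the neighbours of
      \<open>i\<close>; this turns the sum over arcs into the degree sum over vertices.\<close>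
    define other where "other a = (if i = tail G a then head G a else tail G a)" for a
    have o: "(tail G a, head G a) = (i, other a) \<or> (tail G a, head G a) = (other a, i)" if "a \<in> ?I" for a
      using that by (auto simp: other_def)
    have ends: "{tail G a, head G a} = {i, other a}" if "a \<in> ?I" for a
      using o[OF that] by auto
    have inj: "inj_on other ?I"
    proof (rule inj_onI)
      fix a b assume ab: "a \<in> ?I" "b \<in> ?I" "other a = other b"
      then have "{tail G a, head G a} = {tail G b, head G b}"
        using ends[OF ab(1)] ends[OF ab(2)] by simp
      then show "a = b" using oriented_graph_arc_eq[OF oriented] ab by blast
    qed
    have "(\<Sum>a\<in>arcs G. inc i a * cnj (inc i a)) = (\<Sum>a\<in>?I. inc i a * cnj (inc i a))"
      by (rule sum.mono_neutral_right) (use inc_eq_0 in auto)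
    also have "\<dots> = (\<Sum>a\<in>?I. complex_of_real (cmod (adj i (other a))))"
    proof (rule sum.cong[OF refl])
      fix a assume a: "a \<in> ?I"
      then show "inc i a * cnj (inc i a) = complex_of_real (cmod (adj i (other a)))"
        using inc_adj(2)[OF _ o[OF a]] by (simp flip: complex_norm_square)
    qed
    also have "\<dots> = (\<Sum>x\<in>other ` ?I. complex_of_real (cmod (adj i x)))"
      using inj by (simp add: sum.reindex)
    also have "\<dots> = (\<Sum>x\<in>{0..<n} - {i}. complex_of_real (cmod (adj i x)))"
    proof (rule sum.mono_neutral_left)
      have "other a \<in> verts G \<and> other a \<noteq> i" if "a \<in> ?I" for a
        using that wellformed[of a] no_loops[of a] by (auto simp: other_def)
      then show "other ` ?I \<subseteq> {0..<n} - {i}" by (auto simp: verts_eq)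
      show "\<forall>x\<in>{0..<n} - {i} - other ` ?I. complex_of_real (cmod (adj i x)) = 0"
      proof
        fix x assume x: "x \<in> {0..<n} - {i} - other ` ?I"
        have "{tail G a, head G a} \<noteq> {i, x}" if "a \<in> arcs G" for a
        proof
          assume "{tail G a, head G a} = {i, x}"
          then have "a \<in> ?I" "other a = x"
            using that x by (auto simp: other_def doubleton_eq_iff)
          then show False using x by blast
        qed
        then show "complex_of_real (cmod (adj i x)) = 0" using adj_eq_0[of i x] by simp
      qed
    qed simp
    finally have "(\<Sum>a\<in>arcs G. inc i a * cnj (inc i a)) = complex_of_real (\<Sum>x\<in>{0..<n} - {i}. cmod (adj i x))"
      by simp
    moreover have "adj i i = 0"
    proof (rule adj_eq_0)
      fix a assume "a \<in> arcs G"
      then show "{tail G a, head G a} \<noteq> {i, i}" using no_loops[of a] by auto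
    qed
    ultimately show ?thesis using Q True by simp
  next
    case False
    have zero: "inc i a * cnj (inc j a) = 0" if "{tail G a, head G a} \<noteq> {i, j}" for a
      using that False by (auto simp: inc_def split: if_splits)
    show ?thesis
    proof (cases "\<exists>a\<in>arcs G. {tail G a, head G a} = {i, j}")
      case True
      then obtain a where a: "a \<in> arcs G" "{tail G a, head G a} = {i, j}" by blast
      then have "(tail G a, head G a) = (i, j) \<or> (tail G a, head G a) = (j, i)"
        by (auto simp: doubleton_eq_iff)
      then have "inc i a * cnj (inc j a) = adj i j" by (rule inc_adj(1)[OF a(1)])
      moreover have "(\<Sum>b\<in>arcs G. inc i b * cnj (inc j b)) = (\<Sum>b\<in>{a}. inc i b * cnj (inc j b))"
      proof (rule sum.mono_neutral_right)
        show "\<forall>b\<in>arcs G - {a}. inc i b * cnj (inc j b) = 0"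
        proof
          fix b assume b: "b \<in> arcs G - {a}"
          then have "{tail G b, head G b} \<noteq> {i, j}"
            using oriented_graph_arc_eq[OF oriented a(1), of b] a(2) by auto
          then show "inc i b * cnj (inc j b) = 0" by (rule zero)
        qed
      qed (use a in auto)
      ultimately show ?thesis using Q False by simp
    next
      case nex: False
      then have "(\<Sum>b\<in>arcs G. inc i b * cnj (inc j b)) = 0"
        using zero by (intro sum.neutral) auto
      then show ?thesis using Q False nex adj_eq_0[of i j] by auto
    qed
  qed
qed

text \<open>\<open>N'\<close> and \<open>Y'\<close> are the adjoints of \<open>N\<close> and
  \<open>Y\<close>. Because \<open>N' * Y' = Y * N\<close>, the product
  \<open>N * N' * Y' * Y\<close> becomes \<open>N * Y * N * Y\<close>, which is the identity by
  \<open>N * Y = 1\<close>.\<close>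

lemma mp_inverse_signless_laplacian:
  assumes nonempty: "family \<noteq> {}" and arcs: "arcs G = {0..<m}" and ij: "i < n" "j < n"
  shows "mp_inverse (signless_laplacian G w) $$ (i, j) =
    1 / complex_of_real (vol4 G w) *
    (\<Sum>k<m. \<Sum>(Hr, Hs) \<in> {(Hr, Hs). Hr \<in> family \<and> Hs \<in> family \<and> k \<in> arcs Hr \<inter> arcs Hs}.
       complex_of_real (subgraph_pi G w Hr) * complex_of_real (subgraph_pi G w Hs) *
       cnj (incidence_pinv Hr w k i) * incidence_pinv Hs w k j)"
proof -
  define c where "c = complex_of_real (vol2 G w)"
  have "0 < vol2 G w"
    unfolding vol2_def using finite_family nonempty subgraph_pi_pos by (intro sum_pos) auto
  then have c: "c \<noteq> 0" "cnj c = c" by (auto simp: c_def)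
  define S where "S k j = (\<Sum>H | H \<in> family \<and> k \<in> arcs H.
    complex_of_real (subgraph_pi G w H) * incidence_pinv H w k j)" for k j
  define N where "N = mat n m (\<lambda>(i, k). inc i k)"
  define N' where "N' = mat m n (\<lambda>(k, i). cnj (inc i k))"
  define Y where "Y = mat m n (\<lambda>(k, j). S k j / c)"
  define Y' where "Y' = mat n m (\<lambda>(j, k). cnj (S k j / c))"
  have carriers [simp]: "N \<in> carrier_mat n m" "N' \<in> carrier_mat m n" "Y \<in> carrier_mat m n"
    "Y' \<in> carrier_mat n m"
    by (simp_all add: N_def N'_def Y_def Y'_def)
  have NS: "(\<Sum>k<m. inc i k * S k j) = (if i = j then c else 0)" if "i < n" "j < n" for i j
  proof -
    have "(\<Sum>k<m. inc i k * S k j) = (\<Sum>k<m. \<Sum>H\<in>family. if k \<in> arcs H then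
        complex_of_real (subgraph_pi G w H) * (inc i k * incidence_pinv H w k j) else 0)"
      unfolding S_def sum_distrib_left sum.inter_filter[OF finite_family, symmetric]
      by (intro sum.cong refl) (auto simp: mult_ac)
    also have "\<dots> = (\<Sum>H\<in>family. complex_of_real (subgraph_pi G w H) *
        (\<Sum>k\<in>arcs H. inc i k * incidence_pinv H w k j))"
    proof (subst sum.swap, rule sum.cong[OF refl])
      fix H assume H: "H \<in> family"
      have "{k \<in> {..<m}. k \<in> arcs H} = arcs H" using familyD(4)[OF H] arcs by auto
      then show "(\<Sum>k<m. if k \<in> arcs H then complex_of_real (subgraph_pi G w H) *
          (inc i k * incidence_pinv H w k j) else 0) =
        complex_of_real (subgraph_pi G w H) * (\<Sum>k\<in>arcs H. inc i k * incidence_pinv H w k j)"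
        by (simp add: sum.inter_filter[symmetric] sum_distrib_left)
    qed
    also have "\<dots> = (\<Sum>H\<in>family. complex_of_real (subgraph_pi G w H) * (if i = j then 1 else 0))"
      by (intro sum.cong refl arg_cong2[of _ _ _ _ "(*)"] incidence_pinv_inverse(2) that)
    also have "\<dots> = (if i = j then c else 0)"
      by (simp add: c_def vol2_def)
    finally show ?thesis .
  qed
  have SN: "(\<Sum>j<n. S k j * inc j l) = average_coord k l" for k l
    unfolding S_def average_coord_def coord_def sum_distrib_right sum_distrib_left
    by (subst sum.swap) (simp add: mult.assoc)
  have NY: "N * Y = 1\<^sub>m n"
  proof (rule eq_matI)
    fix i j assume "i < dim_row (1\<^sub>m n :: complex mat)" "j < dim_col (1\<^sub>m n :: complex mat)"
    then have ij: "i < n" "j < n" by simp_all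
    then have "(N * Y) $$ (i, j) = (\<Sum>k<m. inc i k * S k j) / c"
      by (simp add: N_def Y_def scalar_prod_def sum_divide_distrib atLeast0LessThan)
    then show "(N * Y) $$ (i, j) = 1\<^sub>m n $$ (i, j)"
      using NS[OF ij] ij c by simp
  qed (simp_all add: N_def Y_def)
  have YN: "N' * Y' = Y * N"
  proof (rule eq_matI)
    fix k l assume "k < dim_row (Y * N)" "l < dim_col (Y * N)"
    then have kl: "k < m" "l < m" by (simp_all add: N_def Y_def)
    have "(N' * Y') $$ (k, l) = cnj ((\<Sum>j<n. S l j * inc j k) / c)"
      using kl by (simp add: N'_def Y'_def scalar_prod_def sum_divide_distrib atLeast0LessThan mult_ac)
    also have "\<dots> = (\<Sum>j<n. S k j * inc j l) / c"
      using average_coord_hermitian[of k l] kl arcs c by (simp add: SN)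
    also have "\<dots> = (Y * N) $$ (k, l)"
      using kl by (simp add: N_def Y_def scalar_prod_def sum_divide_distrib atLeast0LessThan)
    finally show "(N' * Y') $$ (k, l) = (Y * N) $$ (k, l)" .
  qed (simp_all add: N_def Y_def N'_def Y'_def)
  have Q: "signless_laplacian G w = N * N'"
    by (rule eq_matI) (simp_all add: signless_laplacian_entry N_def N'_def scalar_prod_def arcs,
      simp_all add: signless_laplacian_def degree_mat_def adjacency_mat_def verts_eq)
  have car: "N * N' \<in> carrier_mat n n" "Y' * Y \<in> carrier_mat n n"
    by (rule mult_carrier_mat carriers)+
  have "N' * (Y' * Y) = (Y * N) * Y"
    unfolding YN[symmetric] by (rule assoc_mult_mat[OF carriers(2,4,3), symmetric])
  also have "\<dots> = Y * (N * Y)"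
    by (rule assoc_mult_mat[OF carriers(3,1,3)])
  also have "\<dots> = Y"
    unfolding NY by (rule right_mult_one_mat[OF carriers(3)])
  finally have "N' * (Y' * Y) = Y" .
  then have inv: "(N * N') * (Y' * Y) = 1\<^sub>m n"
    using assoc_mult_mat[OF carriers(1,2) car(2)] NY by simp
  have "mp_inverse (signless_laplacian G w) = Y' * Y"
    unfolding Q using mp_inverse_eq[OF car inv mat_mult_left_right_inverse[OF car inv]] .
  then have "mp_inverse (signless_laplacian G w) $$ (i, j) = (\<Sum>k<m. cnj (S k i / c) * (S k j / c))"
    using ij by (simp add: Y_def Y'_def scalar_prod_def atLeast0LessThan)
  also have "\<dots> = 1 / (c * c) * (\<Sum>k<m. cnj (S k i) * S k j)"
    using c by (simp add: sum_distrib_left)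
  also have "(\<Sum>k<m. cnj (S k i) * S k j) =
    (\<Sum>k<m. \<Sum>(Hr, Hs) \<in> {(Hr, Hs). Hr \<in> family \<and> Hs \<in> family \<and> k \<in> arcs Hr \<inter> arcs Hs}.
       complex_of_real (subgraph_pi G w Hr) * complex_of_real (subgraph_pi G w Hs) *
       cnj (incidence_pinv Hr w k i) * incidence_pinv Hs w k j)"
  proof (rule sum.cong[OF refl])
    fix k
    have "{(Hr, Hs). Hr \<in> family \<and> Hs \<in> family \<and> k \<in> arcs Hr \<inter> arcs Hs} =
        {H \<in> family. k \<in> arcs H} \<times> {H \<in> family. k \<in> arcs H}" by auto
    then show "cnj (S k i) * S k j =
      (\<Sum>(Hr, Hs) \<in> {(Hr, Hs). Hr \<in> family \<and> Hs \<in> family \<and> k \<in> arcs Hr \<inter> arcs Hs}.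
       complex_of_real (subgraph_pi G w Hr) * complex_of_real (subgraph_pi G w Hs) *
       cnj (incidence_pinv Hr w k i) * incidence_pinv Hs w k j)"
      unfolding S_def cnj_sum sum_product by (simp add: sum.cartesian_product mult_ac)
  qed
  also have "c * c = complex_of_real (vol4 G w)"
    by (simp add: c_def vol4_def power2_eq_square)
  finally show ?thesis .
qed

end

section \<open>The rows of the inverse incidence matrix\<close>

lemma pcas_rev: "pcas u p v \<Longrightarrow> pcas v (rev (map prod.swap p)) u"
proof (induction p arbitrary: u)
  case (Cons a p)
  have snoc: "pcas x (q @ [(y, z)]) z" if "pcas x q y" for x y z and q :: "('a \<times> 'a) list"
    using that by (induction q arbitrary: x) auto
  show ?case using Cons snoc[of v "rev (map prod.swap p)" "snd a" u] by (cases a) auto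
qed simp

text \<open>In its case of an arc on the cycle, \<open>pinv_entry\<close> combines the distance from
  \<open>j\<close> to the tail with the weight of the path from the tail to \<open>j\<close>;
  symmetry reconciles the two directions.\<close>

lemma undirected_dist_commute:
  assumes "wf_digraph F"
  shows "undirected_dist F s t = undirected_dist F t s"
proof -
  interpret wf_digraph F by fact
  interpret S: pair_wf_digraph "mk_symmetric F" ..
  have "\<exists>q. S.awalk t q s \<and> length q = length p" if "S.awalk s p t" for s t p
  proof -
    have "set (rev (map prod.swap p)) \<subseteq> parcs (mk_symmetric F)"
      using that sym_parcs_mk_symmetric[of F] by (auto simp: S.awalk_def sym_def)
    then have "S.awalk t (rev (map prod.swap p)) s"
      using that S.awalk_last_in_verts[OF that] pcas_rev[of s p t] by (auto simp: S.awalk_def)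
    then show ?thesis by (intro exI[of _ "rev (map prod.swap p)"]) simp
  qed
  then have "(\<exists>p. S.awalk s p t \<and> length p = l) \<longleftrightarrow> (\<exists>p. S.awalk t p s \<and> length p = l)" for l
    by metis
  then show ?thesis by (simp add: undirected_dist_def)
qed

text \<open>What remains of the cycle is the path from \<open>f c\<close> around to
  \<open>c\<close>, one step shorter than the cycle. Its parity is the source of the sign epsilon in
  the formula.\<close>

lemma (in unicyclic_functional_graph) undirected_dist_cycle:
  assumes "c \<in> C"
  shows "undirected_dist (del_arc (e c)) (f c) c = card C - 1"
proof -
  let ?F = "del_arc (e c)"
  have cV: "c \<in> verts H" using assms C_subset by blast
  have "C = orbit f c" "c \<in> orbit f c"
    using C_periodic assms by (auto simp: periodic_orbits_def cyclic_on_alldef)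
  then obtain k where k: "0 < k" "inj_on (\<lambda>i. (f ^^ i) c) {..<k}" "(f ^^ k) c = c" "card C = k"
    using orbit_enumeration[of c f] by metis
  define x where "x i = (f ^^ Suc i) c" for i
  let ?p = "map (\<lambda>i. (x i, x (Suc i))) [0..<k - 1]"
  have xk: "x (k - 1) = c" using k by (simp add: x_def del: funpow.simps)
  have x0: "x 0 = f c" by (simp add: x_def)
  have xc: "x i \<noteq> c" if "i < k - 1" for i
  proof
    assume "x i = c"
    then have "(f ^^ Suc i) c = (f ^^ 0) c" by (simp add: x_def del: funpow.simps(2))
    then have "Suc i = 0"
      by (rule inj_onD[OF k(2)]) (use that in auto)
    then show False by simp
  qed
  interpret F: wf_digraph ?F by (rule wf_digraph_del_arc)
  interpret S: pair_wf_digraph "mk_symmetric ?F" ..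
  have "pcas (x 0) ?p (x (k - 1))" "pawalk_verts (x 0) ?p = map x [0..<Suc (k - 1)]"
    using pcas_map[of 0 "k - 1" x] pawalk_verts_map[of 0 "k - 1" x] by simp_all
  moreover have "inj_on x {0..<k}"
  proof (rule inj_onI)
    fix i j assume ij: "i \<in> {0..<k}" "j \<in> {0..<k}" "x i = x j"
    show "i = j"
    proof (cases "Suc i = k \<or> Suc j = k")
      case True
      then show ?thesis using ij xc xk
        by (metis Suc_lessI Suc_diff_1 atLeastLessThan_iff diff_Suc_1 k(1) less_Suc_eq)
    next
      case False
      then have "Suc i < k" "Suc j < k" using ij by auto
      then show ?thesis using inj_onD[OF k(2), of "Suc i" "Suc j"] ij by (simp add: x_def)
    qed
  qed
  moreover have "set ?p \<subseteq> parcs (mk_symmetric ?F)"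
  proof -
    have "(x i, x (Suc i)) \<in> parcs (mk_symmetric ?F)" if "i < k - 1" for i
      unfolding parcs_del_arc_iff[OF cV] using xc[OF that] funpow_in[OF cV, of "Suc i"]
      by (simp add: x_def)
    then show ?thesis by auto
  qed
  ultimately have p: "S.apath (f c) ?p c"
    using k(1) f_in[OF cV] x0 xk
    by (simp add: S.apath_def S.awalk_def distinct_map verts_del_arc del: upt_Suc)
  then have "S.awalk (f c) ?p c" by (simp add: S.apath_def)
  then have "(f c, c) \<in> (parcs (mk_symmetric ?F))\<^sup>*"
    using rtrancl_del_cycle_arc[OF assms f_in[OF cV] cV] by simp
  note path = undirected_path_acyclic[OF wf_digraph_del_arc cycles_del_cycle_arc[OF assms] _ this]
  have "undirected_path ?F (f c) c = ?p"
    unfolding undirected_path_def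
    using p acyclic_apath_unique[OF wf_digraph_del_arc cycles_del_cycle_arc[OF assms] _ p]
    by (rule the_equality)
  then show ?thesis
    using path(2) f_in[OF cV] k(4) by (simp add: verts_del_arc)
qed

text \<open>Expresses the entry at the tail through the entry at the head; this produces the common
  factor \<open>csqrt (cnj z)\<close> and the phase of the weight in the denominator for cycle
  arcs.\<close>

lemma csqrt_cnj_sgn:
  assumes "z \<notin> neg_reals" "z \<noteq> 0"
  shows "csqrt z = csqrt (cnj z) * sgn z"
proof -
  have "cnj (csqrt z) * csqrt z = complex_of_real ((cmod (csqrt z))\<^sup>2)"
    by (simp only: complex_norm_square mult.commute)
  also have "(cmod (csqrt z))\<^sup>2 = cmod z"
    by (metis norm_power power2_csqrt)
  finally have "cnj (csqrt z) * csqrt z = complex_of_real (cmod z)" .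
  then have "cnj (csqrt z) * (csqrt z * csqrt z) = complex_of_real (cmod z) * csqrt z"
    by (simp add: mult.assoc[symmetric])
  moreover have "csqrt z * csqrt z = z" by (metis power2_csqrt power2_eq_square)
  ultimately show ?thesis
    using assms by (simp add: cnj_csqrt_not_neg sgn_eq field_simps)
qed

section \<open>One row of the inverse, followed along walks\<close>

context weighted_functional_graph
begin

context
  fixes k :: nat
  assumes family: "H \<in> unicyclic_family G w" and k: "k \<in> arcs H"
begin

abbreviation pinv_row :: "nat \<Rightarrow> complex" where
  "pinv_row \<equiv> incidence_pinv H w k"

abbreviation steps :: "nat rel" where
  "steps \<equiv> parcs (mk_symmetric (H.del_arc k))"

lemma row_arc:
  assumes l: "l \<in> arcs H" and xy: "(tail G l, head G l) = (x, y) \<or> (tail G l, head G l) = (y, x)"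
  shows "pinv_row x * inc x l + pinv_row y * inc y l = (if k = l then 1 else 0)"
proof -
  have lG: "l \<in> arcs G" using l H_simps by blast
  have "x \<noteq> y" using inc_adj(6)[OF lG xy] .
  moreover have "x < n" "y < n" using wellformed[OF lG] xy by (auto simp: verts_eq)
  moreover have "inc i l = 0" if "i \<noteq> x" "i \<noteq> y" for i
    using that xy inc_eq_0 by auto
  ultimately have "(\<Sum>j<n. pinv_row j * inc j l) = (\<Sum>j\<in>{x, y}. pinv_row j * inc j l)"
    by (intro sum.mono_neutral_right) auto
  then show ?thesis
    using incidence_pinv_inverse(1)[OF family k l] \<open>x \<noteq> y\<close> by simp
qed

lemma row_step:
  assumes "(x, y) \<in> steps"
  shows "pinv_row y = - sgn (adj x y) * pinv_row x" "adj x y \<noteq> 0"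
proof -
  obtain l where l: "l \<in> arcs H" "l \<noteq> k" "(tail G l, head G l) = (x, y) \<or> (tail G l, head G l) = (y, x)"
    using assms by (auto simp: parcs_mk_symmetric_iff H.arcs_del_arc H.tail_del_arc H.head_del_arc H_simps)
  then have lG: "l \<in> arcs G" using H_simps by blast
  have l': "(tail G l, head G l) = (y, x) \<or> (tail G l, head G l) = (x, y)" using l(3) by blast
  note I = inc_adj[OF lG l(3)] inc_adj[OF lG l']
  have "inc y l * cnj (inc y l) = complex_of_real ((cmod (inc y l))\<^sup>2)"
    by (rule complex_norm_square[symmetric])
  also have "(cmod (inc y l))\<^sup>2 = cmod (adj x y)"
    using I(9,4) by simp
  finally have yy: "inc y l * cnj (inc y l) = complex_of_real (cmod (adj x y))" .
  have "pinv_row x * inc x l + pinv_row y * inc y l = 0"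
    using row_arc[OF l(1,3)] l(2) by simp
  \<comment> \<open>Multiplying by the conjugate of the entry at \<open>y\<close> replaces square
    roots by the adjacency entry and its modulus.\<close>
  then have "(pinv_row x * inc x l + pinv_row y * inc y l) * cnj (inc y l) = 0" by simp
  then have "pinv_row x * (inc x l * cnj (inc y l)) + pinv_row y * (inc y l * cnj (inc y l)) = 0"
    by (simp add: algebra_simps)
  then have "pinv_row x * adj x y + pinv_row y * complex_of_real (cmod (adj x y)) = 0"
    by (simp only: I(1) yy)
  then show "pinv_row y = - sgn (adj x y) * pinv_row x" "adj x y \<noteq> 0"
    using I(5) by (auto simp: sgn_eq field_simps eq_neg_iff_add_eq_0)
qed

lemma row_walk:
  assumes "pcas s p t" "set p \<subseteq> steps"
  shows "pinv_row t = (-1) ^ length p * sgn (walk_wt G w p) * pinv_row s" "walk_wt G w p \<noteq> 0"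
proof -
  have "pinv_row t = (-1) ^ length p * sgn (walk_wt G w p) * pinv_row s \<and> walk_wt G w p \<noteq> 0"
    using assms
  proof (induction p arbitrary: s)
    case Nil
    then show ?case by (simp add: walk_wt_def)
  next
    case (Cons a p)
    obtain y where a: "a = (s, y)" using Cons.prems by (cases a) auto
    have st: "pinv_row y = - sgn (adj s y) * pinv_row s" "adj s y \<noteq> 0"
      using row_step[of s y] Cons.prems(2) by (auto simp: a)
    have IH: "pinv_row t = (-1) ^ length p * sgn (walk_wt G w p) * pinv_row y" "walk_wt G w p \<noteq> 0"
      using Cons.IH[of y] Cons.prems by (auto simp: a)
    have "walk_wt G w (a # p) = adj s y * walk_wt G w p"
      by (simp add: walk_wt_def a)
    then show ?case
      using IH st by (simp add: sgn_mult mult_ac)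
  qed
  then show "pinv_row t = (-1) ^ length p * sgn (walk_wt G w p) * pinv_row s" "walk_wt G w p \<noteq> 0"
    by blast+
qed

lemma row_zero_reach:
  assumes "(u, v) \<in> steps\<^sup>*" "pinv_row u = 0"
  shows "pinv_row v = 0"
  using assms by induction (auto dest: row_step)

text \<open>Going once around the cycle multiplies the row by \<open>(-1)\<close> to the length times the phase of
  the cycle weight; the condition defining the family says that this factor is not \<open>1\<close>.\<close>

lemma row_zero_cycle:
  assumes "D \<in> orbits" "k \<notin> e ` D"
  obtains u where "u \<in> D" "pinv_row u = 0"
proof -
  have DH: "D \<in> periodic_orbits f (verts H)" using assms(1) by (simp add: H_simps)
  obtain p where p: "cycle_walk H p" "H.steps_along p D"
    using H.periodic_orbit_cycle_walk(1)[OF DH] by blast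
  obtain u where u: "pcas u p u" "p \<noteq> []" "set p \<subseteq> parcs (mk_symmetric H)"
    using p(1) unfolding cycle_walk_def pre_digraph.cycle_def awalk_mk_symmetric_iff by blast
  have "fst (hd p) = u" using u by (cases p) auto
  then have uD: "u \<in> D"
  proof -
    have "fst (hd p) \<in> fst ` set p" using u(2) by auto
    moreover have "f v \<in> D" if "v \<in> D" for v
      using cyclic_on_inI[of f D v] DH that by (simp add: periodic_orbits_def)
    ultimately show ?thesis using p(2) \<open>fst (hd p) = u\<close> by auto
  qed
  have st: "(v, f v) \<in> steps" "(f v, v) \<in> steps" if "v \<in> D" for v
  proof -
    have "v < n" using orbit_lt[OF assms(1) that] .
    then have "e v \<in> arcs (H.del_arc k)"
      using H.e_in[of v] assms(2) that by (auto simp: H.arcs_del_arc H_simps)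
    then show "(v, f v) \<in> steps" "(f v, v) \<in> steps"
      using ends_G[OF \<open>v < n\<close>] by (auto simp: parcs_mk_symmetric_iff H.tail_del_arc H.head_del_arc H_simps intro!: bexI[of _ "e v"])
  qed
  have "set p \<subseteq> steps" using p(2) st by auto
  note W = row_walk[OF u(1) this]
  have "card (set p) = card D"
    using p(2) by (auto simp: card_image inj_on_def)
  then have len: "length p = card D" using p(2) distinct_card[of p] by simp
  have "pinv_row u = 0"
  proof (rule ccontr)
    assume "pinv_row u \<noteq> 0"
    then have eq: "(-1) ^ card D * sgn (walk_wt G w p) = 1"
      using W(1) len by simp
    have "sgn (walk_wt G w p) = (-1) ^ card D * ((-1) ^ card D * sgn (walk_wt G w p))"
      by (cases "even (card D)") auto
    then have "sgn (walk_wt G w p) = (-1) ^ card D"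
      unfolding eq by simp
    then have "walk_wt G w p = complex_of_real ((-1) ^ card D * cmod (walk_wt G w p))"
      using W(2) by (simp add: sgn_eq field_simps)
    then have "Re (walk_wt G w p) = (-1) ^ card D * cmod (walk_wt G w p)"
      by (metis Re_complex_of_real)
    moreover have "Re (walk_wt G w p) = Re (orbit_wt D)" "cmod (walk_wt G w p) = cmod (orbit_wt D)"
      using walk_wt_steps_along[OF p(2) assms(1)] by auto
    ultimately have "orbit_alpha D = 0"
      by (cases "even (card D)") (auto simp: orbit_alpha_def)
    then show False using in_unicyclic_family_iff_alpha family assms(1) by blast
  qed
  with uD show ?thesis by (rule that)
qed

text \<open>The component does not contain the arc \<open>k\<close>, so all its steps survive the
  removal, and the zero found on its cycle spreads to every vertex.\<close>

lemma row_zero_basin: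
  assumes D: "D \<in> orbits" and "k \<notin> e ` H.basin D" and j: "j \<in> H.basin D"
  shows "pinv_row j = 0"
proof -
  have DH: "D \<in> periodic_orbits f (verts H)" using D by (simp add: H_simps)
  have DB: "D \<subseteq> H.basin D" by (rule H.periodic_subset_basin[OF DH])
  then have "k \<notin> e ` D" using assms(2) by blast
  then obtain u where u: "u \<in> D" "pinv_row u = 0" using row_zero_cycle[OF D] by blast
  interpret B: functional_graph "H \<restriction> H.basin D" e f by (rule H.functional_graph_basin)
  have "B.core u = B.core j"
    using u j DB by (auto simp: H.basin_def)
  then have "(u, j) \<in> (parcs (mk_symmetric (H \<restriction> H.basin D)))\<^sup>*"
    using B.rtrancl_iff_core[of u j] u j DB by auto
  moreover have "parcs (mk_symmetric (H \<restriction> H.basin D)) \<subseteq> steps"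
  proof -
    have "k \<notin> arcs (H \<restriction> H.basin D)" unfolding H.functional_graph_basin(2) by (rule assms(2))
    then show ?thesis
      by (auto simp: parcs_mk_symmetric_iff H.arcs_del_arc H.tail_del_arc H.head_del_arc)
  qed
  ultimately have "(u, j) \<in> steps\<^sup>*" using rtrancl_mono by blast
  then show ?thesis using row_zero_reach u(2) by blast
qed

end

lemma unicyclic_basin:
  assumes "C \<in> orbits"
  shows "unicyclic_functional_graph (H \<restriction> H.basin C) e f C"
proof -
  interpret B: functional_graph "H \<restriction> H.basin C" e f by (rule H.functional_graph_basin)
  have CH: "C \<in> periodic_orbits f (verts H)" using assms by (simp add: H_simps)
  show ?thesis
    by unfold_locales
      (use H.periodic_subset_basin[OF CH] H.periodic_orbits_nonempty[OF CH] in \<open>auto simp: H.basin_def\<close>)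
qed

text \<open>Paths avoiding the arc fix the row up to a factor, and the equation \<open>k_eq\<close>
  at the arc's own column supplies that factor. On the cycle both ends stay joined, and
  \<open>k_eq\<close> is solved for the entry at the tail. Off the cycle the row vanishes at
  \<open>f c\<close>, on the unicyclic side, and \<open>k_eq\<close> gives the entry at
  \<open>c\<close>.\<close>

lemma incidence_pinv_eq_pinv_entry:
  assumes family: "H \<in> unicyclic_family G w" and C: "C \<in> orbits" and c: "c \<in> H.basin C" and j: "j < n"
  shows "incidence_pinv H w (e c) j = pinv_entry G w (H \<restriction> H.basin C) (e c) j"
proof -
  let ?k = "e c"
  define U where "U = H \<restriction> H.basin C"
  interpret U: unicyclic_functional_graph U e f C
    unfolding U_def by (rule unicyclic_basin[OF C])
  let ?F = "U.del_arc ?k" and ?u = "tail G ?k" and ?v = "head G ?k"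
  let ?W = "w ?u ?v"
  let ?row = "incidence_pinv H w ?k"
  have vU: "verts U = H.basin C" by (simp add: U_def)
  have cn: "c < n" and cU: "c \<in> verts U"
    using c subsetD[OF H.basin_subset c] by (simp_all add: H_simps vU)
  have kH: "?k \<in> arcs H" using H.e_in[of c] cn by (simp add: H_simps)
  have kG: "?k \<in> arcs G" using kH H_simps by blast
  note weight = weights[OF kG]
  have uv: "(?u, ?v) = (c, f c) \<or> (?u, ?v) = (f c, c)" by (rule ends_G[OF cn])
  have UH: "arcs U \<subseteq> arcs H" "tail U = tail H" "head U = head H"
    by (auto simp: U_def)
  have steps: "parcs (mk_symmetric ?F) \<subseteq> parcs (mk_symmetric (H.del_arc ?k))"
  proof (rule subrelI)
    fix x y assume "(x, y) \<in> parcs (mk_symmetric ?F)"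
    then obtain a where "a \<in> arcs U - {?k}"
      "(tail H a, head H a) = (x, y) \<or> (tail H a, head H a) = (y, x)"
      unfolding parcs_mk_symmetric_iff U.arcs_del_arc U.tail_del_arc U.head_del_arc UH by blast
    then show "(x, y) \<in> parcs (mk_symmetric (H.del_arc ?k))"
      unfolding parcs_mk_symmetric_iff H.arcs_del_arc H.tail_del_arc H.head_del_arc
      using UH(1) by blast
  qed
  have path_row: "?row t = (-1) ^ undirected_dist ?F s t * sgn (walk_wt G w (undirected_path ?F s t)) * ?row s"
      "walk_wt G w (undirected_path ?F s t) \<noteq> 0"
    if "pre_digraph.awalk (with_proj (mk_symmetric ?F)) s (undirected_path ?F s t) t"
      "length (undirected_path ?F s t) = undirected_dist ?F s t" for s t
    using row_walk[OF family kH, of s "undirected_path ?F s t" t] that steps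
    unfolding awalk_mk_symmetric_iff by auto
  have k_eq: "?row ?u * csqrt ?W + ?row ?v * csqrt (cnj ?W) = 1"
  proof -
    have "?u \<noteq> ?v" using no_loops[OF kG] .
    then show ?thesis using row_arc[OF family kH kH, of ?u ?v] by (auto simp: inc_def)
  qed
  have recip: "a = 1 / b" if "a * b = 1" for a b :: complex
    using that by (metis eq_divide_imp mult_zero_right zero_neq_one)
  have e_C: "?k \<in> the_cycle U \<longleftrightarrow> c \<in> C"
    using U.e_in_C_iff[OF cU] by (simp add: U.the_cycle_C)
  have card_C: "card (the_cycle U) = card C"
    unfolding U.the_cycle_C by (rule card_e_image[OF C])
  show ?thesis
    unfolding U_def[symmetric]
  proof (cases "j \<in> verts U")
    case False
    let ?D = "H.core j"
    have D: "?D \<in> orbits" "j \<in> H.basin ?D"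
      using H.core_periodic[of j] j by (simp_all add: H.basin_def H_simps)
    have "?D \<noteq> C" using False j by (auto simp: vU H.basin_def H_simps)
    have "?k \<notin> e ` H.basin ?D"
    proof
      assume "?k \<in> e ` H.basin ?D"
      then obtain x where x: "x \<in> H.basin ?D" "e c = e x" by blast
      have "inj_on e (verts H)" using H.bij by (simp add: bij_betw_def)
      then have "c = x"
        using x(2) subsetD[OF H.basin_subset c] subsetD[OF H.basin_subset x(1)] by (rule inj_onD)
      then show False using x(1) c \<open>?D \<noteq> C\<close> by (auto simp: H.basin_def)
    qed
    then have "?row j = 0" using row_zero_basin[OF family kH D(1)] D(2) by blast
    then show "?row j = pinv_entry G w U ?k j" using False by (simp add: pinv_entry_def Let_def)
  next
    case jU: True
    show "?row j = pinv_entry G w U ?k j"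
    proof (cases "c \<in> C")
      case True
      have uvU: "?u \<in> verts U" "?v \<in> verts U" using uv cU U.f_in[OF cU] by auto
      have path: "pre_digraph.awalk (with_proj (mk_symmetric ?F)) ?u (undirected_path ?F ?u t) t"
          "length (undirected_path ?F ?u t) = undirected_dist ?F ?u t" if "t \<in> verts U" for t
        using undirected_path_acyclic[OF U.wf_digraph_del_arc U.cycles_del_cycle_arc[OF True] _
            U.rtrancl_del_cycle_arc[OF True uvU(1) that]] uvU(1)
        by (simp_all add: U.verts_del_arc)
      let ?z = "\<lambda>t. walk_wt G w (undirected_path ?F ?u t)"
      let ?\<epsilon> = "if even (card C) then 1 else - 1 :: complex"
      have dcomm: "undirected_dist ?F s t = undirected_dist ?F t s" for s t
        by (rule undirected_dist_commute[OF U.wf_digraph_del_arc])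
      have "undirected_dist ?F ?u ?v = card C - 1"
        using U.undirected_dist_cycle[OF True] uv dcomm by auto
      moreover have "3 \<le> card C" by (rule card_orbit_ge[OF C])
      \<comment> \<open>The path between the ends of the arc is one step shorter than the cycle,
        hence the minus sign in front of \<open>?\<epsilon>\<close>.\<close>
      ultimately have sign: "(-1) ^ undirected_dist ?F ?u ?v = - ?\<epsilon>"
        by (cases "card C") auto
      have "?row ?v = - ?\<epsilon> * sgn (?z ?v) * ?row ?u"
        using path_row(1)[OF path[OF uvU(2)]] unfolding sign .
      then have "?row ?u * csqrt ?W + (- ?\<epsilon> * sgn (?z ?v) * ?row ?u) * csqrt (cnj ?W) = 1"
        using k_eq by simp
      moreover have "csqrt ?W = csqrt (cnj ?W) * sgn ?W"
        using csqrt_cnj_sgn weight by blast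
      ultimately have "?row ?u * (csqrt (cnj ?W) * (sgn ?W - ?\<epsilon> * sgn (?z ?v))) = 1"
        by (simp add: algebra_simps)
      then have "?row ?u = 1 / (csqrt (cnj ?W) * (sgn ?W - ?\<epsilon> * sgn (?z ?v)))"
        by (rule recip)
      then have "?row j = (-1) ^ undirected_dist ?F j ?u *
          (sgn (?z j) / (csqrt (cnj ?W) * (sgn ?W - ?\<epsilon> * sgn (?z ?v))))"
        using path_row(1)[OF path[OF jU]] dcomm[of ?u j] by simp
      then show ?thesis
        using jU True e_C card_C unfolding pinv_entry_def Let_def sgn_eq by simp
    next
      case False
      note TB = cU False
      have arc_off: "?k \<notin> e ` C"
        using False U.e_in_C_iff[OF cU] by simp
      obtain x where x: "x \<in> C" "?row x = 0"
        using row_zero_cycle[OF family kH C arc_off] by blast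
      have xU: "x \<in> verts U - U.branch c"
        using x(1) U.C_not_in_branch[OF TB] U.C_subset by blast
      have off: "?row t = 0" if "t \<in> verts U - U.branch c" for t
        using row_zero_reach[OF family kH _ x(2)] U.rtrancl_off_branch[OF TB xU that]
          rtrancl_mono[OF steps] by blast
      have verts_up: "verts (unicyclic_part U ?k) = verts U - U.branch c"
        and verts_tp: "verts (tree_part U ?k) = U.branch c"
        using U.unicyclic_part_off_branch[OF TB] U.tree_part_branch[OF TB] by simp_all
      show ?thesis
      proof (cases "j \<in> U.branch c")
        case False
        then show ?thesis
          using off[of j] jU e_C \<open>c \<notin> C\<close> verts_up by (simp add: pinv_entry_def Let_def)
      next
        case jb: True
        let ?T = "U.branch c"
        have T: "?T \<subseteq> verts ?F" by (auto simp: U.branch_def U.verts_del_arc)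
        have closed: "y \<in> ?T" if "(x, y) \<in> parcs (mk_symmetric ?F)" "x \<in> ?T" for x y
          using U.branch_closed[OF cU that(1)] that(2) by simp
        have wfT: "wf_digraph (?F \<restriction> ?T)"
          by (rule wf_digraph.wellformed_induce_subgraph[OF U.wf_digraph_del_arc])
        have "Digraph_Component.connected (?F \<restriction> ?T)"
          using U.weak_components_del_arc[OF TB]
          by (auto simp: weak_components_def pre_digraph.max_subgraph_def)
        then have conn: "(j, c) \<in> (parcs (mk_symmetric (?F \<restriction> ?T)))\<^sup>*"
          unfolding wf_digraph.connected_iff_rtrancl[OF wfT]
          using jb U.self_in_branch[OF cU] by simp
        have jT: "j \<in> verts (?F \<restriction> ?T)" using jb by simp
        have "undirected_path (?F \<restriction> ?T) j c = undirected_path ?F j c"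
          "undirected_dist (?F \<restriction> ?T) j c = undirected_dist ?F j c"
          using undirected_path_restrict_closed[of ?F ?T j c] closed T jb by blast+
        moreover have "pre_digraph.awalk (with_proj (mk_symmetric (?F \<restriction> ?T))) j p c \<longleftrightarrow>
            pre_digraph.awalk (with_proj (mk_symmetric ?F)) j p c" for p
          using awalk_restrict_closed[of ?F ?T j p c] closed T jb by blast
        ultimately have P: "pre_digraph.awalk (with_proj (mk_symmetric ?F)) j (undirected_path ?F j c) c"
          "length (undirected_path ?F j c) = undirected_dist ?F j c"
          using undirected_path_acyclic[OF wfT U.cycles_branch[OF TB] jT conn] by simp_all
        let ?z = "walk_wt G w (undirected_path ?F j c)"
        have z: "?row c = (-1) ^ undirected_dist ?F j c * sgn ?z * ?row j" "?z \<noteq> 0"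
          using path_row[OF P] .
        have "f c \<in> verts U - U.branch c"
          using U.f_not_in_branch[OF TB] U.f_in[OF cU] by simp
        then have fc0: "?row (f c) = 0" by (rule off)
        \<comment> \<open>The path runs from \<open>j\<close> to \<open>c\<close>, so
          \<open>?row c\<close> is known in terms of \<open>?row j\<close> and the relation has to
          be inverted. The sign is its own inverse; inverting the phase gives modulus over
          weight.\<close>
        have "(-1) ^ d * ((-1) ^ d * y) = y" for d and y :: complex
          by (cases "even d") auto
        then have "(-1) ^ undirected_dist ?F j c * ?row c = sgn ?z * ?row j"
          unfolding z(1) by (simp add: mult.assoc)
        then have row_j: "?row j = (-1) ^ undirected_dist ?F j c * ?row c * (complex_of_real (cmod ?z) / ?z)"
          using z(2) by (simp add: sgn_eq field_simps)
        have fT: "f c \<notin> U.branch c" by (rule U.f_not_in_branch[OF TB])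
        have cT: "c \<in> U.branch c" by (rule U.self_in_branch[OF cU])
        from uv show ?thesis
        proof
          assume uv: "(?u, ?v) = (c, f c)"
          then have "?row c * csqrt ?W = 1" using k_eq fc0 by simp
          then have "?row c = 1 / csqrt ?W" by (rule recip)
          then show ?thesis
            using row_j jU e_C \<open>c \<notin> C\<close> verts_up verts_tp jb cT uv by (simp add: pinv_entry_def Let_def)
        next
          assume uv: "(?u, ?v) = (f c, c)"
          then have "?row c * csqrt (cnj ?W) = 1" using k_eq fc0 by simp
          then have "?row c = 1 / csqrt (cnj ?W)" by (rule recip)
          then show ?thesis
            using row_j jU e_C \<open>c \<notin> C\<close> verts_up verts_tp jb fT uv by (simp add: pinv_entry_def Let_def)
        qed
      qed
    qed
  qed
qed

end

theorem theorem5p3: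
  fixes G :: "(nat, nat) pre_digraph" and w :: "nat \<Rightarrow> nat \<Rightarrow> complex" and n m :: nat
  assumes "oriented_graph G"
    and "Digraph_Component.connected G"
    and "n \<ge> 2" and "verts G = {0..<n}"
    and "m \<ge> 1" and "arcs G = {0..<m}"
    and "\<And>k. k \<in> arcs G \<Longrightarrow>
           w (tail G k) (head G k) \<noteq> 0 \<and> w (tail G k) (head G k) \<notin> neg_reals"
    and "cycles G \<noteq> {}"
    and "\<exists>C \<in> cycles G. (odd (card C) \<and> cycle_wt G w C \<notin> neg_reals) \<or>
                        (even (card C) \<and> cycle_wt G w C \<notin> pos_reals)"
  shows "(\<forall>i<n. \<forall>j<n.
            mp_inverse (signless_laplacian G w) $$ (i, j) =
              1 / complex_of_real (vol4 G w) *
              (\<Sum>k<m.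
                 \<Sum>(Hr, Hs) \<in> {(Hr, Hs). Hr \<in> unicyclic_family G w \<and> Hs \<in> unicyclic_family G w \<and>
                                          k \<in> arcs Hr \<inter> arcs Hs}.
                   complex_of_real (subgraph_pi G w Hr) * complex_of_real (subgraph_pi G w Hs) *
                   cnj (incidence_pinv Hr w k i) * incidence_pinv Hs w k j)) \<and>
         (\<forall>H \<in> unicyclic_family G w. \<forall>U \<in> weak_components H. \<forall>k \<in> arcs U. \<forall>j<n.
            incidence_pinv H w k j = pinv_entry G w U k j)"
proof -
  interpret weighted_oriented_graph G w n
    by unfold_locales (use assms in auto)
  have "family \<noteq> {}"
    using unicyclic_family_nonempty[OF assms(2)] assms(9) by blast
  moreover have "incidence_pinv H w k j = pinv_entry G w U k j"
    if H: "H \<in> family" and U: "U \<in> weak_components H" and k: "k \<in> arcs U" and j: "j < n" for H U k j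
  proof -
    obtain e f where "weighted_functional_graph G w n H e f"
      by (rule unicyclic_family_choice[OF H], rule that)
    then interpret W: weighted_functional_graph G w n H e f .
    obtain C where C: "C \<in> W.orbits" "U = H \<restriction> W.H.basin C"
      using U W.H.weak_components_basin by (auto simp: W.H_simps)
    then obtain c where "c \<in> W.H.basin C" "k = e c"
      using k W.H.functional_graph_basin(2) by auto
    then show ?thesis using W.incidence_pinv_eq_pinv_entry[OF H C(1)] j C(2) by simp
  qed
  ultimately show ?thesis
    using mp_inverse_signless_laplacian[OF _ assms(6)] by blast
qed

end
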